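(* Let $d\ge 2$ and consider a meta-elliptical random vector $U\sim\mathcal{ME}_d(\Sigma,g)$, where the (positive definite) correlation matrix $\Sigma$ is not the identity matrix $I_d$. Let $c$ be the density of this copula and let $i$ and $j$ be two different indices in $\{1,\ldots,d\}$ for which the $(i,j)$-component of $\Sigma^{-1}$ is not zero. Let $c_{i,j}$ be the map of two variables that is equal to $c$ when all its arguments are set equal to $1/2$, except the $i$-th and the $j$-th. Assume that $c_{i,j}$ has finite first-order partial derivatives on $(0,1)^2$ and that the maps $u\mapsto\partial_k\ln c_{i,j}(u,1/2)$, $k\in\{1,2\}$, are locally Lipschitz on $(0,1)$. Let $b>0$ be a given real number, and consider two couples $(\Sigma_k,g_k)$, $k\in\{1,2\}$, where $\Sigma_k$ is a positive definite correlation matrix and $g_k\in\mathcal{G}$ (the set of regular density generators), that induce the same law of $U$ (i.e. $U\sim\mathcal{ME}_d(\Sigma_k,g_k)$ for $k=1,2$) and that both satisfy $$b=\frac{\pi^{(d-1)/2}}{\Gamma((d-1)/2)}\int_0^{+\infty}g_k(s)\,s^{(d-3)/2}\,ds .$$ Then these couples are essentially unique: $\Sigma_1=\Sigma_2$; the supports of $g_1$ and $g_2$ are the same interval (except possibly at its boundaries); and $g_1=g_2$ on the interior of their common support.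
   Context: A density generator in dimension $d$ is a measurable function $g:\mathbb{R}^+\to\mathbb{R}^+\cup\{+\infty\}$ such that $\frac{s_d}{2}\int_0^\infty t^{d/2-1}g(t)\,dt=1$, where $s_d=2\pi^{d/2}/\Gamma(d/2)$. For $\mu\in\mathbb{R}^d$ and a positive definite matrix $\Omega$, the elliptical distribution $\mathcal{E}_d(\mu,\Omega,g)$ is the law on $\mathbb{R}^d$ with Lebesgue density $x\mapsto|\Omega|^{-1/2}g\big((x-\mu)^\top\Omega^{-1}(x-\mu)\big)$. For a positive definite correlation matrix $\Sigma$ (i.e. with unit diagonal), $\mathcal{ME}_d(\Sigma,g)$ denotes the meta-elliptical copula, i.e. the (unique) copula of $\mathcal{E}_d(0,\Sigma,g)$; $U\sim\mathcal{ME}_d(\Sigma,g)$ means that the joint cdf of $U$ on $[0,1]^d$ is this copula. All margins of $\mathcal{E}_d(0,\Sigma,g)$ have the same density $f_g(t)=\frac{\pi^{(d-1)/2}}{\Gamma((d-1)/2)}\int_0^{+\infty}g(t^2+s)s^{(d-3)/2}\,ds$, $t\in\mathbb{R}$, with cdf $F_g(x)=\int_{-\infty}^x f_g(t)\,dt$ and quantile function $Q_g(u)=\inf\{x: F_g(x)\ge u\}$. The density of the copula $\mathcal{ME}_d(\Sigma,g)$ is $$c(u)=\frac{g\big(\vec Q_g(u)\,\Sigma^{-1}\,\vec Q_g(u)^\top\big)}{|\Sigma|^{1/2}\prod_{k=1}^d f_g(Q_g(u_k))},\qquad \vec Q_g(u)=[Q_g(u_1),\ldots,Q_g(u_d)],\quad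 u\in(0,1)^d .$$ The set $\mathcal{G}$ of regular density generators consists of the density generators $g$ (satisfying the normalization above) such that, setting $a_g:=\sup\{t: t>0,\ g(t^2)>0\}\in(0,+\infty]$: the map $t\mapsto g(t^2)$ from $\mathbb{R}$ to $\mathbb{R}^+$ is strictly positive and differentiable on $(-a_g,a_g)$; and the map $t\mapsto\int_0^{+\infty}g(t^2+r^2)r^{d-2}\,dr$ is finite and differentiable on $\mathbb{R}$. The support of $g$ is understood as the set $\{t\ge 0: g(t)>0\}$. *)

theory Defs
  imports "HOL-Probability.Probability"
begin

text \<open>Positive definite matrices are symmetric by convention.\<close>

definition positive_definite :: "real^'n^'n \<Rightarrow> bool" where
  "positive_definite A \<longleftrightarrow> transpose A = A \<and> (\<forall>x. x \<noteq> 0 \<longrightarrow> 0 < x \<bullet> (A *v x))"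

definition pd_correlation_matrix :: "real^'n^'n \<Rightarrow> bool" where
  "pd_correlation_matrix S \<longleftrightarrow> positive_definite S \<and> (\<forall>k. S $ k $ k = 1)"

text \<open>Generators are functions \<open>real \<Rightarrow> ennreal\<close> of which only the values on \<open>[0,\<infinity>)\<close> are
  ever used.\<close>

definition density_generator :: "nat \<Rightarrow> (real \<Rightarrow> ennreal) \<Rightarrow> bool" where
  "density_generator d g \<longleftrightarrow>
     g \<in> borel_measurable (restrict_space borel {0..}) \<and>
     ennreal ((2 * pi powr (real d / 2) / Gamma (real d / 2)) / 2) *
       (\<integral>\<^sup>+t\<in>{0<..}. ennreal (t powr (real d / 2 - 1)) * g t \<partial>lborel) = 1"

definition elliptical :: "real^'n \<Rightarrow> real^'n^'n \<Rightarrow> (real \<Rightarrow> ennreal) \<Rightarrow> (real^'n) measure" where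
  "elliptical \<mu> \<Omega> g =
     density lborel (\<lambda>x. ennreal (1 / sqrt (det \<Omega>)) * g ((x - \<mu>) \<bullet> (matrix_inv \<Omega> *v (x - \<mu>))))"

definition joint_cdf :: "(real^'n) measure \<Rightarrow> real^'n \<Rightarrow> real" where
  "joint_cdf L x = measure L {y. \<forall>k. y $ k \<le> x $ k}"

text \<open>Here and in \<open>copula_of\<close>, only the values of \<open>C\<close> on the unit cube matter.\<close>

definition is_copula :: "(real^'n \<Rightarrow> real) \<Rightarrow> bool" where
  "is_copula C \<longleftrightarrow>
     (\<exists>P. prob_space P \<and> sets P = sets borel \<and>
          (\<forall>k. distr P borel (\<lambda>x. x $ k) = uniform_measure lborel {0..1}) \<and>
          (\<forall>u\<in>{u. \<forall>k. u $ k \<in> {0..1}}. C u = joint_cdf P u))"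

text \<open>\<open>C\<close> is a copula of the law \<open>L\<close> in the sense of Sklar's theorem. If the margins of \<open>L\<close> have
  continuous cdfs, this determines \<open>C\<close> on the unit cube.\<close>

definition copula_of :: "(real^'n) measure \<Rightarrow> (real^'n \<Rightarrow> real) \<Rightarrow> bool" where
  "copula_of L C \<longleftrightarrow>
     is_copula C \<and>
     (\<forall>x. joint_cdf L x = C (\<chi> k. cdf (distr L borel (\<lambda>y. y $ k)) (x $ k)))"

definition meta_elliptical ::
    "'a measure \<Rightarrow> ('a \<Rightarrow> real^'n) \<Rightarrow> real^'n^'n \<Rightarrow> (real \<Rightarrow> ennreal) \<Rightarrow> bool" where
  "meta_elliptical M U S g \<longleftrightarrow> copula_of (elliptical 0 S g) (joint_cdf (distr M borel U))"

definition gen_marginal_density :: "nat \<Rightarrow> (real \<Rightarrow> ennreal) \<Rightarrow> real \<Rightarrow> ennreal" where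
  "gen_marginal_density d g t =
     ennreal (pi powr ((real d - 1) / 2) / Gamma ((real d - 1) / 2)) *
       (\<integral>\<^sup>+s\<in>{0<..}. g (t\<^sup>2 + s) * ennreal (s powr ((real d - 3) / 2)) \<partial>lborel)"

definition gen_marginal_cdf :: "nat \<Rightarrow> (real \<Rightarrow> ennreal) \<Rightarrow> real \<Rightarrow> real" where
  "gen_marginal_cdf d g x = enn2real (\<integral>\<^sup>+t\<in>{..x}. gen_marginal_density d g t \<partial>lborel)"

definition gen_quantile :: "nat \<Rightarrow> (real \<Rightarrow> ennreal) \<Rightarrow> real \<Rightarrow> real" where
  "gen_quantile d g u = Inf {x. u \<le> gen_marginal_cdf d g x}"

definition meta_elliptical_density ::
    "real^'n^'n \<Rightarrow> (real \<Rightarrow> ennreal) \<Rightarrow> real^'n \<Rightarrow> ennreal" where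
  "meta_elliptical_density S g u =
     (let q = (\<chi> k. gen_quantile CARD('n) g (u $ k)) in
      g (q \<bullet> (matrix_inv S *v q)) /
        (ennreal (sqrt (det S)) * (\<Prod>k\<in>UNIV. gen_marginal_density CARD('n) g (q $ k))))"

definition density_slice ::
    "real^'n^'n \<Rightarrow> (real \<Rightarrow> ennreal) \<Rightarrow> 'n \<Rightarrow> 'n \<Rightarrow> real \<Rightarrow> real \<Rightarrow> ennreal" where
  "density_slice S g i j u v =
     meta_elliptical_density S g (\<chi> k. if k = i then u else if k = j then v else 1 / 2)"

definition gen_radius :: "(real \<Rightarrow> ennreal) \<Rightarrow> ereal" where
  "gen_radius g = Sup (ereal ` {t. 0 < t \<and> 0 < g (t\<^sup>2)})"

text \<open>The finiteness of \<open>g (t\<^sup>2)\<close> for all \<open>t\<close> says that \<open>t \<mapsto> g (t\<^sup>2)\<close> takes its values in the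
  nonnegative reals.\<close>

definition regular_generator :: "nat \<Rightarrow> (real \<Rightarrow> ennreal) \<Rightarrow> bool" where
  "regular_generator d g \<longleftrightarrow>
     density_generator d g \<and>
     (\<forall>t. g (t\<^sup>2) < \<infinity>) \<and>
     (\<forall>t. - gen_radius g < ereal t \<and> ereal t < gen_radius g \<longrightarrow>
        0 < g (t\<^sup>2) \<and> (\<lambda>s. enn2real (g (s\<^sup>2))) differentiable (at t)) \<and>
     (\<forall>t. (\<integral>\<^sup>+r\<in>{0<..}. g (t\<^sup>2 + r\<^sup>2) * ennreal (r ^ (d - 2)) \<partial>lborel) < \<infinity>) \<and>
     (\<forall>t. (\<lambda>s. enn2real (\<integral>\<^sup>+r\<in>{0<..}. g (s\<^sup>2 + r\<^sup>2) * ennreal (r ^ (d - 2)) \<partial>lborel))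
        differentiable (at t))"

definition gen_support :: "(real \<Rightarrow> ennreal) \<Rightarrow> real set" where
  "gen_support g = {t. 0 \<le> t \<and> 0 < g t}"

text \<open>The library notion \<open>local_lipschitz\<close> is about families of functions indexed by a
  time parameter; a single function is a family that is constant in time.\<close>

definition locally_lipschitz_on :: "real set \<Rightarrow> (real \<Rightarrow> real) \<Rightarrow> bool" where
  "locally_lipschitz_on S f \<longleftrightarrow> local_lipschitz (UNIV :: real set) S (\<lambda>_. f)"

end

theory Submission
  imports Defs
begin

text \<open>
  Write \<open>F\<^sub>k\<close> and \<open>f\<^sub>k\<close> for the marginal cdf and density belonging to \<open>g\<^sub>k\<close>, and put
  \<open>G\<^sub>k t = g\<^sub>k (t\<^sup>2)\<close>.

  The probability that coordinates \<open>i\<close> and \<open>j\<close> of an elliptical vector are both nonpositive is the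
  proportion of the unit ball that lies in a wedge whose opening depends only, and strictly
  monotonically, on the correlation. Since the marginal medians are \<open>0\<close>, this probability is the value
  of the copula at \<open>1/2\<close> in these two coordinates, so the copula determines the correlation matrix.

  With a common correlation matrix, whose inverse we call \<open>A\<close>, the map \<open>T\<close> with \<open>F\<^sub>2 (T x) = F\<^sub>1 x\<close>,
  applied coordinatewise, transports one elliptical law to the other. Comparing the masses of small
  boxes gives a pointwise identity of the two densities. On the plane of coordinates \<open>i\<close>, \<open>j\<close> it
  reads, with \<open>W = 1 / T'\<close> and \<open>q\<close> the quadratic form of \<open>A\<close>,
  \<open>G\<^sub>1 (sqrt (q x y)) W(x) W(y) = G\<^sub>2 (sqrt (q (T x) (T y)))\<close>.
  Eliminating \<open>G\<^sub>2'\<close> from its two partial derivatives at \<open>y = 0\<close>, which is possible because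
  \<open>A\<^sub>i\<^sub>j \<noteq> 0\<close>, shows that \<open>(W(x) - 1) G\<^sub>1 (sqrt A\<^sub>i\<^sub>i x)\<close> has zero derivative; it vanishes at \<open>0\<close> because
  the marginal densities agree there. Hence \<open>T\<close> is the identity wherever \<open>sqrt A\<^sub>i\<^sub>i \<bar>x\<bar>\<close> is
  below both support radii, and the
  transport identity on the diagonals \<open>(x, x)\<close> and \<open>(x, -x)\<close> then compares \<open>G\<^sub>1\<close> and \<open>G\<^sub>2\<close> slightly beyond the
  smaller of the two support radii.
\<close>

section \<open>Positive definite matrices\<close>

definition orthonormal_wrt :: "real^'n^'n \<Rightarrow> (real^'n) set \<Rightarrow> bool" where
  "orthonormal_wrt A S \<longleftrightarrow> (\<forall>s\<in>S. \<forall>t\<in>S. s \<bullet> (A *v t) = (if s = t then 1 else 0))"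

lemma orthonormal_wrt_coeff:
  assumes "orthonormal_wrt A S" "finite S" "t \<in> S"
  shows "t \<bullet> (A *v (\<Sum>s\<in>S. c s *\<^sub>R s)) = c t"
proof -
  have "t \<bullet> (A *v (\<Sum>s\<in>S. c s *\<^sub>R s)) = (\<Sum>s\<in>S. c s * (t \<bullet> (A *v s)))"
    by (simp add: matrix_vector_mult_scaleR inner_sum_right
        linear_sum[OF matrix_vector_mul_linear] o_def)
  also have "\<dots> = (\<Sum>s\<in>S. if s = t then c s else 0)"
    using assms unfolding orthonormal_wrt_def by (intro sum.cong) auto
  also have "\<dots> = c t" using assms by simp
  finally show ?thesis .
qed

lemma orthonormal_wrt_independent:
  assumes "orthonormal_wrt A S" "finite S"
  shows "independent S"
proof (subst independent_explicit_finite_subsets, intro allI impI ballI)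
  fix T u v assume T: "T \<subseteq> S" "finite T" "(\<Sum>v\<in>T. u v *\<^sub>R v) = 0" "v \<in> T"
  have "orthonormal_wrt A T" using assms T unfolding orthonormal_wrt_def by (meson subsetD)
  from orthonormal_wrt_coeff[OF this \<open>finite T\<close> \<open>v \<in> T\<close>, of u] T show "u v = 0" by simp
qed

lemma positive_definite_symm:
  assumes "positive_definite A"
  shows "x \<bullet> (A *v y) = y \<bullet> (A *v x)"
  using assms unfolding positive_definite_def
  by (metis dot_lmul_matrix inner_commute transpose_matrix_vector)

lemma positive_definite_pos: "positive_definite A \<Longrightarrow> x \<noteq> 0 \<Longrightarrow> 0 < x \<bullet> (A *v x)"
  unfolding positive_definite_def by blast

lemma positive_definite_nonneg: "positive_definite A \<Longrightarrow> 0 \<le> x \<bullet> (A *v x)"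
  by (cases "x = 0") (auto dest: positive_definite_pos[of A x])

text \<open>One Gram-Schmidt step. Fewer than \<open>CARD('n)\<close> vectors do not span the space;
  subtracting from an outside vector its \<open>A\<close>-projection on the span and normalising
  gives the new member.\<close>

lemma orthonormal_wrt_extend:
  fixes A :: "real^'n^'n"
  assumes A: "positive_definite A" and S: "orthonormal_wrt A S" "finite S"
    and card: "card S < CARD('n)"
  obtains v where "v \<notin> S" "orthonormal_wrt A (insert v S)"
proof -
  have "span S \<noteq> UNIV"
  proof
    assume "span S = UNIV"
    then have "dim (UNIV :: (real^'n) set) \<le> card S"
      using dim_le_card[of UNIV S] S(2) by simp
    with card show False by simp
  qed
  then obtain x where x: "x \<notin> span S" by blast
  define w where "w = x - (\<Sum>s\<in>S. (s \<bullet> (A *v x)) *\<^sub>R s)"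
  have "w \<noteq> 0"
  proof
    assume "w = 0"
    then have "x = (\<Sum>s\<in>S. (s \<bullet> (A *v x)) *\<^sub>R s)" unfolding w_def by simp
    moreover have "(\<Sum>s\<in>S. (s \<bullet> (A *v x)) *\<^sub>R s) \<in> span S"
      by (intro span_sum span_scale span_base)
    ultimately show False using x by simp
  qed
  then have q: "0 < w \<bullet> (A *v w)" using A positive_definite_pos by blast
  have orth: "t \<bullet> (A *v w) = 0" if "t \<in> S" for t
    using orthonormal_wrt_coeff[OF S that] unfolding w_def
    by (simp add: matrix_vector_mult_diff_distrib inner_diff_right)
  define v where "v = (1 / sqrt (w \<bullet> (A *v w))) *\<^sub>R w"
  have v1: "v \<bullet> (A *v v) = 1"
    using q unfolding v_def by (simp add: matrix_vector_mult_scaleR)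
  have v0: "t \<bullet> (A *v v) = 0" if "t \<in> S" for t
    using orth[OF that] unfolding v_def by (simp add: matrix_vector_mult_scaleR)
  have "v \<notin> S" using v0[of v] v1 by auto
  moreover have "v \<bullet> (A *v t) = 0" if "t \<in> S" for t
    using v0[OF that] positive_definite_symm[OF A, of v t] by simp
  then have "orthonormal_wrt A (insert v S)"
    using S(1) v0 v1 \<open>v \<notin> S\<close> unfolding orthonormal_wrt_def
    by (metis insert_iff)
  ultimately show ?thesis by (rule that)
qed

text \<open>Iterates the extension step; it ends at exactly \<open>CARD('n)\<close> vectors, because
  an orthonormal family is independent and cannot be larger.\<close>

lemma orthonormal_wrt_basis:
  fixes A :: "real^'n^'n"
  assumes A: "positive_definite A" and S: "orthonormal_wrt A S" "finite S"
  obtains B where "S \<subseteq> B" "finite B" "orthonormal_wrt A B" "card B = CARD('n)"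
proof -
  have le: "card T \<le> CARD('n)" if "orthonormal_wrt A T" "finite T" for T
    using independent_card_le[OF orthonormal_wrt_independent[OF that]] that by simp
  have "\<exists>B. S \<subseteq> B \<and> finite B \<and> orthonormal_wrt A B \<and> card B = CARD('n)"
    using S le[OF S]
  proof (induction "CARD('n) - card S" arbitrary: S)
    case 0
    then show ?case by (intro exI[of _ S]) auto
  next
    case (Suc k)
    then have "card S < CARD('n)" by simp
    from orthonormal_wrt_extend[OF A Suc.prems(1,2) this] obtain v where
      v: "v \<notin> S" "orthonormal_wrt A (insert v S)" .
    have "k = CARD('n) - card (insert v S)" using Suc.hyps(2) Suc.prems(2) v(1) by simp
    moreover have "finite (insert v S)" using Suc.prems(2) by simp
    ultimately obtain B where "insert v S \<subseteq> B" "finite B" "orthonormal_wrt A B" "card B = CARD('n)"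
      using Suc.hyps(1) v(2) le[OF v(2)] by blast
    then show ?case by (intro exI[of _ B]) simp
  qed
  with that show ?thesis by blast
qed

text \<open>A family of full cardinality is a basis, and the coefficients of \<open>x\<close> in it
  are its \<open>A\<close>-pairings with the members.\<close>

lemma orthonormal_wrt_parseval:
  fixes A :: "real^'n^'n"
  assumes B: "orthonormal_wrt A B" "finite B" "card B = CARD('n)"
  shows "(\<Sum>s\<in>B. (s \<bullet> (A *v x))\<^sup>2) = x \<bullet> (A *v x)"
proof -
  have "independent B" using B orthonormal_wrt_independent by blast
  with B have "span B = UNIV"
    by (metis DIM_cart DIM_real card_eq_dim dim_UNIV dim_eq_full mult.right_neutral
        subset_UNIV top.extremum_uniqueI)
  then have "x \<in> span B" by simp
  then obtain c where c: "x = (\<Sum>s\<in>B. c s *\<^sub>R s)"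
    using span_finite[OF B(2)] by auto
  have cs: "s \<bullet> (A *v x) = c s" if "s \<in> B" for s
    unfolding c using orthonormal_wrt_coeff[OF B(1,2) that] .
  have "x \<bullet> (A *v x) = (\<Sum>s\<in>B. c s * (s \<bullet> (A *v x)))"
    by (subst c) (simp add: inner_sum_left)
  also have "\<dots> = (\<Sum>s\<in>B. (s \<bullet> (A *v x))\<^sup>2)"
    using cs by (simp add: power2_eq_square)
  finally show ?thesis by simp
qed

section \<open>Inverse matrices and whitening\<close>

lemma positive_definite_invertible:
  fixes S :: "real^'n^'n"
  assumes "positive_definite S"
  shows "invertible S"
proof -
  have "\<forall>x. S *v x = 0 \<longrightarrow> x = 0" using assms unfolding positive_definite_def by force
  then show ?thesis using invertible_left_inverse matrix_left_invertible_ker by blast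
qed

lemma matrix_inv_mult:
  fixes S :: "real^'n^'n"
  assumes "invertible S"
  shows "S ** matrix_inv S = mat 1" "matrix_inv S ** S = mat 1"
proof -
  have "S ** matrix_inv S = mat 1 \<and> matrix_inv S ** S = mat 1"
    using someI_ex[OF assms[unfolded invertible_def]] unfolding matrix_inv_def .
  then show "S ** matrix_inv S = mat 1" "matrix_inv S ** S = mat 1" by auto
qed

lemma matrix_inv_cancel:
  fixes S :: "real^'n^'n"
  assumes "invertible S"
  shows "S *v (matrix_inv S *v x) = x" "matrix_inv S *v (S *v x) = x"
  using matrix_inv_mult[OF assms] by (simp_all add: matrix_vector_mul_assoc)

lemma positive_definite_matrix_inv:
  fixes S :: "real^'n^'n"
  assumes "positive_definite S"
  shows "positive_definite (matrix_inv S)"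
  unfolding positive_definite_def
proof (intro conjI allI impI)
  note inv = positive_definite_invertible[OF assms]
  have "transpose (matrix_inv S) ** S = mat 1"
    using matrix_inv_mult(1)[OF inv] assms unfolding positive_definite_def
    by (metis matrix_transpose_mul transpose_mat)
  then show "transpose (matrix_inv S) = matrix_inv S"
    using matrix_inv_mult[OF inv] by (metis matrix_mul_assoc matrix_mul_lid matrix_mul_rid)
  fix x :: "real^'n" assume "x \<noteq> 0"
  then have "matrix_inv S *v x \<noteq> 0" using matrix_inv_cancel(1)[OF inv, of x] by auto
  then have "0 < (matrix_inv S *v x) \<bullet> (S *v (matrix_inv S *v x))"
    using positive_definite_pos[OF assms] by blast
  then show "0 < x \<bullet> (matrix_inv S *v x)" by (simp add: matrix_inv_cancel[OF inv] inner_commute)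
qed

lemma matrix_vector_axis: "(A :: real^'n^'m) *v axis i 1 = column i A"
  by (simp add: matrix_vector_mult_basis)

lemma axis_inner_matrix: "axis i 1 \<bullet> ((A :: real^'n^'n) *v axis j 1) = A $ i $ j"
  by (simp add: matrix_vector_axis inner_axis' column_def)

text \<open>With \<open>r = S $ i $ j\<close>, the form of \<open>S\<close> at the
  \<open>i\<close>-th unit vector minus \<open>r\<close> times the \<open>j\<close>-th equals
  \<open>1 - r\<^sup>2\<close>, so this number is positive.\<close>

lemma pd_correlation_abs_less_one:
  fixes S :: "real^'n^'n"
  assumes S: "pd_correlation_matrix S" and ij: "i \<noteq> j"
  shows "\<bar>S $ i $ j\<bar> < 1"
proof -
  have pd: "positive_definite S" and diag: "S $ k $ k = 1" for k
    using S unfolding pd_correlation_matrix_def by auto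
  have symm: "S $ j $ i = S $ i $ j"
    using positive_definite_symm[OF pd, of "axis i 1" "axis j 1"] by (simp add: axis_inner_matrix)
  define v where "v = axis i 1 - (S $ i $ j) *\<^sub>R (axis j 1 :: real^'n)"
  have "v $ i = 1" using ij unfolding v_def by (simp add: axis_def)
  then have "v \<noteq> 0" by auto
  then have "0 < v \<bullet> (S *v v)" using pd positive_definite_pos by blast
  also have "v \<bullet> (S *v v) = 1 - (S $ i $ j)\<^sup>2"
    unfolding v_def by (simp add: matrix_vector_mult_diff_distrib inner_diff_right inner_diff_left
        matrix_vector_mult_scaleR axis_inner_matrix diag symm power2_eq_square)
  finally show ?thesis by (simp add: abs_square_less_1)
qed

text \<open>\<open>L\<close> maps the ellipsoids of \<open>matrix_inv S\<close> to balls and is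
  adapted to the chosen indices: it keeps coordinate \<open>i\<close>, and coordinate
  \<open>j\<close> of \<open>x\<close> depends only on coordinates \<open>i\<close> and
  \<open>j\<close> of \<open>L *v x\<close>. So events about two coordinates become planar events
  under a spherical law.\<close>

lemma pd_correlation_whitening:
  fixes S :: "real^'n^'n"
  assumes S: "pd_correlation_matrix S" and ij: "i \<noteq> j"
  obtains L :: "real^'n^'n" where
    "\<And>x. (norm (L *v x))\<^sup>2 = x \<bullet> (matrix_inv S *v x)"
    "\<And>x. (L *v x) $ i = x $ i"
    "\<And>x. x $ j = (S $ i $ j) * (L *v x) $ i + sqrt (1 - (S $ i $ j)\<^sup>2) * (L *v x) $ j"
    "invertible L" "\<bar>det L\<bar> = 1 / sqrt (det S)"
proof -
  have pd: "positive_definite S" and diag: "S $ k $ k = 1" for k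
    using S unfolding pd_correlation_matrix_def by auto
  note inv = positive_definite_invertible[OF pd]
  let ?A = "matrix_inv S" and ?r = "S $ i $ j"
  let ?k = "sqrt (1 - ?r\<^sup>2)"
  note pdA = positive_definite_matrix_inv[OF pd]
  have symm: "S $ j $ i = ?r"
    using positive_definite_symm[OF pd, of "axis i 1" "axis j 1"] by (simp add: axis_inner_matrix)
  have k: "0 < 1 - ?r\<^sup>2" using pd_correlation_abs_less_one[OF S ij] by (simp add: abs_square_less_1)
  \<comment> \<open>The columns of \<open>S\<close> are dual to the coordinates: pairing
    \<open>e l\<close> with \<open>x\<close> through \<open>matrix_inv S\<close> returns
    \<open>x $ l\<close>.\<close>
  define e where "e l = S *v (axis l 1 :: real^'n)" for l
  have eA: "e l \<bullet> (?A *v x) = x $ l" for l x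
    using positive_definite_symm[OF pdA, of "e l" x] unfolding e_def
    by (simp add: matrix_inv_cancel[OF inv] inner_axis)
  have eee: "e l $ m = S $ m $ l" for l m unfolding e_def by (simp add: matrix_vector_axis column_def)
  \<comment> \<open>Gram-Schmidt applied to \<open>e i\<close>, \<open>e j\<close>: the vector
    \<open>e i\<close> is already normalised because the diagonal of \<open>S\<close> is 1, and
    \<open>w\<close> is the normalised remainder of \<open>e j\<close>.\<close>
  define w where "w = (1 / ?k) *\<^sub>R (e j - ?r *\<^sub>R e i)"
  have wA: "w \<bullet> (?A *v x) = (x $ j - ?r * x $ i) / ?k" for x
    unfolding w_def by (simp add: inner_diff_left eA)
  have "e i \<bullet> (?A *v e i) = 1" by (simp add: eA eee diag)
  moreover have ew: "e i \<bullet> (?A *v w) = 0" by (simp add: eA eee diag w_def symm)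
  moreover have "w \<bullet> (?A *v e i) = 0" by (simp add: wA eee diag symm)
  moreover have "w \<bullet> (?A *v w) = 1"
    using k real_sqrt_pow2[of "1 - ?r\<^sup>2"]
    by (simp add: wA) (simp add: w_def eee diag symm field_simps power2_eq_square)
  ultimately have "orthonormal_wrt ?A {e i, w}" "e i \<noteq> w" unfolding orthonormal_wrt_def by auto
  then obtain B where B: "{e i, w} \<subseteq> B" "finite B" "orthonormal_wrt ?A B" "card B = CARD('n)"
    using orthonormal_wrt_basis[OF pdA] by (metis finite.emptyI finite.insertI)
  have "card (B - {e i, w}) = card (UNIV - {i, j})"
    using B \<open>e i \<noteq> w\<close> ij by (simp add: card_Diff_subset)
  then obtain h where h: "bij_betw h (UNIV - {i, j}) (B - {e i, w})"
    using B(2) finite_same_card_bij by (metis finite_Diff finite)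
  \<comment> \<open>The orthonormal basis is enumerated by the coordinates, with \<open>e i\<close>
    and \<open>w\<close> in positions \<open>i\<close> and \<open>j\<close>; these vectors,
    multiplied by \<open>matrix_inv S\<close>, become the rows of \<open>L\<close>.\<close>
  define h' where "h' l = (if l = i then e i else if l = j then w else h l)" for l
  have "bij_betw h' ((UNIV - {i, j}) \<union> {i, j}) ((B - {e i, w}) \<union> {e i, w})"
  proof (rule bij_betw_combine)
    show "bij_betw h' (UNIV - {i, j}) (B - {e i, w})"
      using h by (rule bij_betw_cong[THEN iffD1, rotated]) (auto simp: h'_def)
    show "bij_betw h' {i, j} {e i, w}" using ij \<open>e i \<noteq> w\<close> by (auto simp: bij_betw_def h'_def)
  qed auto
  then have bij: "bij_betw h' UNIV B" using B(1) by (simp add: Un_absorb2 Un_commute insert_absorb)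
  define L :: "real^'n^'n" where "L = (\<chi> l. h' l v* ?A)"
  have L: "(L *v x) $ l = h' l \<bullet> (?A *v x)" for l x
    unfolding L_def by (simp add: matrix_vector_mul_component dot_lmul_matrix)
  have norm: "(norm (L *v x))\<^sup>2 = x \<bullet> (?A *v x)" for x
  proof -
    have "(norm (L *v x))\<^sup>2 = (\<Sum>l\<in>UNIV. (h' l \<bullet> (?A *v x))\<^sup>2)"
      by (simp add: norm_vec_def L2_set_def L sum_nonneg)
    also have "\<dots> = (\<Sum>s\<in>B. (s \<bullet> (?A *v x))\<^sup>2)"
      using sum.reindex_bij_betw[OF bij] .
    finally show ?thesis using orthonormal_wrt_parseval[OF B(3,2,4)] by simp
  qed
  have "invertible L"
  proof -
    have "\<forall>x. L *v x = 0 \<longrightarrow> x = 0"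
      using norm positive_definite_pos[OF pdA] by (metis less_irrefl norm_zero zero_power2)
    then show ?thesis using invertible_left_inverse matrix_left_invertible_ker by blast
  qed
  \<comment> \<open>Polarising the norm identity recovers the whole matrix, and its determinant
    gives that of \<open>L\<close> up to sign.\<close>
  have "transpose L ** L = ?A"
  proof -
    have ip: "(L *v x) \<bullet> (L *v y) = x \<bullet> (?A *v y)" for x y
    proof -
      have "(norm (L *v (x + y)))\<^sup>2 = (x + y) \<bullet> (?A *v (x + y))" by (rule norm)
      then show ?thesis using norm[of x] norm[of y] positive_definite_symm[OF pdA, of x y]
        by (simp add: matrix_vector_right_distrib power2_norm_eq_inner inner_add_left inner_add_right inner_commute)
    qed
    have "x \<bullet> ((transpose L ** L) *v y) = x \<bullet> (?A *v y)" for x y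
      using ip[of x y] dot_lmul_matrix[of x "transpose L" "L *v y"]
      by (simp add: matrix_vector_mul_assoc[symmetric] vector_transpose_matrix del: transpose_matrix_vector)
    then have "(transpose L ** L) *v y = ?A *v y" for y
      by (metis vector_eq_ldot)
    then show ?thesis by (subst matrix_eq) blast
  qed
  then have "(det L)\<^sup>2 = det ?A"
    using det_mul[of "transpose L" L] by (simp add: det_transpose power2_eq_square)
  also have "det ?A = 1 / det S"
  proof -
    have "det S * det ?A = 1" using matrix_inv_mult(1)[OF inv] det_mul[of S ?A] by simp
    then show ?thesis by (metis mult.commute mult_eq_0_iff nonzero_eq_divide_eq zero_neq_one)
  qed
  finally have "\<bar>det L\<bar> = 1 / sqrt (det S)"
    by (simp add: real_sqrt_divide flip: real_sqrt_abs)
  show ?thesis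
  proof (rule that[of L])
    show "(L *v x) $ i = x $ i" for x by (simp add: L h'_def eA)
    show "x $ j = ?r * (L *v x) $ i + ?k * (L *v x) $ j" for x
      using k ij by (simp add: L h'_def eA wA)
  qed fact+
qed

section \<open>Radial distributions\<close>

text \<open>Lower orthants are closed under intersection, generate the Borel sets, and exhaust the
  space along multiples of \<open>One\<close>.\<close>

lemma measure_eqI_atMost:
  fixes M N :: "'a::ordered_euclidean_space measure"
  assumes sets: "sets M = sets borel" "sets N = sets borel"
    and eq: "\<And>a. emeasure M {..a} = emeasure N {..a}"
    and fin: "\<And>a. emeasure M {..a} \<noteq> \<infinity>"
  shows "M = N"
proof (rule measure_eqI_generator_eq[where E = "range atMost" and \<Omega> = UNIV
      and A = "\<lambda>n. {..real n *\<^sub>R One}"])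
  show "Int_stable (range (atMost :: 'a \<Rightarrow> _))"
  proof (intro Int_stableI, safe)
    fix x y :: 'a
    have "{..x} \<inter> {..y} = {..inf x y}" by auto
    then show "{..x} \<inter> {..y} \<in> range atMost" by blast
  qed
  have "sets (borel :: 'a measure) = sigma_sets UNIV (range atMost)"
    by (subst borel_eq_atMost) (rule sets_measure_of, simp)
  then show "sets M = sigma_sets UNIV (range atMost)" "sets N = sigma_sets UNIV (range atMost)"
    using sets by simp_all
  show "(\<Union>n. {..real n *\<^sub>R One :: 'a}) = UNIV"
  proof safe
    fix x :: 'a
    obtain n :: nat where n: "norm x \<le> real n" using real_arch_simple by blast
    have "x \<bullet> b \<le> real n" if "b \<in> Basis" for b
      using Basis_le_norm[OF that, of x] n by simp
    then have "x \<le> real n *\<^sub>R One" by (auto simp: eucl_le[where 'a='a])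
    then show "x \<in> (\<Union>n. {..real n *\<^sub>R One})" by auto
  qed simp
qed (use eq fin in auto)

section \<open>Measures on the half-line with distribution function
  \<open>K * t powr p\<close>\<close>

definition power_law :: "real \<Rightarrow> real \<Rightarrow> real measure" where
  "power_law K p = density lborel (\<lambda>t. ennreal (K * p * t powr (p - 1)) * indicator {0<..} t)"

lemma sets_power_law [simp, measurable_cong]: "sets (power_law K p) = sets borel"
  by (simp add: power_law_def)

lemma emeasure_power_law:
  assumes "0 \<le> K" "0 < p"
  shows "emeasure (power_law K p) {..t} = ennreal (K * (max 0 t) powr p)"
proof (cases "0 \<le> t")
  case True
  have "((\<lambda>x. (K * p) * x powr (p - 1)) has_integral (K * p) * (t powr (p - 1 + 1) / (p - 1 + 1))) {0..t}"
    using assms True by (intro has_integral_mult_right has_integral_powr_from_0) auto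
  then have "((\<lambda>x. K * p * x powr (p - 1)) has_integral K * t powr p) {0..t}"
    using assms by simp
  from nn_integral_has_integral_lebesgue'[OF _ this] assms
  have *: "(\<integral>\<^sup>+x. ennreal (K * p * x powr (p - 1)) * indicator {0..t} x \<partial>lborel) = ennreal (K * t powr p)"
    by simp
  have "emeasure (power_law K p) {..t} =
      (\<integral>\<^sup>+x. (ennreal (K * p * x powr (p - 1)) * indicator {0<..} x) * indicator {..t} x \<partial>lborel)"
    unfolding power_law_def by (subst emeasure_density) auto
  also have "\<dots> = (\<integral>\<^sup>+x. ennreal (K * p * x powr (p - 1)) * indicator {0..t} x \<partial>lborel)"
    by (intro nn_integral_cong) (auto simp: indicator_def)
  finally show ?thesis using * True by simp
next
  case False
  have "emeasure (power_law K p) {..t} =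
      (\<integral>\<^sup>+x. (ennreal (K * p * x powr (p - 1)) * indicator {0<..} x) * indicator {..t} x \<partial>lborel)"
    unfolding power_law_def by (subst emeasure_density) auto
  also have "\<dots> = (\<integral>\<^sup>+(x::real). 0 \<partial>lborel)"
    using False by (intro nn_integral_cong) (auto simp: indicator_def)
  finally show ?thesis using False assms by simp
qed

lemma power_law_unique:
  assumes sets: "sets M = sets borel" and Kp: "0 \<le> K" "0 < p"
    and pos: "\<And>t. 0 < t \<Longrightarrow> emeasure M {..t} = ennreal (K * t powr p)"
    and neg: "\<And>t. t < 0 \<Longrightarrow> emeasure M {..t} = 0"
  shows "M = power_law K p"
proof -
  \<comment> \<open>The value at 0 is not among the hypotheses; it is bounded by
    \<open>K * t powr p\<close> for all \<open>t > 0\<close>, and this bound tends to 0.\<close>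
  have zero: "emeasure M {..0} = 0"
  proof -
    have "emeasure M {..0} \<le> ennreal (K * t powr p)" if "0 < t" for t
      using pos[OF that] emeasure_mono[of "{..0}" "{..t}" M] sets that by auto
    then have ev: "\<forall>\<^sub>F t in at_right (0::real). emeasure M {..0} \<le> ennreal (K * t powr p)"
      by (auto simp: eventually_at_right_field intro: exI[of _ 1])
    have "((\<lambda>t. K * t powr p) \<longlongrightarrow> K * 0 powr p) (at_right 0)"
      using Kp by (intro tendsto_intros tendsto_powr2) (auto simp: eventually_at_right_field intro: exI[of _ 1])
    then have "((\<lambda>t. ennreal (K * t powr p)) \<longlongrightarrow> 0) (at_right 0)"
      using Kp by (auto dest: tendsto_ennrealI)
    from tendsto_lowerbound[OF this ev] show ?thesis by simp
  qed
  show ?thesis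
  proof (rule measure_eqI_atMost)
    show eq: "emeasure M {..a} = emeasure (power_law K p) {..a}" for a
      unfolding emeasure_power_law[OF Kp] using pos neg zero Kp
      by (cases a "0::real" rule: linorder_cases) auto
    show "emeasure M {..a} \<noteq> \<infinity>" for a
      unfolding eq emeasure_power_law[OF Kp] by simp
  qed (use sets in auto)
qed

lemma nn_integral_power_law:
  assumes "\<phi> \<in> borel_measurable borel" "0 \<le> K" "0 < p"
  shows "(\<integral>\<^sup>+t. \<phi> t \<partial>power_law K p) =
    ennreal (K * p) * (\<integral>\<^sup>+t\<in>{0<..}. ennreal (t powr (p - 1)) * \<phi> t \<partial>lborel)"
proof -
  have "(\<integral>\<^sup>+t. \<phi> t \<partial>power_law K p)
    = (\<integral>\<^sup>+t. (ennreal (K * p * t powr (p - 1)) * indicator {0<..} t) * \<phi> t \<partial>lborel)"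
    unfolding power_law_def using assms by (subst nn_integral_density) auto
  also have "\<dots> = (\<integral>\<^sup>+t. ennreal (K * p) * (ennreal (t powr (p - 1)) * \<phi> t * indicator {0<..} t) \<partial>lborel)"
    using assms by (intro nn_integral_cong) (simp add: ennreal_mult' ac_simps)
  also have "\<dots> = ennreal (K * p) * (\<integral>\<^sup>+t\<in>{0<..}. ennreal (t powr (p - 1)) * \<phi> t \<partial>lborel)"
    using assms by (intro nn_integral_cmult) auto
  finally show ?thesis .
qed

text \<open>The condition \<open>r\<^sup>2 \<le> t\<close> confines \<open>r\<close> to an interval
  around 0 whose negative half carries no mass, and the \<open>p\<close>-th power of
  \<open>sqrt t\<close> is \<open>t powr (p / 2)\<close>. This stands for the substitution
  \<open>s = r\<^sup>2\<close>.\<close>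

lemma distr_square_power_law:
  assumes "0 \<le> K" "0 < p"
  shows "distr (power_law K p) borel (\<lambda>r. r\<^sup>2) = power_law K (p / 2)"
proof (rule power_law_unique)
  have "r\<^sup>2 \<le> t \<longleftrightarrow> r \<in> {- sqrt t..sqrt t}" for r t :: real
    by (subst real_sqrt_le_iff[symmetric]) (auto simp: abs_le_iff)
  then have vim: "(\<lambda>r. r\<^sup>2) -` {..t} \<inter> space (power_law K p) = {- sqrt t..sqrt t}" for t
    by (auto simp: power_law_def)
  fix t :: real assume t: "0 < t"
  have "emeasure (power_law K p) {..<- sqrt t} \<le> emeasure (power_law K p) {..0}"
    using real_sqrt_gt_zero[OF t] by (intro emeasure_mono) (auto simp del: real_sqrt_gt_0_iff)
  then have "emeasure (power_law K p) {..<- sqrt t} = 0"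
    using assms by (simp add: emeasure_power_law)
  then have "emeasure (power_law K p) {- sqrt t..sqrt t}
      = emeasure (power_law K p) ({- sqrt t..sqrt t} \<union> {..<- sqrt t})"
    by (intro emeasure_Un_null_set[symmetric]) (auto simp: null_sets_def)
  also have "{- sqrt t..sqrt t} \<union> {..<- sqrt t} = {..sqrt t}"
    using real_sqrt_gt_zero[OF t] by (auto simp del: real_sqrt_gt_0_iff)
  finally show "emeasure (distr (power_law K p) borel (\<lambda>r. r\<^sup>2)) {..t} = ennreal (K * t powr (p / 2))"
    using t vim[of t] assms
    by (simp add: emeasure_distr emeasure_power_law powr_half_sqrt[symmetric] powr_powr)
next
  fix t :: real assume t: "t < 0"
  have "\<not> r\<^sup>2 \<le> t" for r using t zero_le_power2[of r] by linarith
  then have "(\<lambda>r. r\<^sup>2) -` {..t} \<inter> space (power_law K p) = {}" by auto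
  then show "emeasure (distr (power_law K p) borel (\<lambda>r. r\<^sup>2)) {..t} = 0"
    by (simp add: emeasure_distr)
qed (use assms in auto)

section \<open>Laws of squared norms and integrals of radial functions\<close>

lemma distr_sum_squares_PiM:
  fixes A :: "'i set"
  assumes A: "finite A" "A \<noteq> {}"
  shows "distr (Pi\<^sub>M A (\<lambda>_. lborel)) borel (\<lambda>f. \<Sum>i\<in>A. (f i)\<^sup>2) =
    power_law (unit_ball_vol (real (card A))) (real (card A) / 2)"
proof (rule power_law_unique)
  let ?P = "Pi\<^sub>M A (\<lambda>_. lborel) :: ('i \<Rightarrow> real) measure"
  fix t :: real assume t: "0 < t"
  have "emeasure (distr ?P borel (\<lambda>f. \<Sum>i\<in>A. (f i)\<^sup>2)) {..t}
      = emeasure ?P ({f. sqrt (\<Sum>i\<in>A. (f i)\<^sup>2) \<le> sqrt t} \<inter> space ?P)"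
    by (subst emeasure_distr) (auto intro!: arg_cong[where f="emeasure _"])
  also have "\<dots> = ennreal (unit_ball_vol (real (card A)) * sqrt t ^ card A)"
    using A t by (intro emeasure_cball_aux) auto
  also have "sqrt t ^ card A = t powr (real (card A) / 2)"
    using t by (simp add: powr_half_sqrt[symmetric] powr_powr flip: powr_realpow)
  finally show "emeasure (distr ?P borel (\<lambda>f. \<Sum>i\<in>A. (f i)\<^sup>2)) {..t}
      = ennreal (unit_ball_vol (real (card A)) * t powr (real (card A) / 2))" .
next
  let ?P = "Pi\<^sub>M A (\<lambda>_. lborel) :: ('i \<Rightarrow> real) measure"
  fix t :: real assume t: "t < 0"
  have "(\<Sum>i\<in>A. (f i)\<^sup>2) > t" for f :: "'i \<Rightarrow> real"
    using t by (intro less_le_trans[OF t] sum_nonneg) auto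
  then have "(\<lambda>f. \<Sum>i\<in>A. (f i)\<^sup>2) -` {..t} \<inter> space ?P = {}" by (fastforce simp: not_le[symmetric])
  then show "emeasure (distr ?P borel (\<lambda>f. \<Sum>i\<in>A. (f i)\<^sup>2)) {..t} = 0"
    by (subst emeasure_distr) auto
qed (use A in \<open>auto simp: card_gt_0_iff\<close>)

text \<open>The part of a cone in the ball of radius \<open>sqrt t\<close> is the dilation by
  \<open>sqrt t\<close> of its part in the unit ball, so volumes scale by
  \<open>t powr (real DIM('a) / 2)\<close>.\<close>

lemma distr_norm_square_cone:
  fixes C :: "'a::euclidean_space set"
  assumes C[measurable]: "C \<in> sets borel" and cone: "\<And>c x. 0 < c \<Longrightarrow> x \<in> C \<Longrightarrow> c *\<^sub>R x \<in> C"
  shows "distr (density lborel (indicator C)) borel (\<lambda>x. (norm x)\<^sup>2) =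
    power_law (measure lborel (C \<inter> cball 0 1)) (real DIM('a) / 2)"
proof (rule power_law_unique)
  let ?D = "distr (density lborel (indicator C)) borel (\<lambda>x::'a. (norm x)\<^sup>2)"
  have fin: "emeasure lborel (C \<inter> cball 0 1) = ennreal (measure lborel (C \<inter> cball 0 1))"
    using emeasure_bounded_finite[of "C \<inter> cball 0 1"]
    by (intro emeasure_eq_ennreal_measure) (auto simp: bounded_Int)
  fix t :: real assume t: "0 < t"
  have cone': "c *\<^sub>R x \<in> C \<longleftrightarrow> x \<in> C" if "0 < c" for c and x :: 'a
    using cone[OF that, of x] cone[of "1 / c" "c *\<^sub>R x"] that by auto
  have "emeasure ?D {..t} = emeasure lborel (C \<inter> cball 0 (sqrt t))"
  proof -
    have "emeasure ?D {..t} = (\<integral>\<^sup>+x. indicator C x * indicator {x. (norm x)\<^sup>2 \<le> t} x \<partial>lborel)"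
      by (subst emeasure_distr) (auto simp: emeasure_density vimage_def)
    also have "\<dots> = (\<integral>\<^sup>+x. indicator (C \<inter> cball 0 (sqrt t)) x \<partial>lborel)"
      using t by (intro nn_integral_cong) (auto simp: indicator_def real_le_rsqrt sqrt_ge_absD real_sqrt_le_iff[symmetric, of "(norm _)\<^sup>2"])
    finally show ?thesis by simp
  qed
  also have "\<dots> = emeasure (density (distr lborel borel (\<lambda>x::'a. 0 + sqrt t *\<^sub>R x))
      (\<lambda>_. ennreal (\<bar>sqrt t\<bar> ^ DIM('a)))) (C \<inter> cball 0 (sqrt t))"
    using t by (subst lborel_affine[of "sqrt t" 0]) auto
  also have "\<dots> = ennreal (sqrt t ^ DIM('a)) *
      emeasure (distr lborel borel (\<lambda>x::'a. 0 + sqrt t *\<^sub>R x)) (C \<inter> cball 0 (sqrt t))"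
    using t by (subst emeasure_density_const) auto
  also have "emeasure (distr lborel borel (\<lambda>x::'a. 0 + sqrt t *\<^sub>R x)) (C \<inter> cball 0 (sqrt t)) =
      emeasure lborel (C \<inter> cball 0 1)"
    using t cone' by (subst emeasure_distr) (auto intro!: arg_cong[where f="emeasure _"])
  also have "sqrt t ^ DIM('a) = t powr (real DIM('a) / 2)"
    using t by (simp add: powr_half_sqrt[symmetric] powr_powr flip: powr_realpow)
  finally show "emeasure ?D {..t} = ennreal (measure lborel (C \<inter> cball 0 1) * t powr (real DIM('a) / 2))"
    unfolding fin by (simp add: ennreal_mult'' mult.commute)
next
  let ?D = "distr (density lborel (indicator C)) borel (\<lambda>x::'a. (norm x)\<^sup>2)"
  fix t :: real assume t: "t < 0"
  have "\<not> (norm x)\<^sup>2 \<le> t" for x :: 'a using t zero_le_power2[of "norm x"] by linarith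
  then have "(\<lambda>x::'a. (norm x)\<^sup>2) -` {..t} \<inter> space (density lborel (indicator C)) = {}"
    by auto
  then show "emeasure ?D {..t} = 0" by (subst emeasure_distr) auto
qed auto

text \<open>Plays the role of polar coordinates: a radial integral over a cone factors into the
  volume of the section by the unit ball and a one-dimensional integral that does not depend on the
  cone.\<close>

lemma nn_integral_norm_square_cone:
  fixes C :: "'a::euclidean_space set"
  assumes C[measurable]: "C \<in> sets borel" and cone: "\<And>c x. 0 < c \<Longrightarrow> x \<in> C \<Longrightarrow> c *\<^sub>R x \<in> C"
    and \<phi>[measurable]: "\<phi> \<in> borel_measurable borel"
  shows "(\<integral>\<^sup>+x\<in>C. \<phi> ((norm x)\<^sup>2) \<partial>lborel) = emeasure lborel (C \<inter> cball 0 1) *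
    (ennreal (real DIM('a) / 2) * (\<integral>\<^sup>+t\<in>{0<..}. ennreal (t powr (real DIM('a) / 2 - 1)) * \<phi> t \<partial>lborel))"
proof -
  have fin: "emeasure lborel (C \<inter> cball 0 1) = ennreal (measure lborel (C \<inter> cball 0 1))"
    using emeasure_bounded_finite[of "C \<inter> cball 0 1"]
    by (intro emeasure_eq_ennreal_measure) (auto simp: bounded_Int)
  have "(\<integral>\<^sup>+x\<in>C. \<phi> ((norm x)\<^sup>2) \<partial>lborel) = (\<integral>\<^sup>+x. indicator C x * \<phi> ((norm x)\<^sup>2) \<partial>lborel)"
    by (simp add: mult.commute)
  also have "\<dots> = (\<integral>\<^sup>+t. \<phi> t \<partial>distr (density lborel (indicator C)) borel (\<lambda>x::'a. (norm x)\<^sup>2))"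
    by (subst nn_integral_distr) (auto simp: nn_integral_density)
  also have "\<dots> = (\<integral>\<^sup>+t. \<phi> t \<partial>power_law (measure lborel (C \<inter> cball 0 1)) (real DIM('a) / 2))"
    by (subst distr_norm_square_cone[OF C cone]) auto
  also have "\<dots> = emeasure lborel (C \<inter> cball 0 1) *
    (ennreal (real DIM('a) / 2) * (\<integral>\<^sup>+t\<in>{0<..}. ennreal (t powr (real DIM('a) / 2 - 1)) * \<phi> t \<partial>lborel))"
    unfolding fin
    by (subst nn_integral_power_law) (simp_all add: ennreal_mult' mult.assoc del: times_divide_eq_right)
  finally show ?thesis .
qed

text \<open>Fubini splits off the coordinate along \<open>b\<close>; the sum of the squares of the
  other coordinates is then replaced by its power law. With a radial density this computes the law
  of one coordinate.\<close>

lemma nn_integral_lborel_component_norm: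
  fixes h :: "real \<Rightarrow> ennreal" and \<phi> :: "real \<Rightarrow> ennreal" and b :: "'a::euclidean_space"
  assumes b: "b \<in> Basis" and d: "2 \<le> DIM('a)"
    and h[measurable]: "h \<in> borel_measurable borel" and \<phi>[measurable]: "\<phi> \<in> borel_measurable borel"
  shows "(\<integral>\<^sup>+x. h (x \<bullet> b) * \<phi> ((norm x)\<^sup>2) \<partial>lborel) =
    (\<integral>\<^sup>+y. h y * (\<integral>\<^sup>+s. \<phi> (y\<^sup>2 + s)
       \<partial>power_law (unit_ball_vol (real (DIM('a) - 1))) (real (DIM('a) - 1) / 2)) \<partial>lborel)"
proof -
  interpret product_sigma_finite "\<lambda>_::'a. lborel :: real measure" by standard
  let ?A = "Basis - {b} :: 'a set"
  have A: "finite ?A" "card ?A = DIM('a) - 1" "b \<notin> ?A"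
    using card_Diff_singleton[OF b] by auto
  have ne: "?A \<noteq> {}" using A(2) d by (metis card.empty diff_is_0_eq not_one_le_zero numeral_2_eq_2 not_less_eq_eq One_nat_def)
  have ins: "insert b ?A = Basis" using b by auto
  let ?F = "\<lambda>f. h (f b) * \<phi> ((f b)\<^sup>2 + (\<Sum>i\<in>?A. (f i)\<^sup>2))"
  have "(\<integral>\<^sup>+x. h (x \<bullet> b) * \<phi> ((norm x)\<^sup>2) \<partial>lborel) =
      (\<integral>\<^sup>+f. h ((\<Sum>i\<in>Basis. f i *\<^sub>R i :: 'a) \<bullet> b) * \<phi> ((norm (\<Sum>i\<in>Basis. f i *\<^sub>R i :: 'a))\<^sup>2)
        \<partial>(\<Pi>\<^sub>M i\<in>Basis. lborel))"
    by (subst lborel_eq) (subst nn_integral_distr, auto)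
  also have "\<dots> = (\<integral>\<^sup>+f. ?F f \<partial>(\<Pi>\<^sub>M i\<in>insert b ?A. lborel))"
  proof -
    have "(norm (\<Sum>i\<in>Basis. f i *\<^sub>R i :: 'a))\<^sup>2 = (f b)\<^sup>2 + (\<Sum>i\<in>?A. (f i)\<^sup>2)" for f
    proof -
      let ?x = "\<Sum>i\<in>Basis. f i *\<^sub>R i :: 'a"
      have "(norm ?x)\<^sup>2 = (\<Sum>i\<in>Basis. (?x \<bullet> i) * (?x \<bullet> i))"
        by (simp only: power2_norm_eq_inner euclidean_inner[of ?x ?x])
      also have "\<dots> = (\<Sum>i\<in>Basis. (f i)\<^sup>2)"
        by (intro sum.cong) (simp_all add: power2_eq_square)
      finally have "(norm ?x)\<^sup>2 = (\<Sum>i\<in>Basis. (f i)\<^sup>2)" .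
      then show ?thesis using b by (simp add: sum.remove)
    qed
    then show ?thesis unfolding ins using b by simp
  qed
  also have "\<dots> = (\<integral>\<^sup>+y. \<integral>\<^sup>+f. ?F (f(b := y)) \<partial>Pi\<^sub>M ?A (\<lambda>_. lborel) \<partial>lborel)"
    using A by (intro product_nn_integral_insert_rev) auto
  also have "\<dots> = (\<integral>\<^sup>+y. h y * (\<integral>\<^sup>+f. \<phi> (y\<^sup>2 + (\<Sum>i\<in>?A. (f i)\<^sup>2)) \<partial>Pi\<^sub>M ?A (\<lambda>_. lborel)) \<partial>lborel)"
  proof (intro nn_integral_cong)
    fix y :: real
    have "?F (f(b := y)) = h y * \<phi> (y\<^sup>2 + (\<Sum>i\<in>?A. (f i)\<^sup>2))" for f
      by (auto intro!: arg_cong[where f=\<phi>] sum.cong arg_cong2[where f="(*)"])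
    then show "(\<integral>\<^sup>+f. ?F (f(b := y)) \<partial>Pi\<^sub>M ?A (\<lambda>_. lborel)) =
        h y * (\<integral>\<^sup>+f. \<phi> (y\<^sup>2 + (\<Sum>i\<in>?A. (f i)\<^sup>2)) \<partial>Pi\<^sub>M ?A (\<lambda>_. lborel))"
      by (simp only:) (subst nn_integral_cmult, auto)
  qed
  also have "\<dots> = (\<integral>\<^sup>+y. h y * (\<integral>\<^sup>+s. \<phi> (y\<^sup>2 + s)
      \<partial>distr (Pi\<^sub>M ?A (\<lambda>_. lborel)) borel (\<lambda>f. \<Sum>i\<in>?A. (f i)\<^sup>2)) \<partial>lborel)"
    by (subst nn_integral_distr) auto
  finally show ?thesis unfolding distr_sum_squares_PiM[OF A(1) ne] A(2) .
qed

section \<open>Linear images of Lebesgue measure\<close>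

text \<open>With all coordinates except that along \<open>b\<close> fixed, the shear is a
  translation along \<open>b\<close>, which leaves the inner integral unchanged.\<close>

lemma nn_integral_lborel_shear:
  fixes h :: "'a::euclidean_space \<Rightarrow> ennreal"
  assumes b: "b \<in> Basis" "b' \<in> Basis" "b' \<noteq> b" and h[measurable]: "h \<in> borel_measurable borel"
  shows "(\<integral>\<^sup>+x. h (x + (x \<bullet> b') *\<^sub>R b) \<partial>lborel) = (\<integral>\<^sup>+x. h x \<partial>lborel)"
proof -
  interpret product_sigma_finite "\<lambda>_::'a. lborel :: real measure" by standard
  let ?A = "Basis - {b} :: 'a set"
  let ?v = "\<lambda>f. \<Sum>i\<in>?A. f i *\<^sub>R i :: 'a"
  have ins: "Basis = insert b ?A" "finite ?A" "b \<notin> ?A" using b by auto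
  have v: "(\<Sum>i\<in>Basis. f i *\<^sub>R i :: 'a) = f b *\<^sub>R b + ?v f" for f
    using b by (simp add: sum.remove)
  have sh: "(\<Sum>i\<in>Basis. f i *\<^sub>R i :: 'a) + ((\<Sum>i\<in>Basis. f i *\<^sub>R i :: 'a) \<bullet> b') *\<^sub>R b =
      (f b + f b') *\<^sub>R b + ?v f" for f
  proof -
    have "(\<Sum>i\<in>Basis. f i *\<^sub>R i :: 'a) \<bullet> b' = f b'" using b by simp
    then show ?thesis by (simp only:) (simp add: v scaleR_add_left)
  qed
  have fub: "(\<integral>\<^sup>+f. F f \<partial>(\<Pi>\<^sub>M i\<in>Basis. lborel)) =
      (\<integral>\<^sup>+f. \<integral>\<^sup>+y. F (f(b := y)) \<partial>lborel \<partial>Pi\<^sub>M ?A (\<lambda>_. lborel))"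
    if "F \<in> borel_measurable (\<Pi>\<^sub>M i\<in>Basis. lborel)" for F :: "('a \<Rightarrow> real) \<Rightarrow> ennreal"
    using product_nn_integral_insert[OF ins(2,3), of F, folded ins(1)] that by simp
  have v': "?v (f(b := y)) = ?v f" for f y by (intro sum.cong) auto
  have "(\<integral>\<^sup>+x. h (x + (x \<bullet> b') *\<^sub>R b) \<partial>lborel) =
      (\<integral>\<^sup>+f. h ((f b + f b') *\<^sub>R b + ?v f) \<partial>(\<Pi>\<^sub>M i\<in>Basis. lborel))"
    apply (subst lborel_eq)
    apply (subst nn_integral_distr)
    apply (simp_all add: sh)
    done
  also have "\<dots> = (\<integral>\<^sup>+f. \<integral>\<^sup>+y. h ((y + f b') *\<^sub>R b + ?v f) \<partial>lborel \<partial>Pi\<^sub>M ?A (\<lambda>_. lborel))"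
    using b by (subst fub) (auto simp: v')
  also have "\<dots> = (\<integral>\<^sup>+f. \<integral>\<^sup>+y. h (y *\<^sub>R b + ?v f) \<partial>lborel \<partial>Pi\<^sub>M ?A (\<lambda>_. lborel))"
  proof (rule nn_integral_cong)
    fix f
    show "(\<integral>\<^sup>+y. h ((y + f b') *\<^sub>R b + ?v f) \<partial>lborel) = (\<integral>\<^sup>+y. h (y *\<^sub>R b + ?v f) \<partial>lborel)"
      by (subst (2) nn_integral_real_affine[where c = 1 and t = "f b'"]) (auto simp: add.commute)
  qed
  also have "\<dots> = (\<integral>\<^sup>+f. h (f b *\<^sub>R b + ?v f) \<partial>(\<Pi>\<^sub>M i\<in>Basis. lborel))"
    using b by (subst fub) (auto simp: v')
  also have "\<dots> = (\<integral>\<^sup>+x. h x \<partial>lborel)"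
    by (subst (2) lborel_eq) (subst nn_integral_distr, simp_all flip: v)
  finally show ?thesis .
qed

lemma prod_Basis_cart: "(\<Prod>b\<in>Basis. (x :: real^'n) \<bullet> b) = (\<Prod>i\<in>UNIV. x $ i)"
proof -
  have "(\<Prod>b\<in>Basis. x \<bullet> b) = (\<Prod>b\<in>range (\<lambda>i::'n. axis i (1::real)). x \<bullet> b)"
    by (intro prod.cong) (auto simp: Basis_vec_def)
  also have "\<dots> = (\<Prod>i\<in>UNIV. x $ i)"
    by (subst prod.reindex) (auto simp: inj_on_def axis_eq_axis inner_axis)
  finally show ?thesis .
qed

lemma measurable_matrix_vector_mult [measurable]: "(*v) (L :: real^'n^'m) \<in> borel_measurable borel"
  by (intro borel_measurable_continuous_onI linear_continuous_on matrix_vector_mul_bounded_linear)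

text \<open>Unlike \<open>measure_linear_image\<close>, this needs no wellorder on the index type.\<close>

lemma lborel_linear:
  fixes L :: "real^'n^'n"
  assumes "det L \<noteq> 0"
  shows "lborel = density (distr lborel borel ((*v) L)) (\<lambda>_. ennreal \<bar>det L\<bar>)"
  using assms
\<comment> \<open>The identity is multiplicative in \<open>L\<close>, so elementary factors suffice.
  A factor with a zero row has determinant 0 and is excluded by the assumption.\<close>
proof (induction L rule: induct_matrix_elementary_alt
    [case_names mult zero_row diagonal swap1 idplus])
  case (mult A B)
  then have nz: "det A \<noteq> 0" "det B \<noteq> 0" by (auto simp: det_mul)
  have "lborel = density (distr (density (distr lborel borel ((*v) B)) (\<lambda>_. ennreal \<bar>det B\<bar>))
      borel ((*v) A)) (\<lambda>_. ennreal \<bar>det A\<bar>)"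
    using mult.IH nz by simp
  also have "\<dots> = density (distr lborel borel ((*v) (A ** B))) (\<lambda>_. ennreal \<bar>det (A ** B)\<bar>)"
  proof (rule measure_eqI)
    fix X :: "(real^'n) set" assume "X \<in> sets (density (distr (density (distr lborel borel ((*v) B))
        (\<lambda>_. ennreal \<bar>det B\<bar>)) borel ((*v) A)) (\<lambda>_. ennreal \<bar>det A\<bar>))"
    then have [measurable]: "X \<in> sets borel" by simp
    have [measurable]: "(*v) A -` X \<in> sets borel" for A :: "real^'n^'n"
      using measurable_sets_borel[of "(*v) A" borel X] by simp
    show "emeasure (density (distr (density (distr lborel borel ((*v) B)) (\<lambda>_. ennreal \<bar>det B\<bar>))
        borel ((*v) A)) (\<lambda>_. ennreal \<bar>det A\<bar>)) X =
      emeasure (density (distr lborel borel ((*v) (A ** B))) (\<lambda>_. ennreal \<bar>det (A ** B)\<bar>)) X"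
      by (simp add: emeasure_density_const emeasure_distr det_mul abs_mult ennreal_mult mult.assoc
          vimage_comp o_def matrix_vector_mul_assoc)
  qed simp
  finally show ?case .
next
  case (zero_row A i)
  then show ?case by (metis det_zero_row(1))
next
  case (diagonal A)
  then have det: "det A = (\<Prod>i\<in>UNIV. A $ i $ i)" by (intro det_diagonal) auto
  let ?c = "\<lambda>b. (\<chi> i. A $ i $ i) \<bullet> b"
  have nz: "?c b \<noteq> 0" if "b \<in> Basis" for b
    using that det diagonal.prems by (auto simp: Basis_vec_def inner_axis)
  have eq: "0 + (\<Sum>j\<in>Basis. (?c j * (x \<bullet> j)) *\<^sub>R j) = A *v x" for x
  proof (rule euclidean_eqI)
    fix b :: "real^'n" assume "b \<in> Basis"
    then obtain i where b: "b = axis i 1" by (auto simp: Basis_vec_def)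
    have "(A *v x) $ i = (\<Sum>j\<in>UNIV. A $ i $ j * x $ j)" by (simp add: matrix_vector_mult_def)
    also have "\<dots> = (\<Sum>j\<in>UNIV. if j = i then A $ i $ i * x $ i else 0)"
      using diagonal.hyps by (intro sum.cong) auto
    finally have "(A *v x) $ i = A $ i $ i * x $ i" by simp
    moreover have "(0 + (\<Sum>j\<in>Basis. (?c j * (x \<bullet> j)) *\<^sub>R j)) \<bullet> b = ?c b * (x \<bullet> b)"
      using \<open>b \<in> Basis\<close> by simp
    ultimately show "(0 + (\<Sum>j\<in>Basis. (?c j * (x \<bullet> j)) *\<^sub>R j)) \<bullet> b = (A *v x) \<bullet> b"
      by (simp only: b inner_axis) simp
  qed
  have "(\<Prod>b\<in>Basis. \<bar>?c b\<bar>) = \<bar>det A\<bar>"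
    unfolding det by (simp add: prod_Basis_cart flip: abs_prod)
  with lborel_affine_euclidean[of ?c 0] nz show ?case unfolding eq by (simp add: prod_ennreal)
next
  case (swap1 m n)
  let ?t = "Transposition.transpose m n" let ?A = "(\<chi> i j. mat 1 $ i $ ?t j) :: real^'n^'n"
  have A: "(?A *v x) $ i = x $ ?t i" for x i
  proof -
    have "(?A *v x) $ i = (\<Sum>j\<in>UNIV. (if i = ?t j then 1 else 0) * x $ j)"
      by (simp add: matrix_vector_mult_def mat_def)
    also have "\<dots> = (\<Sum>j\<in>UNIV. if j = ?t i then x $ j else 0)"
      by (intro sum.cong) (auto simp: transpose_eq_iff)
    finally show ?thesis by simp
  qed
  have det: "\<bar>det ?A\<bar> = 1"
    by (simp add: det_permute_columns permutes_swap_id sign_swap_id abs_mult)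
  have "lborel = density (distr lborel borel ((*v) ?A)) (\<lambda>_. 1)"
  \<comment> \<open>A swap of two coordinates maps boxes to boxes with the same side lengths, and
    Lebesgue measure is determined by its values on boxes.\<close>
  proof (rule lborel_eqI)
    fix l u :: "real^'n" assume le: "\<And>b. b \<in> Basis \<Longrightarrow> l \<bullet> b \<le> u \<bullet> b"
    let ?l = "\<chi> i. l $ ?t i" and ?u = "\<chi> i. u $ ?t i"
    have lec: "l $ i \<le> u $ i" for i using le[of "axis i 1"] by (simp add: inner_axis)
    have "(*v) ?A -` box l u = box ?l ?u"
      by (auto simp: mem_box_cart A) (metis transpose_involutory)+
    then have "emeasure (density (distr lborel borel ((*v) ?A)) (\<lambda>_. 1)) (box l u) = emeasure lborel (box ?l ?u)"
      by (simp add: emeasure_distr density_1)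
    also have "\<dots> = ennreal (\<Prod>b\<in>Basis. (?u - ?l) \<bullet> b)"
      using lec by (intro emeasure_lborel_box) (auto simp: Basis_vec_def inner_axis)
    also have "(\<Prod>b\<in>Basis. (?u - ?l) \<bullet> b) = (\<Prod>i\<in>UNIV. (u - l) $ ?t i)"
      by (simp add: prod_Basis_cart)
    also have "\<dots> = (\<Prod>i\<in>UNIV. (u - l) $ i)"
      using prod.permute[OF permutes_swap_id, of m UNIV n "\<lambda>i. (u - l) $ i"] by (simp add: o_def)
    finally show "emeasure (density (distr lborel borel ((*v) ?A)) (\<lambda>_. 1)) (box l u) =
        ennreal (\<Prod>b\<in>Basis. (u - l) \<bullet> b)" by (simp add: prod_Basis_cart)
  qed simp
  then show ?case using det by simp
next
  case (idplus m n)
  let ?A = "(\<chi> i j. of_bool (i = m \<and> j = n \<or> i = j)) :: real^'n^'n"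
  have A: "?A *v x = x + (x \<bullet> axis n 1) *\<^sub>R axis m 1" for x
  proof (subst vec_eq_iff, rule allI)
    fix i
    have "(?A *v x) $ i = (\<Sum>j\<in>UNIV. (if j = i then x $ i else 0) + (if j = n then of_bool (i = m) * x $ n else 0))"
      using idplus.hyps unfolding matrix_vector_mult_def vec_lambda_beta by (intro sum.cong) auto
    also have "\<dots> = x $ i + of_bool (i = m) * x $ n" by (simp add: sum.distrib)
    finally show "(?A *v x) $ i = (x + (x \<bullet> axis n 1) *\<^sub>R axis m 1) $ i"
      by (simp add: inner_axis) (simp add: axis_def)
  qed
  have "?A = (\<chi> k. if k = m then row m (mat 1) + 1 *s row n (mat 1) else row k (mat 1))"
    using idplus.hyps by (auto simp: vec_eq_iff row_def mat_def)
  then have det: "det ?A = 1" using det_row_operation[OF idplus.hyps, of "mat 1 :: real^'n^'n" 1] by simp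
  have "lborel = distr lborel borel ((*v) ?A)"
  proof (rule measure_eqI)
    fix X :: "(real^'n) set" assume "X \<in> sets lborel"
    then have [measurable]: "X \<in> sets borel" by simp
    have "emeasure (distr lborel borel ((*v) ?A)) X = (\<integral>\<^sup>+x. indicator X (?A *v x) \<partial>lborel)"
      using nn_integral_distr[of "(*v) ?A" lborel borel "indicator X"] by simp
    also have "\<dots> = (\<integral>\<^sup>+x. indicator X x \<partial>lborel)"
      unfolding A using idplus.hyps by (intro nn_integral_lborel_shear) (auto simp: axis_eq_axis)
    finally show "emeasure lborel X = emeasure (distr lborel borel ((*v) ?A)) X" by simp
  qed simp
  then show ?case using det by (simp add: density_1)
qed

section \<open>Elliptical laws\<close>

text \<open>Half the surface area of the unit sphere, written in two ways; it reconciles the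
  constants in the definition of a generator and of its margin with ball volumes.\<close>

lemma unit_ball_vol_half:
  assumes "0 < m" shows "unit_ball_vol m * (m / 2) = pi powr (m / 2) / Gamma (m / 2)"
proof -
  have "Gamma (m / 2 + 1) = (m / 2) * Gamma (m / 2)"
    using assms by (intro Gamma_plus1) (auto simp: nonpos_Ints_def)
  then show ?thesis using assms unfolding unit_ball_vol_def by simp
qed

lemma borel_measurable_vec_nth [measurable]: "(\<lambda>x :: real^'n. x $ k) \<in> borel_measurable borel"
  by (intro borel_measurable_continuous_onI continuous_intros)

locale elliptical_law =
  fixes S :: "real^'n^'n" and g :: "real \<Rightarrow> ennreal"
  assumes S: "pd_correlation_matrix S" and card: "2 \<le> CARD('n)"
    and gen: "density_generator CARD('n) g"
begin

text \<open>A generator is only measurable on \<open>[0,\<infinity>)\<close>; \<open>gplus\<close> extends it to a Borel function.\<close>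

definition gplus :: "real \<Rightarrow> ennreal" where "gplus t = g (max 0 t)"

lemma gplus_eq: "0 \<le> t \<Longrightarrow> gplus t = g t"
  by (simp add: gplus_def max_def)

lemma measurable_gplus [measurable]: "gplus \<in> borel_measurable borel"
proof -
  have "(\<lambda>t::real. max 0 t) \<in> borel \<rightarrow>\<^sub>M restrict_space borel {0..}"
    by (intro measurable_restrict_space2) auto
  from measurable_compose[OF this, of g borel] gen show ?thesis
    unfolding gplus_def[abs_def] density_generator_def by simp
qed

lemma positive_definite_S: "positive_definite S"
  using S unfolding pd_correlation_matrix_def by simp

abbreviation quad :: "real^'n \<Rightarrow> real" where "quad x \<equiv> x \<bullet> (matrix_inv S *v x)"

lemma quad_nonneg: "0 \<le> quad x"
  by (rule positive_definite_nonneg[OF positive_definite_matrix_inv[OF positive_definite_S]])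

lemma measurable_quad [measurable]: "quad \<in> borel_measurable borel"
  by (intro borel_measurable_continuous_onI continuous_intros linear_continuous_on_compose
      linear_continuous_on matrix_vector_mul_bounded_linear)

definition \<mu> :: "(real^'n) measure" where "\<mu> = elliptical 0 S g"

lemma mu_eq: "\<mu> = density lborel (\<lambda>x. ennreal (1 / sqrt (det S)) * gplus (quad x))"
  unfolding \<mu>_def elliptical_def by (simp add: quad_nonneg gplus_eq)

lemma sets_mu [simp, measurable_cong]: "sets \<mu> = sets borel"
  by (simp add: mu_eq)

lemma space_mu [simp]: "space \<mu> = UNIV"
  by (simp add: mu_eq)

text \<open>Change of variables: the quadratic form becomes the squared norm, and the Jacobian
  \<open>\<bar>det L\<bar>\<close> absorbs the factor \<open>1 / sqrt (det S)\<close>.\<close>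

lemma distr_mu_whitening:
  assumes norm: "\<And>x. (norm (L *v x))\<^sup>2 = quad x" and inv: "invertible L"
    and det: "\<bar>det L\<bar> = 1 / sqrt (det S)"
  shows "distr \<mu> borel ((*v) L) = density lborel (\<lambda>z. gplus ((norm z)\<^sup>2))"
proof (rule measure_eqI)
  fix Y assume "Y \<in> sets (distr \<mu> borel ((*v) L))"
  then have Y[measurable]: "Y \<in> sets borel" by simp
  have L0: "det L \<noteq> 0" using inv by (simp add: invertible_det_nz)
  have "emeasure (density lborel (\<lambda>z. gplus ((norm z)\<^sup>2))) Y
      = (\<integral>\<^sup>+z. gplus ((norm z)\<^sup>2) * indicator Y z \<partial>lborel)"
    by (rule emeasure_density) auto
  also have "\<dots> = (\<integral>\<^sup>+x. ennreal \<bar>det L\<bar> * (gplus ((norm (L *v x))\<^sup>2) * indicator Y (L *v x)) \<partial>lborel)"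
    by (subst lborel_linear[OF L0]) (auto simp: nn_integral_density nn_integral_distr)
  also have "\<dots> = (\<integral>\<^sup>+x. (ennreal (1 / sqrt (det S)) * gplus (quad x)) * indicator ((*v) L -` Y) x \<partial>lborel)"
    unfolding norm det by (intro nn_integral_cong) (auto simp: indicator_def)
  also have "\<dots> = emeasure \<mu> ((*v) L -` Y)"
    using measurable_sets_borel[OF measurable_matrix_vector_mult Y] unfolding mu_eq
    by (subst emeasure_density) auto
  finally show "emeasure (distr \<mu> borel ((*v) L)) Y = emeasure (density lborel (\<lambda>z. gplus ((norm z)\<^sup>2))) Y"
    by (simp add: emeasure_distr)
qed simp

text \<open>The mass that the whitened law gives to a cone, per unit of volume of the part of the
  cone in the unit ball.\<close>

definition radial_mass :: ennreal where
  "radial_mass = ennreal (real CARD('n) / 2) *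
    (\<integral>\<^sup>+t\<in>{0<..}. ennreal (t powr (real CARD('n) / 2 - 1)) * gplus t \<partial>lborel)"

lemma spherical_cone:
  fixes C :: "(real^'n) set"
  assumes "C \<in> sets borel" "\<And>c x. 0 < c \<Longrightarrow> x \<in> C \<Longrightarrow> c *\<^sub>R x \<in> C"
  shows "emeasure (density lborel (\<lambda>z. gplus ((norm z)\<^sup>2))) C = emeasure lborel (C \<inter> cball 0 1) * radial_mass"
  using nn_integral_norm_square_cone[OF assms measurable_gplus] assms(1)
  by (simp add: emeasure_density radial_mass_def)

text \<open>This is the normalisation of the generator, rewritten with the volume of the unit
  ball.\<close>

lemma ball_radial_mass: "emeasure lborel (cball (0 :: real^'n) 1) * radial_mass = 1"
proof -
  have "(\<integral>\<^sup>+t\<in>{0<..}. ennreal (t powr (real CARD('n) / 2 - 1)) * gplus t \<partial>lborel) =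
      (\<integral>\<^sup>+t\<in>{0<..}. ennreal (t powr (real CARD('n) / 2 - 1)) * g t \<partial>lborel)"
    by (intro nn_integral_cong) (auto simp: indicator_def gplus_eq)
  moreover have "ennreal (unit_ball_vol (real CARD('n))) * ennreal (real CARD('n) / 2) =
      ennreal ((2 * pi powr (real CARD('n) / 2) / Gamma (real CARD('n) / 2)) / 2)"
    using unit_ball_vol_half[of "real CARD('n)"] card by (simp add: ennreal_mult[symmetric] del: times_divide_eq_right)
  ultimately show ?thesis
    using gen unfolding density_generator_def radial_mass_def
    by (simp add: emeasure_cball mult.assoc[symmetric])
qed

text \<open>Whitening is stated for a pair of indices; this supplies the second one when only one,
  or none, is given.\<close>

lemma other_index: obtains j where "j \<noteq> (k :: 'n)"
proof -
  have "UNIV \<noteq> {k}" using card by (metis Suc_1 card.empty card.insert empty_iff finite.emptyI le_antisym n_not_Suc_n not_less_eq_eq One_nat_def le_refl)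
  then show ?thesis using that by blast
qed

lemma prob_space_mu: "prob_space \<mu>"
proof
  obtain i j :: 'n where "j \<noteq> i" using other_index .
  then obtain L where L: "\<And>x. (norm (L *v x))\<^sup>2 = quad x" "invertible L" "\<bar>det L\<bar> = 1 / sqrt (det S)"
    using pd_correlation_whitening[OF S] by metis
  have "emeasure \<mu> (space \<mu>) = emeasure (distr \<mu> borel ((*v) L)) UNIV"
    by (simp add: emeasure_distr)
  also have "\<dots> = 1"
    unfolding distr_mu_whitening[OF L] using spherical_cone[of UNIV] ball_radial_mass by simp
  finally show "emeasure \<mu> (space \<mu>) = 1" .
qed

lemma measurable_gen_marginal_density [measurable]:
  "gen_marginal_density CARD('n) g \<in> borel_measurable borel"
proof -
  have "gen_marginal_density CARD('n) g = (\<lambda>t. ennreal (pi powr ((real CARD('n) - 1) / 2) / Gamma ((real CARD('n) - 1) / 2)) *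
       (\<integral>\<^sup>+s\<in>{0<..}. gplus (t\<^sup>2 + s) * ennreal (s powr ((real CARD('n) - 3) / 2)) \<partial>lborel))"
    unfolding gen_marginal_density_def
    by (rule ext, rule arg_cong2[where f = "(*)", OF refl], rule nn_integral_cong)
      (auto simp: indicator_def gplus_eq)
  then show ?thesis by simp
qed

lemma marginal_power_law:
  "(\<integral>\<^sup>+s. gplus (y\<^sup>2 + s) \<partial>power_law (unit_ball_vol (real CARD('n) - 1)) ((real CARD('n) - 1) / 2)) =
    gen_marginal_density CARD('n) g y"
proof -
  let ?m = "real CARD('n) - 1"
  have m: "0 < ?m" using card by auto
  have "(\<integral>\<^sup>+s. gplus (y\<^sup>2 + s) \<partial>power_law (unit_ball_vol ?m) (?m / 2)) =
      ennreal (unit_ball_vol ?m * (?m / 2)) * (\<integral>\<^sup>+s\<in>{0<..}. ennreal (s powr (?m / 2 - 1)) * gplus (y\<^sup>2 + s) \<partial>lborel)"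
    using m by (intro nn_integral_power_law) auto
  also have "(\<integral>\<^sup>+s\<in>{0<..}. ennreal (s powr (?m / 2 - 1)) * gplus (y\<^sup>2 + s) \<partial>lborel) =
      (\<integral>\<^sup>+s\<in>{0<..}. g (y\<^sup>2 + s) * ennreal (s powr ((real CARD('n) - 3) / 2)) \<partial>lborel)"
    by (intro nn_integral_cong) (auto simp: indicator_def field_simps gplus_eq)
  also have "unit_ball_vol ?m * (?m / 2) = pi powr (?m / 2) / Gamma (?m / 2)"
    using m by (intro unit_ball_vol_half)
  finally show ?thesis unfolding gen_marginal_density_def .
qed

text \<open>The whitening matrix is invertible, so \<open>1 / sqrt (det S)\<close> is the absolute
  value of a nonzero number; the sign of \<open>det S\<close> can be read off from this.\<close>

lemma det_pos: "0 < det S"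
proof -
  obtain i j :: 'n where "i \<noteq> j" using other_index by metis
  then obtain L :: "real^'n^'n" where "invertible L" "\<bar>det L\<bar> = 1 / sqrt (det S)"
    using pd_correlation_whitening[OF S] by metis
  then have "0 < 1 / sqrt (det S)" by (metis invertible_det_nz zero_less_abs_iff)
  then show ?thesis by simp
qed

text \<open>A whitening that keeps coordinate \<open>k\<close> reduces the claim to the spherical
  law, where integrating out the other coordinates leaves the marginal density. The result depends
  neither on \<open>k\<close> nor on \<open>S\<close>.\<close>

lemma distr_mu_component:
  "distr \<mu> borel (\<lambda>y. y $ k) = density lborel (gen_marginal_density CARD('n) g)"
proof (rule measure_eqI)
  fix B :: "real set" assume "B \<in> sets (distr \<mu> borel (\<lambda>y. y $ k))"
  then have B[measurable]: "B \<in> sets borel" by simp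
  obtain j where "k \<noteq> j" using other_index[of k] by metis
  then obtain L where L: "\<And>x. (norm (L *v x))\<^sup>2 = quad x" "invertible L" "\<bar>det L\<bar> = 1 / sqrt (det S)"
    and Lk: "\<And>x. (L *v x) $ k = x $ k"
    using pd_correlation_whitening[OF S \<open>k \<noteq> j\<close>] by metis
  let ?m = "real CARD('n) - 1"
  have m: "real (CARD('n) - 1) = ?m" using card by auto
  have "emeasure (distr \<mu> borel (\<lambda>y. y $ k)) B = emeasure (distr \<mu> borel ((*v) L)) ((\<lambda>z. z $ k) -` B)"
    using measurable_sets_borel[OF borel_measurable_vec_nth B, of k]
    by (simp add: emeasure_distr vimage_comp o_def Lk)
  also have "\<dots> = (\<integral>\<^sup>+z. gplus ((norm z)\<^sup>2) * indicator ((\<lambda>z. z $ k) -` B) z \<partial>lborel)"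
    unfolding distr_mu_whitening[OF L] using measurable_sets_borel[OF borel_measurable_vec_nth B, of k]
    by (intro emeasure_density) auto
  also have "\<dots> = (\<integral>\<^sup>+z. indicator B (z \<bullet> axis k (1::real)) * gplus ((norm z)\<^sup>2) \<partial>lborel)"
    by (intro nn_integral_cong) (auto simp: indicator_def inner_axis)
  also have "\<dots> = (\<integral>\<^sup>+y. indicator B y * (\<integral>\<^sup>+s. gplus (y\<^sup>2 + s)
       \<partial>power_law (unit_ball_vol ?m) (?m / 2)) \<partial>lborel)"
    using nn_integral_lborel_component_norm[of "axis k 1 :: real^'n" "indicator B" gplus] card m by simp
  also have "\<dots> = (\<integral>\<^sup>+y. gen_marginal_density CARD('n) g y * indicator B y \<partial>lborel)"
    by (simp add: marginal_power_law mult.commute)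
  also have "\<dots> = emeasure (density lborel (gen_marginal_density CARD('n) g)) B"
    by (subst emeasure_density) auto
  finally show "emeasure (distr \<mu> borel (\<lambda>y. y $ k)) B =
      emeasure (density lborel (gen_marginal_density CARD('n) g)) B" .
qed simp

end

section \<open>Wedges and quadrant probabilities\<close>

lemma emeasure_lborel_open_pos:
  fixes U :: "'a::euclidean_space set"
  assumes "open U" "U \<noteq> {}"
  shows "0 < emeasure lborel U"
proof -
  obtain x where "x \<in> U" using assms by auto
  then obtain e where e: "0 < e" "ball x e \<subseteq> U" using assms(1) by (auto simp: open_contains_ball)
  have "0 < emeasure lborel (ball x e)" using e by (simp add: emeasure_ball)
  also have "\<dots> \<le> emeasure lborel U" using e assms by (intro emeasure_mono) auto
  finally show ?thesis .
qed

text \<open>The whitened image of the quadrant where coordinates \<open>i\<close> and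
  \<open>j\<close> are nonpositive, when their correlation is \<open>r\<close>.\<close>

definition wedge :: "'n \<Rightarrow> 'n \<Rightarrow> real \<Rightarrow> (real^'n) set" where
  "wedge i j r = {z. z $ i \<le> 0 \<and> r * z $ i + sqrt (1 - r\<^sup>2) * z $ j \<le> 0}"

lemma closed_wedge: "closed (wedge i j r :: (real^'n) set)"
  unfolding wedge_def by (intro closed_Collect_conj closed_Collect_le continuous_intros)

text \<open>In the half-space \<open>z $ i \<le> 0\<close> the wedge lies below a line of slope
  \<open>\<kappa> r\<close> in the variable \<open>- z $ i\<close>. This slope increases strictly
  with \<open>r\<close>, so the larger wedge also contains an open sector.\<close>

lemma wedge_volume_strict_mono:
  assumes ij: "i \<noteq> (j :: 'n)" and r: "\<bar>r\<bar> < 1" "\<bar>r'\<bar> < 1" "r < r'"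
  shows "emeasure lborel (wedge i j r \<inter> cball 0 1) < emeasure lborel (wedge i j r' \<inter> cball (0 :: real^'n) 1)"
proof -
  define \<kappa> where "\<kappa> r = r / sqrt (1 - r\<^sup>2)" for r :: real
  have pos: "0 < sqrt (1 - r\<^sup>2)" "0 < sqrt (1 - r'\<^sup>2)" using r by (auto simp: abs_square_less_1)
  have wedge_iff: "z \<in> wedge i j s \<longleftrightarrow> z $ i \<le> 0 \<and> z $ j \<le> \<kappa> s * (- z $ i)" if "0 < sqrt (1 - s\<^sup>2)" for s and z :: "real^'n"
    using that unfolding wedge_def \<kappa>_def by (auto simp: field_simps)
  have \<kappa>_pos: "\<kappa> a < \<kappa> b" if "0 \<le> a" "a < b" "b < 1" for a b
    unfolding \<kappa>_def using that by (intro frac_less) (auto simp: abs_square_less_1 power_mono)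
  \<comment> \<open>For negative arguments the monotonicity follows because \<open>\<kappa>\<close>
    is odd; the mixed case is a comparison of signs.\<close>
  have \<kappa>: "\<kappa> r < \<kappa> r'"
  proof -
    consider "0 \<le> r" | "r < 0" "0 \<le> r'" | "r' < 0" by linarith
    then show ?thesis
    proof cases
      case 1 then show ?thesis using \<kappa>_pos r by simp
    next
      case 2
      then have "\<kappa> r < 0" "0 \<le> \<kappa> r'" using pos unfolding \<kappa>_def by (auto simp: divide_less_0_iff)
      then show ?thesis by simp
    next
      case 3
      then show ?thesis using \<kappa>_pos[of "- r'" "- r"] r unfolding \<kappa>_def by simp
    qed
  qed
  let ?W = "wedge i j r \<inter> cball (0 :: real^'n) 1" and ?W' = "wedge i j r' \<inter> cball (0 :: real^'n) 1"
  let ?U = "{z :: real^'n. z $ i < 0 \<and> \<kappa> r * (- z $ i) < z $ j \<and> z $ j < \<kappa> r' * (- z $ i)} \<inter> ball 0 1"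
  have "open ?U"
    by (intro open_Int open_Collect_conj open_Collect_less continuous_intros) auto
  have sub: "?W \<union> ?U \<subseteq> ?W'"
  proof -
    have "\<kappa> r * (- z $ i) \<le> \<kappa> r' * (- z $ i)" if "z $ i \<le> 0" for z :: "real^'n"
      using \<kappa> that by (intro mult_right_mono) auto
    then show ?thesis by (fastforce simp: wedge_iff[OF pos(1)] wedge_iff[OF pos(2)])
  qed
  have disj: "?W \<inter> ?U = {}" by (auto simp: wedge_iff[OF pos(1)])
  \<comment> \<open>A point of the sector: its direction has the mean of the two slopes, and
    rescaling then moves it inside the unit ball.\<close>
  define w :: "real^'n" where "w = - axis i 1 + ((\<kappa> r + \<kappa> r') / 2) *\<^sub>R axis j 1"
  define z where "z = (1 / (2 * (norm w + 1))) *\<^sub>R w"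
  have c: "0 < 1 / (2 * (norm w + 1))" by (simp add: add_nonneg_pos)
  have w: "w $ i = - 1" "w $ j = (\<kappa> r + \<kappa> r') / 2" using ij unfolding w_def by (auto simp: axis_def)
  have "norm z < 1"
  proof -
    have "norm z = norm w / (2 * (norm w + 1))" unfolding z_def using c by simp
    also have "\<dots> < 1" using norm_ge_zero[of w] by (subst divide_less_eq_1_pos) (auto simp: add_nonneg_pos)
    finally show ?thesis .
  qed
  moreover have "z $ i < 0" "\<kappa> r * (- z $ i) < z $ j" "z $ j < \<kappa> r' * (- z $ i)"
  proof -
    define c where "c = 1 / (2 * (norm w + 1))"
    have z: "z $ i = - c" "z $ j = c * ((\<kappa> r + \<kappa> r') / 2)" "0 < c"
      using c unfolding z_def c_def[symmetric] by (simp_all add: w)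
    have "c * \<kappa> r < c * ((\<kappa> r + \<kappa> r') / 2)" "c * ((\<kappa> r + \<kappa> r') / 2) < c * \<kappa> r'"
      using \<kappa> by (intro mult_strict_left_mono z(3); simp)+
    then show "z $ i < 0" "\<kappa> r * (- z $ i) < z $ j" "z $ j < \<kappa> r' * (- z $ i)"
      unfolding z(1,2) using z(3) by (simp_all only: minus_minus mult.commute[of _ c] neg_less_0_iff_less)
  qed
  ultimately have "?U \<noteq> {}" by auto
  have bd: "emeasure lborel ?W < \<infinity>" by (intro emeasure_bounded_finite) (auto simp: bounded_Int)
  have m: "?W \<in> sets borel" "?U \<in> sets borel" "?W' \<in> sets borel"
    by (intro borel_closed borel_open closed_Int closed_wedge closed_cball \<open>open ?U\<close>)+
  have "emeasure lborel ?W < emeasure lborel ?W + emeasure lborel ?U"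
    using emeasure_lborel_open_pos[OF \<open>open ?U\<close> \<open>?U \<noteq> {}\<close>] bd
      ennreal_add_left_cancel_less[of "emeasure lborel ?W" 0 "emeasure lborel ?U"]
    by simp
  also have "\<dots> = emeasure lborel (?W \<union> ?U)"
    by (rule plus_emeasure[OF _ _ disj]) (simp_all only: sets_lborel m)
  also have "\<dots> \<le> emeasure lborel ?W'"
    by (rule emeasure_mono[OF sub]) (simp only: sets_lborel m)
  finally show ?thesis .
qed

context elliptical_law
begin

text \<open>Whitening turns the quadrant into a wedge, which is a cone, so its probability is the
  proportion of the unit ball in the wedge. The generator cancels through the normalisation.\<close>

lemma prob_quadrant:
  assumes ij: "i \<noteq> j"
  shows "emeasure \<mu> {x. x $ i \<le> 0 \<and> x $ j \<le> 0} * emeasure lborel (cball (0 :: real^'n) 1) =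
    emeasure lborel (wedge i j (S $ i $ j) \<inter> cball 0 1)"
proof -
  let ?r = "S $ i $ j"
  obtain L where L: "\<And>x. (norm (L *v x))\<^sup>2 = quad x" "invertible L" "\<bar>det L\<bar> = 1 / sqrt (det S)"
    and Lij: "\<And>x. (L *v x) $ i = x $ i"
    "\<And>x. x $ j = ?r * (L *v x) $ i + sqrt (1 - ?r\<^sup>2) * (L *v x) $ j"
    using pd_correlation_whitening[OF S ij] by metis
  have "{x. x $ i \<le> 0 \<and> x $ j \<le> 0} = (*v) L -` wedge i j ?r"
  proof (rule set_eqI)
    fix x
    have "?r * x $ i + sqrt (1 - ?r\<^sup>2) * (L *v x) $ j = x $ j"
      using Lij(2)[of x] unfolding Lij(1) by (rule sym)
    then show "x \<in> {x. x $ i \<le> 0 \<and> x $ j \<le> 0} \<longleftrightarrow> x \<in> (*v) L -` wedge i j ?r"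
      unfolding wedge_def vimage_eq mem_Collect_eq Lij(1) by simp
  qed
  then have "emeasure \<mu> {x. x $ i \<le> 0 \<and> x $ j \<le> 0} = emeasure (distr \<mu> borel ((*v) L)) (wedge i j ?r)"
    using borel_closed[OF closed_wedge[of i j ?r]] by (simp add: emeasure_distr)
  also have "\<dots> = emeasure lborel (wedge i j ?r \<inter> cball 0 1) * radial_mass"
    unfolding distr_mu_whitening[OF L]
  proof (rule spherical_cone)
    fix c :: real and x :: "real^'n" assume "0 < c" "x \<in> wedge i j ?r"
    moreover have "?r * (c * x $ i) + sqrt (1 - ?r\<^sup>2) * (c * x $ j) = c * (?r * x $ i + sqrt (1 - ?r\<^sup>2) * x $ j)"
      by (simp add: algebra_simps)
    ultimately show "c *\<^sub>R x \<in> wedge i j ?r" unfolding wedge_def by (auto simp: mult_le_0_iff)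
  qed (rule borel_closed[OF closed_wedge])
  finally show ?thesis using ball_radial_mass by (simp add: mult.assoc mult.commute[of radial_mass])
qed

section \<open>The common marginal distribution function\<close>

definition F :: "real \<Rightarrow> real" where
  "F x = measure (density lborel (gen_marginal_density CARD('n) g)) {..x}"

lemma cdf_component: "cdf (distr \<mu> borel (\<lambda>y. y $ k)) = F"
  unfolding distr_mu_component by (rule ext) (simp add: F_def cdf_def)

lemma real_distribution_marginal: "real_distribution (density lborel (gen_marginal_density CARD('n) g))"
proof -
  interpret prob_space \<mu> by (rule prob_space_mu)
  have "prob_space (distr \<mu> borel (\<lambda>y. y $ k))" for k by (intro prob_space_distr) simp
  then show ?thesis unfolding distr_mu_component by (simp add: real_distribution_def real_distribution_axioms_def)
qed

text \<open>The marginal density is even, so both half-lines have equal mass, and the point 0 has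
  none.\<close>

lemma F_zero: "F 0 = 1 / 2"
proof -
  let ?f = "gen_marginal_density CARD('n) g" let ?D = "density lborel ?f"
  interpret real_distribution ?D by (rule real_distribution_marginal)
  have "emeasure ?D {..0} = (\<integral>\<^sup>+t. ?f t * indicator {..0} t \<partial>lborel)" by (intro emeasure_density) auto
  also have "\<dots> = (\<integral>\<^sup>+t. ?f t * indicator {0..} t \<partial>lborel)"
  proof -
    have "?f (- t) = ?f t" for t by (simp add: gen_marginal_density_def)
    then show ?thesis
      using nn_integral_real_affine[of "\<lambda>t. ?f t * indicator {..0} t" "-1" 0]
      by (simp add: indicator_def)
  qed
  also have "\<dots> = emeasure ?D {0..}" by (intro emeasure_density[symmetric]) auto
  finally have "measure ?D {..0} = measure ?D {0..}" by (simp add: measure_def)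
  moreover have "measure ?D UNIV = measure ?D {..0} + measure ?D {0<..}"
    by (subst finite_measure_Union[symmetric]) (auto intro!: arg_cong[where f = "measure _"])
  moreover have "measure ?D {0..} = measure ?D {0<..} + measure ?D {0}"
    by (subst finite_measure_Union[symmetric]) (auto intro!: arg_cong[where f = "measure _"])
  moreover have "measure ?D {0} = 0"
  proof -
    have "emeasure ?D {0} = (\<integral>\<^sup>+t. ?f t * indicator {0} t \<partial>lborel)" by (intro emeasure_density) auto
    also have "\<dots> = 0" by (subst nn_integral_0_iff_AE) (use AE_lborel_singleton[of 0] in auto)
    finally show ?thesis by (simp add: measure_def)
  qed
  ultimately show ?thesis using prob_space unfolding F_def by simp
qed

end

section \<open>Copulas and quantile transforms\<close>

text \<open>The laws whose joint cdfs are the copulas of \<open>is_copula\<close>, as an object on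
  which measure-theoretic arguments can act.\<close>

definition uniform_margins :: "(real^'n) measure \<Rightarrow> bool" where
  "uniform_margins P \<longleftrightarrow> prob_space P \<and> sets P = sets borel \<and>
    (\<forall>k. distr P borel (\<lambda>x. x $ k) = uniform_measure lborel {0..1})"

lemma atMost_vec: "{..a :: real^'n} = {y. \<forall>k. y $ k \<le> a $ k}"
  by (auto simp: less_eq_vec_def)

lemma joint_cdf_atMost: "joint_cdf L a = measure L {..a}"
  by (simp add: joint_cdf_def atMost_vec)

lemma uniform_margins_AE:
  assumes "uniform_margins P"
  shows "AE w in P. \<forall>k. 0 < w $ k \<and> w $ k < 1"
proof -
  have "AE w in P. 0 < w $ k \<and> w $ k < 1" for k
  proof -
    have [measurable_cong]: "sets P = sets borel" using assms unfolding uniform_margins_def by simp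
    have "AE t in uniform_measure lborel {0..1::real}. 0 < t \<and> t < 1"
    proof (rule AE_uniform_measureI)
      show "AE t in lborel. t \<in> {0..1} \<longrightarrow> 0 < t \<and> t < (1::real)"
        using AE_lborel_singleton[of "0::real"] AE_lborel_singleton[of "1::real"] by eventually_elim auto
    qed simp
    moreover have "distr P borel (\<lambda>x. x $ k) = uniform_measure lborel {0..1}"
      using assms unfolding uniform_margins_def by blast
    ultimately have "AE t in distr P borel (\<lambda>x. x $ k). 0 < t \<and> t < 1" by (simp only:)
    then show ?thesis by (subst (asm) AE_distr_iff) auto
  qed
  then show ?thesis by (subst AE_all_countable) simp
qed

text \<open>Such laws live on the open unit cube, so the mass of any lower orthant is 0 or that of
  an orthant with its corner moved into the cube.\<close>

lemma uniform_margins_unique: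
  fixes P P' :: "(real^'n) measure"
  assumes P: "uniform_margins P" and P': "uniform_margins P'"
    and eq: "\<And>u. (\<forall>k. u $ k \<in> {0..1}) \<Longrightarrow> joint_cdf P u = joint_cdf P' u"
  shows "P = P'"
proof (rule measure_eqI_atMost)
  show sets: "sets P = sets borel" "sets P' = sets borel" using P P' unfolding uniform_margins_def by auto
  interpret P: prob_space P using P unfolding uniform_margins_def by simp
  interpret P': prob_space P' using P' unfolding uniform_margins_def by simp
  fix a :: "real^'n"
  show "emeasure P {..a} = emeasure P' {..a}"
  proof (cases "\<forall>k. 0 \<le> a $ k")
    case True
    let ?a = "\<chi> k. min 1 (a $ k)"
    have *: "emeasure Q {..a} = ennreal (joint_cdf Q ?a)" if Q: "uniform_margins Q" for Q
    proof -
      interpret Q: prob_space Q using Q unfolding uniform_margins_def by simp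
      have sQ: "sets Q = sets borel" using Q unfolding uniform_margins_def by simp
      have "emeasure Q {..a} = emeasure Q {..?a}"
      proof (rule emeasure_eq_AE)
        show "AE w in Q. w \<in> {..a} \<longleftrightarrow> w \<in> {..?a}"
          using uniform_margins_AE[OF Q] by eventually_elim (auto simp: less_eq_vec_def less_imp_le)
      qed (auto simp: sQ)
      then show ?thesis by (simp add: joint_cdf_atMost Q.emeasure_eq_measure)
    qed
    have "joint_cdf P ?a = joint_cdf P' ?a" using True by (intro eq) auto
    then show ?thesis by (simp add: *[OF P] *[OF P'])
  next
    case False
    then obtain k where k: "a $ k < 0" by (auto simp: not_le)
    have "emeasure Q {..a} = 0" if Q: "uniform_margins Q" for Q
    proof -
      have sQ: "sets Q = sets borel" using Q unfolding uniform_margins_def by simp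
      have "emeasure Q {..a} = emeasure Q {}"
      proof (rule emeasure_eq_AE)
        show "AE w in Q. w \<in> {..a} \<longleftrightarrow> w \<in> {}"
          using uniform_margins_AE[OF Q]
        proof eventually_elim
          case (elim w)
          then have "0 < w $ k" by simp
          with k have "\<not> w $ k \<le> a $ k" by simp
          then show ?case by (auto simp: less_eq_vec_def)
        qed
      qed (auto simp: sQ)
      then show ?thesis by simp
    qed
    with P P' show ?thesis by simp
  qed
  show "emeasure P {..a} \<noteq> \<infinity>" by simp
qed

text \<open>\<open>Q\<close> applies the quantile function to each coordinate. The equivalence
  between \<open>Q w $ k \<le> x\<close> and \<open>w $ k \<le> cdf D x\<close> pulls lower orthants
  back to lower orthants, so the law of \<open>Q\<close> has the joint cdf of
  \<open>\<mu>\<close>.\<close>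

lemma copula_quantile_transform:
  fixes \<mu> P :: "(real^'n) measure" and D :: "real measure"
  assumes mu: "prob_space \<mu>" "sets \<mu> = sets borel"
    and D: "real_distribution D" "\<And>k. distr \<mu> borel (\<lambda>y. y $ k) = D"
    and P: "uniform_margins P"
    and cop: "\<And>x. joint_cdf \<mu> x = joint_cdf P (\<chi> k. cdf D (x $ k))"
  obtains Q where "Q \<in> borel_measurable borel" "\<mu> = distr P borel Q"
    "AE w in P. \<forall>k x. Q w $ k \<le> x \<longleftrightarrow> w $ k \<le> cdf D x"
proof -
  interpret \<mu>: prob_space \<mu> by fact
  interpret P: prob_space P using P unfolding uniform_margins_def by simp
  have sets: "sets P = sets borel" using P unfolding uniform_margins_def by simp
  interpret D: cdf_distribution D unfolding cdf_distribution_def by fact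
  \<comment> \<open>The quantile function \<open>D.I\<close> is used on the open unit interval only;
    the value 0 elsewhere is arbitrary, since coordinates almost surely lie in that
    interval.\<close>
  define q where "q t = (if t \<in> {0<..<1} then D.I t else 0)" for t
  have [measurable]: "q \<in> borel_measurable borel"
    using D.measurable_CI unfolding q_def[abs_def]
    by (subst (asm) measurable_restrict_space_iff[where c = 0]) auto
  define Q :: "real^'n \<Rightarrow> real^'n" where "Q w = (\<chi> k. q (w $ k))" for w
  have [measurable]: "Q \<in> borel_measurable borel"
  proof (subst borel_measurable_euclidean_space, intro ballI)
    fix b :: "real^'n" assume "b \<in> Basis"
    then obtain k where "b = axis k 1" by (auto simp: Basis_vec_def)
    then show "(\<lambda>w. Q w \<bullet> b) \<in> borel_measurable borel" by (simp add: Q_def inner_axis)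
  qed
  have gal: "AE w in P. \<forall>k x. Q w $ k \<le> x \<longleftrightarrow> w $ k \<le> cdf D x"
    using uniform_margins_AE[OF P]
  proof eventually_elim
    case (elim w)
    show ?case
    proof (intro allI)
      fix k x
      have "0 < w $ k" "w $ k < 1" using elim by auto
      then show "Q w $ k \<le> x \<longleftrightarrow> w $ k \<le> cdf D x"
        using D.pseudoinverse[of "w $ k" x] by (simp add: Q_def q_def)
    qed
  qed
  have "\<mu> = distr P borel Q"
  proof (rule measure_eqI_atMost)
    fix a :: "real^'n"
    have "emeasure (distr P borel Q) {..a} = emeasure P (Q -` {..a})"
      using sets sets_eq_imp_space_eq[OF sets] by (subst emeasure_distr) auto
    also have "\<dots> = emeasure P {..\<chi> k. cdf D (a $ k)}"
    proof (rule emeasure_eq_AE)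
      show "AE w in P. w \<in> Q -` {..a} \<longleftrightarrow> w \<in> {..\<chi> k. cdf D (a $ k)}"
        using gal by eventually_elim (auto simp: less_eq_vec_def)
      show "Q -` {..a} \<in> P.events" using measurable_sets_borel[of Q borel "{..a}"] by (simp add: sets)
    qed (simp add: sets)
    also have "\<dots> = emeasure \<mu> {..a}"
      using cop[of a] by (simp add: joint_cdf_atMost P.emeasure_eq_measure \<mu>.emeasure_eq_measure)
    finally show "emeasure \<mu> {..a} = emeasure (distr P borel Q) {..a}" ..
  qed (use mu in auto)
  then show ?thesis using that[of Q] gal by simp
qed

section \<open>Transport of densities\<close>

text \<open>Half-open boxes involve only inequalities \<open>\<le>\<close> and their negations, so
  quantile equivalences carry them to boxes of the same type with no boundary terms.\<close>

definition hbox :: "real^'n \<Rightarrow> real^'n \<Rightarrow> (real^'n) set" where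
  "hbox x y = {z. \<forall>k. x $ k < z $ k \<and> z $ k \<le> y $ k}"

lemma hbox_eq: "hbox x y = (\<Inter>k. {z. x $ k < z $ k} \<inter> {z. z $ k \<le> y $ k})"
  by (auto simp: hbox_def)

lemma borel_hbox [measurable]: "hbox x y \<in> sets borel"
  unfolding hbox_eq by (intro sets.countable_INT'' sets.Int) auto

lemma emeasure_hbox:
  assumes "\<And>k. x $ k \<le> y $ k"
  shows "emeasure lborel (hbox x y) = ennreal (\<Prod>k\<in>UNIV. y $ k - x $ k)"
proof (rule antisym)
  have le: "\<And>b. b \<in> Basis \<Longrightarrow> x \<bullet> b \<le> y \<bullet> b" using assms by (auto simp: Basis_vec_def inner_axis)
  have "(\<Prod>k\<in>UNIV. y $ k - x $ k) = (\<Prod>b\<in>Basis. (y - x) \<bullet> b)" by (simp add: prod_Basis_cart)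
  then have e: "emeasure lborel (box x y) = ennreal (\<Prod>k\<in>UNIV. y $ k - x $ k)"
    "emeasure lborel (cbox x y) = ennreal (\<Prod>k\<in>UNIV. y $ k - x $ k)"
    using emeasure_lborel_box[OF le] emeasure_lborel_cbox[OF le] by simp_all
  show "emeasure lborel (hbox x y) \<le> ennreal (\<Prod>k\<in>UNIV. y $ k - x $ k)"
    unfolding e(2)[symmetric] by (intro emeasure_mono) (auto simp: hbox_def mem_box_cart less_imp_le)
  show "ennreal (\<Prod>k\<in>UNIV. y $ k - x $ k) \<le> emeasure lborel (hbox x y)"
    unfolding e(1)[symmetric] by (intro emeasure_mono) (auto simp: hbox_def mem_box_cart less_imp_le)
qed

text \<open>On a small box with lower corner \<open>x\<close> the density is within
  \<open>e / 2\<close> of \<open>p x\<close> by continuity. The boxes need only shrink to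
  \<open>x\<close>; their proportions are free, as required for images under
  \<open>T\<close>.\<close>

lemma emeasure_density_hbox_limit:
  fixes p :: "real^'n \<Rightarrow> real" and Y :: "nat \<Rightarrow> real^'n"
  assumes p[measurable]: "p \<in> borel_measurable borel" and nn: "\<And>z. 0 \<le> p z"
    and cont: "isCont p x" and gt: "\<And>n k. x $ k < Y n $ k" and lim: "Y \<longlonglongrightarrow> x"
  shows "(\<lambda>n. measure (density lborel (\<lambda>z. ennreal (p z))) (hbox x (Y n)) / (\<Prod>k\<in>UNIV. Y n $ k - x $ k)) \<longlonglongrightarrow> p x"
proof (rule LIMSEQ_I)
  fix e :: real assume e: "0 < e"
  let ?M = "density lborel (\<lambda>z. ennreal (p z))"
  obtain d where d: "0 < d" "\<And>z. dist z x < d \<Longrightarrow> \<bar>p z - p x\<bar> < e / 2"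
    using cont e unfolding continuous_at_eps_delta dist_real_def by (metis half_gt_zero)
  obtain N where N: "\<And>n. n \<ge> N \<Longrightarrow> dist (Y n) x < d"
    using lim d(1) unfolding lim_sequentially by blast
  show "\<exists>no. \<forall>n\<ge>no. norm (measure ?M (hbox x (Y n)) / (\<Prod>k\<in>UNIV. Y n $ k - x $ k) - p x) < e"
  proof (intro exI[of _ N] allI impI)
    fix n assume "N \<le> n"
    let ?v = "\<Prod>k\<in>UNIV. Y n $ k - x $ k"
    have v: "0 < ?v" using gt by (intro prod_pos) auto
    have vol: "emeasure lborel (hbox x (Y n)) = ennreal ?v"
      using gt by (intro emeasure_hbox) (auto intro: less_imp_le)
    have bnd: "\<bar>p z - p x\<bar> < e / 2" if "z \<in> hbox x (Y n)" for z
    proof (rule d(2))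
      have "dist z x = norm (z - x)" by (simp add: dist_norm)
      also have "\<dots> \<le> norm (Y n - x)"
      proof (rule norm_le_componentwise_cart)
        fix k
        have "x $ k < z $ k" "z $ k \<le> Y n $ k" using that unfolding hbox_def by auto
        then show "norm ((z - x) $ k) \<le> norm ((Y n - x) $ k)" by simp
      qed
      finally show "dist z x < d" using N[OF \<open>N \<le> n\<close>] by (simp add: dist_norm)
    qed
    then have bnd: "p z \<le> p x + e / 2" "p x - e / 2 \<le> p z" if "z \<in> hbox x (Y n)" for z
      using that by (smt (verit))+
    have E: "emeasure ?M (hbox x (Y n)) = (\<integral>\<^sup>+z. ennreal (p z) * indicator (hbox x (Y n)) z \<partial>lborel)"
      by (intro emeasure_density) auto
    have up: "emeasure ?M (hbox x (Y n)) \<le> ennreal ((p x + e / 2) * ?v)"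
    proof -
      have "emeasure ?M (hbox x (Y n)) \<le> (\<integral>\<^sup>+z. ennreal (p x + e / 2) * indicator (hbox x (Y n)) z \<partial>lborel)"
        unfolding E
      proof (rule nn_integral_mono)
        fix z show "ennreal (p z) * indicator (hbox x (Y n)) z \<le> ennreal (p x + e / 2) * indicator (hbox x (Y n)) z"
          using bnd[of z] by (cases "z \<in> hbox x (Y n)") (auto intro!: ennreal_leI)
      qed
      also have "\<dots> = ennreal ((p x + e / 2) * ?v)"
        using nn[of x] e by (simp add: nn_integral_cmult_indicator vol ennreal_mult')
      finally show ?thesis .
    qed
    have lo: "ennreal ((p x - e / 2) * ?v) \<le> emeasure ?M (hbox x (Y n))"
    proof -
      have "ennreal ((p x - e / 2) * ?v) = (\<integral>\<^sup>+z. ennreal (p x - e / 2) * indicator (hbox x (Y n)) z \<partial>lborel)"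
        using v by (simp add: nn_integral_cmult_indicator vol ennreal_mult'')
      also have "\<dots> \<le> emeasure ?M (hbox x (Y n))"
        unfolding E
      proof (rule nn_integral_mono)
        fix z show "ennreal (p x - e / 2) * indicator (hbox x (Y n)) z \<le> ennreal (p z) * indicator (hbox x (Y n)) z"
          using bnd[of z] by (cases "z \<in> hbox x (Y n)") (auto intro!: ennreal_leI)
      qed
      finally show ?thesis .
    qed
    have fin: "emeasure ?M (hbox x (Y n)) = ennreal (measure ?M (hbox x (Y n)))"
      using up by (intro emeasure_eq_ennreal_measure) (auto simp: top_unique)
    have "measure ?M (hbox x (Y n)) \<le> (p x + e / 2) * ?v"
      using up nn[of x] e v unfolding fin by (subst (asm) ennreal_le_iff) auto
    moreover have "(p x - e / 2) * ?v \<le> measure ?M (hbox x (Y n))"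
      using lo unfolding fin by (subst (asm) ennreal_le_iff) auto
    ultimately have "measure ?M (hbox x (Y n)) / ?v \<le> p x + e / 2" "p x - e / 2 \<le> measure ?M (hbox x (Y n)) / ?v"
      by (simp_all only: pos_divide_le_eq[OF v] pos_le_divide_eq[OF v])
    then show "norm (measure ?M (hbox x (Y n)) / ?v - p x) < e" using e by (auto simp: abs_if)
  qed
qed

text \<open>A change-of-variables formula at a single point: corresponding boxes have equal mass,
  the ratios of mass to volume tend to the two densities, and the ratio of the volumes tends to the
  product of the derivatives.\<close>

lemma density_transport:
  fixes p1 p2 :: "real^'n \<Rightarrow> real" and T T' :: "real \<Rightarrow> real" and I :: "real set"
  assumes p: "p1 \<in> borel_measurable borel" "p2 \<in> borel_measurable borel"
      "\<And>z. 0 \<le> p1 z" "\<And>z. 0 \<le> p2 z"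
    and I: "open I" "\<And>k. x $ k \<in> I" and T: "strict_mono_on I T"
    and deriv: "\<And>t. t \<in> I \<Longrightarrow> (T has_real_derivative T' t) (at t)"
    and boxes: "\<And>y. (\<And>k. x $ k < y $ k \<and> y $ k \<in> I) \<Longrightarrow>
      measure (density lborel (\<lambda>z. ennreal (p1 z))) (hbox x y) =
      measure (density lborel (\<lambda>z. ennreal (p2 z))) (hbox (\<chi> k. T (x $ k)) (\<chi> k. T (y $ k)))"
    and cont: "isCont p1 x" "isCont p2 (\<chi> k. T (x $ k))"
  shows "p1 x = p2 (\<chi> k. T (x $ k)) * (\<Prod>k\<in>UNIV. T' (x $ k))"
proof -
  have "\<exists>e>0. \<forall>k. {x $ k..x $ k + e} \<subseteq> I"
  proof -
    have "\<exists>e>0. {x $ k..x $ k + e} \<subseteq> I" for k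
    proof -
      obtain e where "0 < e" "cball (x $ k) e \<subseteq> I"
        using I(1) I(2)[of k] unfolding open_contains_cball by blast
      then show ?thesis by (intro exI[of _ e]) (auto simp: subset_iff dist_real_def)
    qed
    then obtain e where e: "\<And>k. 0 < e k" "\<And>k. {x $ k..x $ k + e k} \<subseteq> I" by metis
    let ?e = "Min (range e)"
    have "0 < ?e" using e(1) by simp
    moreover have "{x $ k..x $ k + ?e} \<subseteq> I" for k
    proof -
      have "?e \<le> e k" by simp
      then have "{x $ k..x $ k + ?e} \<subseteq> {x $ k..x $ k + e k}" by auto
      then show ?thesis using e(2)[of k] by blast
    qed
    ultimately show ?thesis by blast
  qed
  then obtain e where e: "0 < e" "\<And>k. {x $ k..x $ k + e} \<subseteq> I" by blast
  \<comment> \<open>The denominator \<open>Suc n\<close> keeps every side positive and at most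
    \<open>e\<close>, so all boxes stay in the domain of \<open>T\<close>.\<close>
  define h where "h n = e / real (Suc n)" for n
  have h: "0 < h n" "h n \<le> e" for n using e(1) unfolding h_def by (auto simp: field_simps)
  have h0: "h \<longlonglongrightarrow> 0" unfolding h_def[abs_def] by (rule LIMSEQ_Suc[OF lim_const_over_n])
  define Y where "Y n = (\<chi> k. x $ k + h n)" for n
  let ?T = "\<lambda>v :: real^'n. (\<chi> k. T (v $ k)) :: real^'n"
  have Y: "x $ k < Y n $ k" "Y n $ k \<in> I" for n k
    using h[of n] e(2)[of k] unfolding Y_def by auto
  have Ylim: "Y \<longlonglongrightarrow> x"
  proof (rule vec_tendstoI)
    fix k show "(\<lambda>n. Y n $ k) \<longlonglongrightarrow> x $ k" unfolding Y_def using tendsto_add[OF tendsto_const h0] by simp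
  qed
  have TY: "T (x $ k) < T (Y n $ k)" for n k using strict_mono_onD[OF T I(2) Y(2) Y(1)] .
  have quot: "(\<lambda>n. (T (Y n $ k) - T (x $ k)) / h n) \<longlonglongrightarrow> T' (x $ k)" for k
  proof -
    have "((\<lambda>s. (T (x $ k + s) - T (x $ k)) / s) \<longlongrightarrow> T' (x $ k)) (at 0)"
      using deriv[OF I(2)] by (simp add: DERIV_def)
    moreover have "filterlim h (at 0) sequentially"
      using h0 h(1) by (auto simp: filterlim_at intro!: always_eventually) (metis less_irrefl)
    ultimately have "(\<lambda>n. (T (x $ k + h n) - T (x $ k)) / h n) \<longlonglongrightarrow> T' (x $ k)"
      by (rule filterlim_compose)
    then show ?thesis by (simp add: Y_def)
  qed
  have TYlim: "(\<lambda>n. ?T (Y n)) \<longlonglongrightarrow> ?T x"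
  proof (rule vec_tendstoI)
    fix k
    have "(\<lambda>n. T (Y n $ k)) \<longlonglongrightarrow> T (x $ k)"
      using DERIV_isCont[OF deriv[OF I(2)]] tendsto_vec_nth[OF Ylim] by (rule isCont_tendsto_compose)
    then show "(\<lambda>n. ?T (Y n) $ k) \<longlonglongrightarrow> ?T x $ k" by simp
  qed
  let ?m1 = "\<lambda>n. measure (density lborel (\<lambda>z. ennreal (p1 z))) (hbox x (Y n))"
  let ?m2 = "\<lambda>n. measure (density lborel (\<lambda>z. ennreal (p2 z))) (hbox (?T x) (?T (Y n)))"
  let ?v1 = "\<lambda>n. \<Prod>k\<in>UNIV. Y n $ k - x $ k" and ?v2 = "\<lambda>n. \<Prod>k\<in>UNIV. T (Y n $ k) - T (x $ k)"
  have l1: "(\<lambda>n. ?m1 n / ?v1 n) \<longlonglongrightarrow> p1 x"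
    using p cont Y(1) Ylim by (intro emeasure_density_hbox_limit)
  have l2: "(\<lambda>n. ?m2 n / ?v2 n) \<longlonglongrightarrow> p2 (?T x)"
    using emeasure_density_hbox_limit[OF p(2,4) cont(2) _ TYlim] TY by simp
  have v2: "0 < ?v2 n" for n using TY by (intro prod_pos) (simp add: less_diff_eq)
  have "(\<lambda>n. \<Prod>k\<in>UNIV. (T (Y n $ k) - T (x $ k)) / h n) \<longlonglongrightarrow> (\<Prod>k\<in>UNIV. T' (x $ k))"
    by (intro tendsto_prod quot)
  then have l3: "(\<lambda>n. ?v2 n / ?v1 n) \<longlonglongrightarrow> (\<Prod>k\<in>UNIV. T' (x $ k))"
    by (simp add: prod_dividef Y_def)
  have "?m1 n = ?m2 n" for n using Y by (intro boxes) auto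
  moreover have "a / u = (b / v) * (v / u)" if "a = b" "0 < v" for a b u v :: real
    using that by simp
  ultimately have eq: "?m1 n / ?v1 n = (?m2 n / ?v2 n) * (?v2 n / ?v1 n)" for n using v2[of n] by blast
  have "(\<lambda>n. ?m1 n / ?v1 n) \<longlonglongrightarrow> p2 (?T x) * (\<Prod>k\<in>UNIV. T' (x $ k))"
    unfolding eq by (rule tendsto_mult[OF l2 l3])
  with l1 show ?thesis using LIMSEQ_unique by blast
qed

section \<open>Marginal profiles\<close>

text \<open>\<open>G\<close> is the generator at squared arguments, \<open>f\<close> and
  \<open>F\<close> are the marginal density and cdf, \<open>a\<close> is the support radius.
  \<open>G\<close> is left unspecified at distance exactly \<open>a\<close> from 0, whereas
  \<open>f\<close> vanishes there.\<close>

locale margin_profile =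
  fixes G f F :: "real \<Rightarrow> real" and a :: ereal
  assumes a_pos: "0 < a"
    and G_even: "\<And>t. G (- t) = G t" and f_even: "\<And>t. f (- t) = f t"
    and G_nonneg: "\<And>t. 0 \<le> G t"
    and G_pos: "\<And>t. ereal \<bar>t\<bar> < a \<Longrightarrow> 0 < G t"
    and G_zero: "\<And>t. a < ereal \<bar>t\<bar> \<Longrightarrow> G t = 0"
    and G_diff: "\<And>t. ereal \<bar>t\<bar> < a \<Longrightarrow> G differentiable (at t)"
    and f_pos: "\<And>t. ereal \<bar>t\<bar> < a \<Longrightarrow> 0 < f t"
    and f_zero: "\<And>t. a \<le> ereal \<bar>t\<bar> \<Longrightarrow> f t = 0"
    and f_diff: "\<And>t. f differentiable (at t)"
    and F_deriv: "\<And>t. (F has_real_derivative f t) (at t)"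
    and F_bot: "(F \<longlongrightarrow> 0) at_bot" and F_top: "(F \<longlongrightarrow> 1) at_top"
    and F_zero: "F 0 = 1 / 2"
begin

lemma f_nonneg: "0 \<le> f t"
  using f_pos[of t] f_zero[of t] by (cases "ereal \<bar>t\<bar> < a") auto

lemma F_mono: "s \<le> t \<Longrightarrow> F s \<le> F t"
  using DERIV_nonneg_imp_nondecreasing[of s t F] F_deriv f_nonneg by blast

lemma F_cont: "isCont F t"
  using DERIV_isCont[OF F_deriv] .

lemma open_domain: "open {t. ereal \<bar>t\<bar> < a}"
  by (intro open_Collect_less continuous_intros)

lemma F_strict_mono:
  assumes "ereal \<bar>s\<bar> < a" "ereal \<bar>t\<bar> < a" "s < t"
  shows "F s < F t"
proof (rule DERIV_pos_imp_increasing[OF \<open>s < t\<close>])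
  fix x assume x: "s \<le> x" "x \<le> t"
  have "\<bar>x\<bar> \<le> max \<bar>s\<bar> \<bar>t\<bar>" using x by auto
  then have "ereal \<bar>x\<bar> \<le> max (ereal \<bar>s\<bar>) (ereal \<bar>t\<bar>)" by (simp add: ereal_max[symmetric] del: ereal_max)
  also have "\<dots> < a" using assms by simp
  finally show "\<exists>y. DERIV F x :> y \<and> 0 < y" using F_deriv f_pos by blast
qed

lemma larger_radius:
  assumes "ereal \<bar>t\<bar> < a"
  obtains r where "\<bar>t\<bar> < r" "ereal r < a"
  using ereal_dense2[OF assms] by auto

lemma F_range:
  assumes "ereal \<bar>t\<bar> < a"
  shows "0 < F t" "F t < 1"
proof -
  obtain r where r: "\<bar>t\<bar> < r" "ereal r < a" using larger_radius[OF assms] .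
  then have "ereal \<bar>r\<bar> < a" "ereal \<bar>- r\<bar> < a" "- r < t" "t < r" by auto
  then have "F (- r) < F t" "F t < F r" using F_strict_mono assms by auto
  moreover have "0 \<le> F (- r)"
    by (rule tendsto_upperbound[OF F_bot]) (auto intro!: eventually_at_bot_linorderI[of "- r"] F_mono)
  moreover have "F r \<le> 1"
    by (rule tendsto_lowerbound[OF F_top]) (auto intro!: eventually_at_top_linorderI[of r] F_mono)
  ultimately show "0 < F t" "F t < 1" by auto
qed

text \<open>The intermediate value theorem gives a preimage. Were it outside the domain,
  \<open>F\<close> would be constant from there outwards and its limit at infinity would be
  \<open>u\<close> instead of 0 or 1.\<close>

lemma F_surj:
  assumes u: "0 < u" "u < 1"
  obtains t where "ereal \<bar>t\<bar> < a" "F t = u"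
proof -
  obtain l where l: "F l < u"
    using order_tendstoD(2)[OF F_bot u(1)] by (auto simp: eventually_at_bot_linorder)
  obtain r where r: "u < F r"
    using order_tendstoD(1)[OF F_top u(2)] by (auto simp: eventually_at_top_linorder)
  have "l \<le> r" using l r F_mono[of r l] by (cases "l \<le> r") auto
  then obtain t0 where t0: "F t0 = u" using IVT[of F l u r] l r F_cont by force
  have "ereal \<bar>t0\<bar> < a"
  proof (rule ccontr)
    assume "\<not> ereal \<bar>t0\<bar> < a"
    then have out: "a \<le> ereal \<bar>t0\<bar>" by simp
    have const: "F s = F t" if "s < t" "\<And>x. s < x \<Longrightarrow> x < t \<Longrightarrow> a \<le> ereal \<bar>x\<bar>" for s t
    proof (rule sym, rule DERIV_isconst_end[OF that(1)])
      show "continuous_on {s..t} F" by (intro continuous_at_imp_continuous_on ballI F_cont)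
      show "DERIV F x :> 0" if "s < x" "x < t" for x
        using F_deriv[of x] f_zero[OF \<open>\<And>x. s < x \<Longrightarrow> x < t \<Longrightarrow> a \<le> ereal \<bar>x\<bar>\<close>[OF that]] by simp
    qed
    show False
    proof (cases "0 \<le> t0")
      case True
      have "F t = u" if "t0 \<le> t" for t
      proof (cases "t = t0")
        case False
        have "F t0 = F t"
        proof (rule const)
          show "a \<le> ereal \<bar>x\<bar>" if "t0 < x" for x
            using out that True by (intro order.trans[OF out]) simp
        qed (use that False in simp)
        then show ?thesis using t0 by simp
      qed (use t0 in simp)
      then have "(F \<longlongrightarrow> u) at_top"
        by (intro tendsto_eventually eventually_at_top_linorderI[of t0])
      then show False using tendsto_unique[OF _ F_top] u(2) by auto
    next
      case False
      have "F t = u" if "t \<le> t0" for t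
      proof (cases "t = t0")
        case ne: False
        have "F t = F t0"
        proof (rule const)
          show "a \<le> ereal \<bar>x\<bar>" if "x < t0" for x
            using out that False by (intro order.trans[OF out]) simp
        qed (use that ne in simp)
        then show ?thesis using t0 by simp
      qed (use t0 in simp)
      then have "(F \<longlongrightarrow> u) at_bot"
        by (intro tendsto_eventually eventually_at_bot_linorderI[of t0])
      then show False using tendsto_unique[OF _ F_bot] u(1) by auto
    qed
  qed
  with that t0 show ?thesis by blast
qed

definition Q :: "real \<Rightarrow> real" where
  "Q u = (THE t. ereal \<bar>t\<bar> < a \<and> F t = u)"

lemma F_inj: "ereal \<bar>s\<bar> < a \<Longrightarrow> ereal \<bar>t\<bar> < a \<Longrightarrow> F s = F t \<Longrightarrow> s = t"
  using F_strict_mono by (metis less_irrefl linorder_neqE_linordered_idom)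

lemma Q_F: "ereal \<bar>t\<bar> < a \<Longrightarrow> Q (F t) = t"
  unfolding Q_def using F_inj by (intro the_equality) auto

lemma Q:
  assumes "0 < u" "u < 1"
  shows "ereal \<bar>Q u\<bar> < a" "F (Q u) = u"
proof -
  obtain t where "ereal \<bar>t\<bar> < a" "F t = u" using F_surj[OF assms] .
  then show "ereal \<bar>Q u\<bar> < a" "F (Q u) = u" using Q_F[of t] by auto
qed

text \<open>The inverse function rule applies as \<open>f\<close> is positive on the domain;
  continuity of \<open>Q\<close> comes from \<open>F\<close> being continuous and injective on a
  compact interval around the point.\<close>

lemma Q_deriv:
  assumes u: "0 < u" "u < 1"
  shows "(Q has_real_derivative inverse (f (Q u))) (at u)"
proof (rule DERIV_inverse_function[of F, OF F_deriv _ u])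
  show "f (Q u) \<noteq> 0" using f_pos[OF Q(1)[OF u]] by simp
  show "F (Q y) = y" if "0 < y" "y < 1" for y using Q(2)[OF that] .
  obtain r where r: "\<bar>Q u\<bar> < r" "ereal r < a" using larger_radius[OF Q(1)[OF u]] .
  have "isCont Q (F (Q u))"
  proof (rule isCont_inverse_function2[of "- r" "Q u" r])
    show "- r < Q u" "Q u < r" using r by auto
    fix z assume "- r \<le> z" "z \<le> r"
    then have "\<bar>z\<bar> \<le> r" by auto
    then have "ereal \<bar>z\<bar> < a" using r(2) by (meson ereal_less_eq(3) le_less_trans)
    then show "Q (F z) = z" by (rule Q_F)
  qed (rule F_cont)
  then show "isCont Q u" using Q(2)[OF u] by simp
qed

text \<open>Differentiable inside the radius, locally zero outside it; at the radius itself
  \<open>G\<close> may jump.\<close>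

lemma G_cont:
  assumes "ereal \<bar>t\<bar> \<noteq> a" shows "isCont G t"
proof (cases "ereal \<bar>t\<bar> < a")
  case True
  then show ?thesis using G_diff differentiable_imp_continuous_within by blast
next
  case False
  then have "a < ereal \<bar>t\<bar>" using assms by simp
  moreover have "open {t. a < ereal \<bar>t\<bar>}"
    by (intro open_Collect_less continuous_intros)
  ultimately have "\<forall>\<^sub>F s in nhds t. s \<in> {t. a < ereal \<bar>t\<bar>}" by (intro eventually_nhds_in_open) auto
  then have "\<forall>\<^sub>F s in nhds t. G s = 0" by eventually_elim (auto simp: G_zero)
  then show ?thesis by (subst isCont_cong[where g = "\<lambda>_. 0"]) auto
qed

lemma even_deriv_zero:
  fixes h :: "real \<Rightarrow> real"
  assumes "\<And>t. h (- t) = h t" "(h has_real_derivative D) (at 0)"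
  shows "D = 0"
proof -
  have "(h has_real_derivative D) (at (- 0))" using assms(2) by simp
  then have "((\<lambda>t. h (- t)) has_real_derivative D * (- 1)) (at 0)"
    by (rule DERIV_chain2) (auto intro!: derivative_eq_intros)
  then have "(h has_real_derivative - D) (at 0)" using assms(1) by simp
  from DERIV_unique[OF assms(2) this] show ?thesis by simp
qed

lemma f_deriv_zero: "(f has_real_derivative 0) (at 0)"
  using even_deriv_zero[of f, OF f_even] f_diff[of 0]
  by (metis real_differentiable_def)

end

section \<open>The margin profile of a regular generator\<close>

locale regular_law = elliptical_law S g for S :: "real^'n^'n" and g +
  assumes regular: "regular_generator CARD('n) g"
begin

definition a :: ereal where "a = gen_radius g"

definition G :: "real \<Rightarrow> real" where "G t = enn2real (g (t\<^sup>2))"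

definition f :: "real \<Rightarrow> real" where "f t = enn2real (gen_marginal_density CARD('n) g t)"

definition R :: "real \<Rightarrow> ennreal" where
  "R t = (\<integral>\<^sup>+r\<in>{0<..}. g (t\<^sup>2 + r\<^sup>2) * ennreal (r ^ (CARD('n) - 2)) \<partial>lborel)"

lemma g_finite: "g (t\<^sup>2) < \<infinity>"
  using regular unfolding regular_generator_def by blast

lemma ennreal_G: "ennreal (G t) = g (t\<^sup>2)"
  unfolding G_def using g_finite[of t] by simp

lemma abs_less_ereal: "ereal \<bar>t\<bar> < c \<longleftrightarrow> - c < ereal t \<and> ereal t < c"
  by (cases c) (auto simp: abs_less_iff)

lemma inside:
  assumes "ereal \<bar>t\<bar> < a"
  shows "0 < g (t\<^sup>2)" "G differentiable (at t)"
  using assms regular unfolding regular_generator_def G_def[abs_def] a_def abs_less_ereal by blast+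

lemma outside:
  assumes "a < ereal \<bar>t\<bar>" shows "g (t\<^sup>2) = 0"
proof (rule ccontr)
  assume "g (t\<^sup>2) \<noteq> 0"
  then have pos: "0 < g (\<bar>t\<bar>\<^sup>2)" by (simp add: zero_less_iff_neq_zero)
  \<comment> \<open>The supremum defining the radius sees positive arguments only. At
    \<open>t = 0\<close> the assumption would make the radius negative, so \<open>g\<close> would
    vanish on the positive axis, against the normalisation.\<close>
  have "t \<noteq> 0"
  proof
    assume "t = 0"
    then have neg: "a < 0" using assms by (simp add: zero_ereal_def)
    have "g s = 0" if "0 < s" for s
    proof (rule ccontr)
      assume "g s \<noteq> 0"
      then have "ereal (sqrt s) \<le> a" unfolding a_def gen_radius_def
        using that by (intro Sup_upper) (auto simp: zero_less_iff_neq_zero)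
      from this neg have "ereal (sqrt s) < 0" by (rule le_less_trans)
      then show False using that by (simp add: zero_ereal_def)
    qed
    then have "(\<integral>\<^sup>+t\<in>{0<..}. ennreal (t powr (real CARD('n) / 2 - 1)) * g t \<partial>lborel) = (\<integral>\<^sup>+(t::real). 0 \<partial>lborel)"
      by (intro nn_integral_cong) (auto simp: indicator_def)
    then show False using gen unfolding density_generator_def by simp
  qed
  then have "ereal \<bar>t\<bar> \<le> a" unfolding a_def gen_radius_def using pos
    by (intro Sup_upper) auto
  with assms show False by simp
qed

lemma a_pos: "0 < a"
proof (rule ccontr)
  assume "\<not> 0 < a"
  then have "a \<le> 0" by simp
  have "g s = 0" if "0 < s" for s
  proof -
    have "a < ereal \<bar>sqrt s\<bar>" using \<open>a \<le> 0\<close> that by (intro le_less_trans[OF \<open>a \<le> 0\<close>]) (simp add: zero_ereal_def)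
    from outside[OF this] that show ?thesis by simp
  qed
  then have "(\<integral>\<^sup>+t\<in>{0<..}. ennreal (t powr (real CARD('n) / 2 - 1)) * g t \<partial>lborel) = (\<integral>\<^sup>+(t::real). 0 \<partial>lborel)"
    by (intro nn_integral_cong) (auto simp: indicator_def)
  then show False using gen unfolding density_generator_def by simp
qed

text \<open>The surface area of the unit sphere in dimension \<open>CARD('n) - 1\<close>.\<close>

definition c :: real where "c = unit_ball_vol (real CARD('n) - 1) * (real CARD('n) - 1)"

lemma c_pos: "0 < c" unfolding c_def using card by simp

text \<open>The substitution \<open>s = r\<^sup>2\<close> links the marginal density to the integral
  whose finiteness and differentiability regularity provides.\<close>

lemma marginal_R: "gen_marginal_density CARD('n) g t = ennreal c * R t"
proof -
  let ?m = "real CARD('n) - 1"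
  have m: "0 < ?m" "0 \<le> unit_ball_vol ?m" using card by auto
  have "gen_marginal_density CARD('n) g t =
      (\<integral>\<^sup>+s. gplus (t\<^sup>2 + s) \<partial>distr (power_law (unit_ball_vol ?m) ?m) borel (\<lambda>r. r\<^sup>2))"
    unfolding marginal_power_law[symmetric] distr_square_power_law[OF m(2,1)] ..
  also have "\<dots> = (\<integral>\<^sup>+r. gplus (t\<^sup>2 + r\<^sup>2) \<partial>power_law (unit_ball_vol ?m) ?m)"
    by (subst nn_integral_distr) auto
  also have "\<dots> = ennreal c * (\<integral>\<^sup>+r\<in>{0<..}. ennreal (r powr (?m - 1)) * gplus (t\<^sup>2 + r\<^sup>2) \<partial>lborel)"
    unfolding c_def using m by (intro nn_integral_power_law) auto
  also have "(\<integral>\<^sup>+r\<in>{0<..}. ennreal (r powr (?m - 1)) * gplus (t\<^sup>2 + r\<^sup>2) \<partial>lborel) = R t"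
    unfolding R_def
  proof (rule nn_integral_cong)
    fix r :: real
    have "r powr (?m - 1) = r ^ (CARD('n) - 2)" if "0 < r"
      using that card powr_realpow[OF that, of "CARD('n) - 2"] by (simp add: of_nat_diff)
    then show "ennreal (r powr (?m - 1)) * gplus (t\<^sup>2 + r\<^sup>2) * indicator {0<..} r =
        g (t\<^sup>2 + r\<^sup>2) * ennreal (r ^ (CARD('n) - 2)) * indicator {0<..} r"
      by (auto simp: indicator_def gplus_eq mult.commute)
  qed
  finally show ?thesis .
qed

lemma R_finite: "R t < \<infinity>"
  using regular unfolding regular_generator_def R_def by blast

lemma f_R: "f t = c * enn2real (R t)"
  unfolding f_def marginal_R using c_pos by (simp add: enn2real_mult)

lemma ennreal_f: "ennreal (f t) = gen_marginal_density CARD('n) g t"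
  unfolding f_def marginal_R using R_finite[of t] by (simp add: ennreal_mult_less_top)

lemma f_differentiable: "f differentiable (at t)"
proof -
  have "(\<lambda>s. enn2real (R s)) differentiable (at t)"
    using regular unfolding regular_generator_def R_def[abs_def] by blast
  then show ?thesis unfolding f_R[abs_def] by (intro differentiable_mult) auto
qed

lemma f_cont: "isCont f t"
  using f_differentiable differentiable_imp_continuous_within by blast

text \<open>For every \<open>r > 0\<close> the radius \<open>sqrt (t\<^sup>2 + r\<^sup>2)\<close>
  strictly exceeds \<open>a\<close>, even if \<open>\<bar>t\<bar>\<close> equals \<open>a\<close>,
  so the integrand vanishes.\<close>

lemma f_outside:
  assumes "a \<le> ereal \<bar>t\<bar>" shows "f t = 0"
proof -
  have "g (t\<^sup>2 + r\<^sup>2) = 0" if "0 < r" for r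
  proof -
    let ?s = "sqrt (t\<^sup>2 + r\<^sup>2)"
    have "\<bar>t\<bar> < ?s" using that by (intro real_less_rsqrt) simp
    then have "a < ereal \<bar>?s\<bar>" using assms by (intro le_less_trans[OF assms]) simp
    from outside[OF this] show ?thesis by simp
  qed
  then have "R t = (\<integral>\<^sup>+(r::real). 0 \<partial>lborel)"
    unfolding R_def by (intro nn_integral_cong) (auto simp: indicator_def)
  then show ?thesis unfolding f_R by simp
qed

lemma f_inside:
  assumes "ereal \<bar>t\<bar> < a" shows "0 < f t"
proof -
  obtain \<rho> where \<rho>: "\<bar>t\<bar> < \<rho>" "ereal \<rho> < a" using ereal_dense2[OF assms] by auto
  \<comment> \<open>For \<open>r\<close> below \<open>\<delta>\<close> the radius
    \<open>sqrt (t\<^sup>2 + r\<^sup>2)\<close> stays below \<open>\<rho>\<close>, so the integrand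
    is positive on an interval of positive length.\<close>
  define \<delta> where "\<delta> = sqrt (\<rho>\<^sup>2 - t\<^sup>2)"
  have lt: "t\<^sup>2 < \<rho>\<^sup>2" using power_strict_mono[OF \<rho>(1), of 2] by simp
  then have \<delta>: "0 < \<delta>" unfolding \<delta>_def by simp
  have pos: "0 < g (t\<^sup>2 + r\<^sup>2)" if "0 < r" "r < \<delta>" for r
  proof -
    let ?s = "sqrt (t\<^sup>2 + r\<^sup>2)"
    have "r\<^sup>2 < \<delta>\<^sup>2" using that by (intro power_strict_mono) auto
    also have "\<delta>\<^sup>2 = \<rho>\<^sup>2 - t\<^sup>2" unfolding \<delta>_def using lt by simp
    finally have "?s < \<rho>" using \<rho>(1) by (intro real_less_lsqrt) auto
    then have "ereal \<bar>?s\<bar> < a" using \<rho>(2) by (intro less_trans[OF _ \<rho>(2)]) simp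
    from inside(1)[OF this] show ?thesis by simp
  qed
  have "R t \<noteq> 0"
  proof
    assume "R t = 0"
    moreover have "R t = (\<integral>\<^sup>+r\<in>{0<..}. gplus (t\<^sup>2 + r\<^sup>2) * ennreal (r ^ (CARD('n) - 2)) \<partial>lborel)"
      unfolding R_def by (intro nn_integral_cong) (auto simp: indicator_def gplus_eq)
    ultimately have ae: "AE r in lborel. gplus (t\<^sup>2 + r\<^sup>2) * ennreal (r ^ (CARD('n) - 2)) * indicator {0<..} r = 0"
      using nn_integral_0_iff_AE[of "\<lambda>r. gplus (t\<^sup>2 + r\<^sup>2) * ennreal (r ^ (CARD('n) - 2)) * indicator {0<..} r" lborel]
      by simp
    have "AE r in lborel. r \<notin> {0<..<\<delta>}"
      using ae
    proof eventually_elim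
      case (elim r)
      show ?case
      proof
        assume r: "r \<in> {0<..<\<delta>}"
        then have "gplus (t\<^sup>2 + r\<^sup>2) \<noteq> 0" "ennreal (r ^ (CARD('n) - 2)) \<noteq> 0" using pos[of r] by (auto simp: gplus_eq)
        with elim r show False by simp
      qed
    qed
    then have "emeasure lborel {0<..<\<delta>} = 0"
      using AE_iff_measurable[of "{0<..<\<delta>}" lborel "\<lambda>r. r \<notin> {0<..<\<delta>}"] by (simp add: greaterThanLessThan_def greaterThan_def lessThan_def Int_def)
    then show False using \<delta> by simp
  qed
  then show ?thesis unfolding f_R using c_pos R_finite[of t] by (simp add: enn2real_positive_iff zero_less_iff_neq_zero)
qed

text \<open>The fundamental theorem of calculus on the window of radius 1 around \<open>t\<close>,
  where \<open>f\<close> is continuous.\<close>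

lemma F_has_derivative: "(F has_real_derivative f t) (at t)"
proof -
  let ?D = "density lborel (gen_marginal_density CARD('n) g)"
  interpret D: real_distribution ?D by (rule real_distribution_marginal)
  let ?l = "t - 1" and ?u = "t + 1"
  have cont: "continuous_on {?l..?u} f" by (intro continuous_at_imp_continuous_on ballI f_cont)
  have Fx: "F x = F ?l + integral {?l..x} f" if "x \<in> {?l..?u}" for x
  proof -
    have int: "(f has_integral integral {?l..x} f) {?l..x}"
      using that by (intro integrable_integral integrable_continuous_real continuous_on_subset[OF cont]) auto
    have nn: "0 \<le> f y" for y unfolding f_def by simp
    have "emeasure ?D {?l<..x} = (\<integral>\<^sup>+y. ennreal (f y) * indicator {?l<..x} y \<partial>lborel)"
      unfolding ennreal_f by (intro emeasure_density) auto
    also have "\<dots> = (\<integral>\<^sup>+y. ennreal (f y) * indicator {?l..x} y \<partial>lborel)"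
      using AE_lborel_singleton[of ?l] by (intro nn_integral_cong_AE) (auto elim!: eventually_mono simp: indicator_def)
    also have "\<dots> = ennreal (integral {?l..x} f)"
      using nn int by (intro nn_integral_has_integral_lebesgue') auto
    finally have "measure ?D {?l<..x} = integral {?l..x} f"
      using nn by (simp add: measure_def Henstock_Kurzweil_Integration.integral_nonneg[OF has_integral_integrable[OF int]])
    moreover have "measure ?D {..x} = measure ?D {..?l} + measure ?D {?l<..x}"
      using that by (subst D.finite_measure_Union[symmetric]) (auto intro!: arg_cong[where f = "measure _"])
    ultimately show ?thesis unfolding F_def by simp
  qed
  have "((\<lambda>x. integral {?l..x} f) has_real_derivative f t) (at t within {?l..?u})"
    by (intro integral_has_real_derivative cont) simp
  then have "((\<lambda>x. F ?l + integral {?l..x} f) has_real_derivative f t) (at t within {?l..?u})"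
    by (auto intro!: derivative_eq_intros)
  then have "(F has_real_derivative f t) (at t within {?l..?u})"
    by (rule has_field_derivative_transform_within[where d = 1]) (simp, simp, rule Fx[symmetric])
  then show ?thesis by (simp add: at_within_Icc_at)
qed

sublocale margin_profile G f F a
proof
  interpret D: real_distribution "density lborel (gen_marginal_density CARD('n) g)"
    by (rule real_distribution_marginal)
  have cdf: "cdf (density lborel (gen_marginal_density CARD('n) g)) = F"
    by (rule ext) (simp add: F_def cdf_def)
  show "(F \<longlongrightarrow> 0) at_bot" using D.cdf_lim_at_bot unfolding cdf .
  show "(F \<longlongrightarrow> 1) at_top" using D.cdf_lim_at_top_prob unfolding cdf .
  show "0 < a" by (rule a_pos)
  show "G (- t) = G t" "f (- t) = f t" "0 \<le> G t" for t
    by (simp_all add: G_def f_def gen_marginal_density_def)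
  show "0 < G t" if "ereal \<bar>t\<bar> < a" for t
    unfolding G_def using inside(1)[OF that] g_finite[of t] by (simp add: enn2real_positive_iff)
  show "G t = 0" if "a < ereal \<bar>t\<bar>" for t
    unfolding G_def using outside[OF that] by simp
  show "F 0 = 1 / 2" by (rule F_zero)
qed (fact inside(2) f_inside f_outside f_differentiable F_has_derivative)+

definition p :: "real^'n \<Rightarrow> real" where "p x = G (sqrt (quad x)) / sqrt (det S)"

lemma p_nonneg: "0 \<le> p x"
  unfolding p_def G_def using det_pos by simp

lemma ennreal_p: "ennreal (p x) = ennreal (1 / sqrt (det S)) * gplus (quad x)"
proof -
  have "ennreal (p x) = ennreal (1 / sqrt (det S)) * ennreal (G (sqrt (quad x)))"
    unfolding p_def using det_pos by (simp add: G_def ennreal_mult'[symmetric])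
  then show ?thesis unfolding ennreal_G using quad_nonneg[of x] by (simp add: gplus_eq)
qed

lemma measurable_p: "p \<in> borel_measurable borel"
proof -
  have "p = (\<lambda>x. enn2real (ennreal (1 / sqrt (det S)) * gplus (quad x)))"
    unfolding ennreal_p[symmetric] using p_nonneg by simp
  then show ?thesis by simp
qed

lemma mu_density_p: "\<mu> = density lborel (\<lambda>x. ennreal (p x))"
  unfolding mu_eq ennreal_p ..

lemma isCont_p:
  assumes "ereal (sqrt (quad x)) \<noteq> a" shows "isCont p x"
proof -
  have "isCont G (sqrt (quad x))" using assms quad_nonneg[of x] by (intro G_cont) simp
  moreover have "isCont (\<lambda>x. sqrt (quad x)) x"
    by (intro continuous_intros linear_continuous_at matrix_vector_mul_bounded_linear)
  ultimately have "isCont (\<lambda>x. G (sqrt (quad x))) x" by (rule isCont_o2[rotated])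
  then show ?thesis unfolding p_def[abs_def] by (intro continuous_intros) (use det_pos in auto)
qed

end

section \<open>Uniqueness of the transport map\<close>

lemma DERIV_unique_eventually:
  fixes f h :: "real \<Rightarrow> real"
  assumes "(f has_real_derivative a) (at x)" "(h has_real_derivative b) (at x)"
    and "\<forall>\<^sub>F s in nhds x. f s = h s"
  shows "a = b"
proof -
  have "(h has_real_derivative a) (at x)"
    using assms(1) DERIV_cong_ev[OF refl assms(3) refl] by simp
  then show ?thesis using assms(2) by (rule DERIV_unique)
qed

lemma isCont_eventually_less:
  fixes f :: "real \<Rightarrow> ereal"
  assumes "isCont f x" "f x < c"
  shows "\<forall>\<^sub>F y in nhds x. f y < c"
proof -
  have "(f \<longlongrightarrow> f x) (nhds x)" using assms(1) unfolding isCont_def tendsto_at_iff_tendsto_nhds .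
  then show ?thesis using assms(2) by (rule order_tendstoD(2))
qed

section \<open>The transport map between two margins\<close>

locale profile_pair = E1: margin_profile G1 f1 F1 a1 + E2: margin_profile G2 f2 F2 a2
  for G1 f1 F1 a1 G2 f2 F2 a2 +
  assumes f_zero_eq: "f1 0 = f2 0"
begin

definition T :: "real \<Rightarrow> real" where "T x = E2.Q (F1 x)"

text \<open>The reciprocal of the derivative of \<open>T\<close>, differentiable because
  \<open>f1\<close>, \<open>f2\<close> and \<open>T\<close> are.\<close>

definition W :: "real \<Rightarrow> real" where "W x = f2 (T x) / f1 x"

lemma domain_mono: "\<bar>x\<bar> \<le> r \<Longrightarrow> ereal r < a \<Longrightarrow> ereal \<bar>x\<bar> < a"
  by (meson ereal_less_eq(3) le_less_trans)

lemma T_range: "ereal \<bar>x\<bar> < a1 \<Longrightarrow> ereal \<bar>T x\<bar> < a2"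
  unfolding T_def using E2.Q(1) E1.F_range by blast

lemma F2_T: "ereal \<bar>x\<bar> < a1 \<Longrightarrow> F2 (T x) = F1 x"
  unfolding T_def using E2.Q(2) E1.F_range by blast

lemma zero_domain: "ereal \<bar>0\<bar> < a1" "ereal \<bar>0\<bar> < a2"
  using E1.a_pos E2.a_pos by (simp_all add: zero_ereal_def)

lemma T_zero: "T 0 = 0"
proof -
  have "F1 0 = F2 0" by (simp add: E1.F_zero E2.F_zero)
  then show ?thesis unfolding T_def using E2.Q_F[OF zero_domain(2)] by simp
qed

lemma T_strict_mono:
  assumes "ereal \<bar>x\<bar> < a1" "ereal \<bar>y\<bar> < a1" "x < y"
  shows "T x < T y"
proof (rule ccontr)
  assume "\<not> T x < T y"
  then have "F2 (T y) \<le> F2 (T x)" by (intro E2.F_mono) simp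
  then show False using E1.F_strict_mono[OF assms] F2_T assms by simp
qed

lemma T_mono: "ereal \<bar>x\<bar> < a1 \<Longrightarrow> ereal \<bar>y\<bar> < a1 \<Longrightarrow> x \<le> y \<Longrightarrow> T x \<le> T y"
  using T_strict_mono by (cases "x = y") (auto intro: less_imp_le)

lemma T_deriv:
  assumes "ereal \<bar>x\<bar> < a1"
  shows "(T has_real_derivative inverse (W x)) (at x)"
proof -
  have "((\<lambda>x. E2.Q (F1 x)) has_real_derivative inverse (f2 (E2.Q (F1 x))) * f1 x) (at x)"
    by (rule DERIV_chain2[OF E2.Q_deriv[OF E1.F_range[OF assms]] E1.F_deriv])
  then show ?thesis unfolding W_def T_def[abs_def] by (simp add: field_simps)
qed

lemma T_cont: "ereal \<bar>x\<bar> < a1 \<Longrightarrow> isCont T x"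
  using T_deriv DERIV_isCont by blast

lemma W_pos: "ereal \<bar>x\<bar> < a1 \<Longrightarrow> 0 < W x"
  unfolding W_def using E2.f_pos[OF T_range] E1.f_pos by simp

lemma W_zero: "W 0 = 1"
  unfolding W_def T_zero using f_zero_eq E1.f_pos[OF zero_domain(1)] by simp

text \<open>Both marginal densities are even, so their derivatives vanish at 0, and \<open>T\<close>
  fixes 0.\<close>

lemma W_deriv_zero: "(W has_real_derivative 0) (at 0)"
proof -
  have "((\<lambda>x. f2 (T x)) has_real_derivative 0 * inverse (W 0)) (at 0)"
    by (rule DERIV_chain2[where g = T]) (use E2.f_deriv_zero T_deriv[OF zero_domain(1)] T_zero in auto)
  from DERIV_divide[OF this E1.f_deriv_zero] show ?thesis
    unfolding W_def[abs_def] using E1.f_pos[OF zero_domain(1)] by simp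
qed

lemma W_differentiable:
  assumes "ereal \<bar>x\<bar> < a1"
  obtains D where "(W has_real_derivative D) (at x)"
proof -
  obtain d2 d1 where d: "(f2 has_real_derivative d2) (at (T x))" "(f1 has_real_derivative d1) (at x)"
    using E2.f_diff E1.f_diff by (metis real_differentiable_def)
  have "((\<lambda>x. f2 (T x)) has_real_derivative d2 * inverse (W x)) (at x)"
    by (rule DERIV_chain2[OF d(1) T_deriv[OF assms]])
  from DERIV_divide[OF this d(2)] show ?thesis
    using that E1.f_pos[OF assms] unfolding W_def[abs_def] by auto
qed

end

text \<open>The density identity on the plane of coordinates \<open>i\<close> and \<open>j\<close>;
  \<open>\<alpha>\<close>, \<open>\<beta>\<close>, \<open>\<gamma>\<close> stand for the entries
  \<open>ii\<close>, \<open>jj\<close>, \<open>ij\<close> of the inverse correlation matrix. Points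
  on the two boundary ellipses are excluded, as the densities may be discontinuous there.\<close>

locale transported_pair = profile_pair +
  fixes \<alpha> \<beta> \<gamma> :: real
  assumes alpha: "1 \<le> \<alpha>" and beta: "0 < \<beta>" and gamma: "\<gamma> \<noteq> 0"
    and transport: "\<And>x y. ereal \<bar>x\<bar> < a1 \<Longrightarrow> ereal \<bar>y\<bar> < a1 \<Longrightarrow>
      ereal (sqrt (\<alpha> * x\<^sup>2 + 2 * \<gamma> * x * y + \<beta> * y\<^sup>2)) \<noteq> a1 \<Longrightarrow>
      ereal (sqrt (\<alpha> * (T x)\<^sup>2 + 2 * \<gamma> * T x * T y + \<beta> * (T y)\<^sup>2)) \<noteq> a2 \<Longrightarrow>
      G1 (sqrt (\<alpha> * x\<^sup>2 + 2 * \<gamma> * x * y + \<beta> * y\<^sup>2)) * (W x * W y) =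
      G2 (sqrt (\<alpha> * (T x)\<^sup>2 + 2 * \<gamma> * T x * T y + \<beta> * (T y)\<^sup>2))"
begin

section \<open>The differential equation for \<open>W\<close>\<close>

definition q :: "real \<Rightarrow> real \<Rightarrow> real" where "q x y = \<alpha> * x\<^sup>2 + 2 * \<gamma> * x * y + \<beta> * y\<^sup>2"

text \<open>The points of the axis \<open>y = 0\<close> that lie strictly inside both elliptical
  supports, the second one after transport; \<open>sqrt \<alpha> * \<bar>x\<bar>\<close> is the root
  of the form there.\<close>

definition near :: "real set" where
  "near = {x. ereal (sqrt \<alpha> * \<bar>x\<bar>) < a1 \<and> ereal (sqrt \<alpha> * \<bar>T x\<bar>) < a2}"

lemma transport': "ereal \<bar>x\<bar> < a1 \<Longrightarrow> ereal \<bar>y\<bar> < a1 \<Longrightarrow>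
    ereal (sqrt (q x y)) \<noteq> a1 \<Longrightarrow> ereal (sqrt (q (T x) (T y))) \<noteq> a2 \<Longrightarrow>
    G1 (sqrt (q x y)) * (W x * W y) = G2 (sqrt (q (T x) (T y)))"
  using transport unfolding q_def by blast

lemma abs_le_sqrt_alpha: "\<bar>x\<bar> \<le> sqrt \<alpha> * \<bar>x\<bar>"
  using alpha mult_right_mono[of 1 "sqrt \<alpha>" "\<bar>x\<bar>"] by simp

lemma near_domain: "x \<in> near \<Longrightarrow> ereal \<bar>x\<bar> < a1"
  unfolding near_def using domain_mono[OF abs_le_sqrt_alpha] by blast

lemma q_zero: "q x 0 = \<alpha> * x\<^sup>2" "sqrt (q x 0) = sqrt \<alpha> * \<bar>x\<bar>"
  unfolding q_def by (simp_all add: real_sqrt_mult)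

lemma open_near: "open near"
proof -
  have "open {x. ereal (sqrt \<alpha> * \<bar>x\<bar>) < a1}"
    by (intro open_Collect_less continuous_intros)
  moreover have "{x. ereal (sqrt \<alpha> * \<bar>x\<bar>) < a1} \<subseteq> {x. ereal \<bar>x\<bar> < a1}"
    using domain_mono[OF abs_le_sqrt_alpha] by blast
  then have "continuous_on {x. ereal (sqrt \<alpha> * \<bar>x\<bar>) < a1} (\<lambda>x. ereal (sqrt \<alpha> * \<bar>T x\<bar>))"
    by (intro continuous_intros continuous_at_imp_continuous_on ballI T_cont) auto
  ultimately have "open ({x. ereal (sqrt \<alpha> * \<bar>x\<bar>) < a1} \<inter> (\<lambda>x. ereal (sqrt \<alpha> * \<bar>T x\<bar>)) -` {..<a2})"
    by (subst Int_commute, intro continuous_on_open_vimage[THEN iffD1, rule_format]) auto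
  then show ?thesis unfolding near_def by (simp add: vimage_def Int_def)
qed

text \<open>\<open>T\<close> is increasing and fixes 0, so moving towards 0 decreases both
  \<open>\<bar>x\<bar>\<close> and \<open>\<bar>T x\<bar>\<close>. Identities of derivatives can
  thus be integrated from 0.\<close>

lemma near_between:
  assumes "x \<in> near" "s \<in> closed_segment 0 x"
  shows "s \<in> near"
proof -
  have s: "0 \<le> s \<and> s \<le> x \<or> x \<le> s \<and> s \<le> 0" "\<bar>s\<bar> \<le> \<bar>x\<bar>"
    using assms(2) by (auto simp: closed_segment_eq_real_ivl split: if_splits)
  have dx: "ereal \<bar>x\<bar> < a1" using near_domain assms(1) .
  have ds: "ereal \<bar>s\<bar> < a1" using domain_mono[OF s(2) dx] .
  have "\<bar>T s\<bar> \<le> \<bar>T x\<bar>"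
    using s(1)
  proof
    assume "0 \<le> s \<and> s \<le> x"
    then show ?thesis using T_mono[OF zero_domain(1) ds] T_mono[OF ds dx] T_zero by auto
  next
    assume "x \<le> s \<and> s \<le> 0"
    then show ?thesis using T_mono[OF ds zero_domain(1)] T_mono[OF dx ds] T_zero by auto
  qed
  then have "sqrt \<alpha> * \<bar>s\<bar> \<le> sqrt \<alpha> * \<bar>x\<bar>" "sqrt \<alpha> * \<bar>T s\<bar> \<le> sqrt \<alpha> * \<bar>T x\<bar>"
    using s(2) alpha by (auto intro!: mult_left_mono)
  then show ?thesis using assms(1) unfolding near_def mem_Collect_eq
    by (meson ereal_less_eq(3) le_less_trans)
qed

lemma deriv_sqrt_q:
  assumes "x \<noteq> 0"
  shows "((\<lambda>s. sqrt (q s 0)) has_real_derivative \<alpha> * x / sqrt (q x 0)) (at x)"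
    and "((\<lambda>y. sqrt (q x y)) has_real_derivative \<gamma> * x / sqrt (q x 0)) (at 0)"
proof -
  have pos: "0 < q x 0" using assms alpha by (simp add: q_zero)
  have "((\<lambda>s. q s 0) has_real_derivative 2 * \<alpha> * x) (at x)"
    unfolding q_def by (auto intro!: derivative_eq_intros)
  from DERIV_chain2[OF DERIV_real_sqrt[OF pos] this]
  show "((\<lambda>s. sqrt (q s 0)) has_real_derivative \<alpha> * x / sqrt (q x 0)) (at x)"
    by (simp add: field_simps)
  have "((\<lambda>y. q x y) has_real_derivative 2 * \<gamma> * x) (at 0)"
    unfolding q_def by (auto intro!: derivative_eq_intros)
  from DERIV_chain2[OF DERIV_real_sqrt[OF pos] this]
  show "((\<lambda>y. sqrt (q x y)) has_real_derivative \<gamma> * x / sqrt (q x 0)) (at 0)"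
    by (simp add: field_simps)
qed

lemma G_derivative:
  assumes "G differentiable (at (t::real))" obtains d where "(G has_real_derivative d) (at t)"
  using assms by (metis real_differentiable_def)

text \<open>The partial derivatives of the transport identity in both variables at \<open>y = 0\<close> say that \<open>W\<close>
  solves a linear differential equation of which \<open>G1 (sqrt \<alpha> * x)\<close> is an integrating factor.\<close>

lemma integrating_factor:
  assumes x: "x \<in> near"
  shows "((\<lambda>x. (W x - 1) * G1 (sqrt \<alpha> * x)) has_real_derivative 0) (at x)"
proof (cases "x = 0")
  \<comment> \<open>The square root of the form is not differentiable at the origin, so this point
    is separate; here both terms of the product rule vanish, by \<open>W 0 = 1\<close> and the zero
    derivative of \<open>W\<close>.\<close>
  case True
  obtain d where "(G1 has_real_derivative d) (at (sqrt \<alpha> * 0))"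
    using G_derivative[of G1 "sqrt \<alpha> * 0"] E1.G_diff[OF zero_domain(1)] by auto
  then have "((\<lambda>x. G1 (sqrt \<alpha> * x)) has_real_derivative d * sqrt \<alpha>) (at 0)"
    by (rule DERIV_chain2) (auto intro!: derivative_eq_intros)
  from DERIV_mult[OF DERIV_diff[OF W_deriv_zero DERIV_const[of 1]] this] show ?thesis
    using True W_zero by simp
next
  case False
  note dx = near_domain[OF x]
  have Tx: "T x \<noteq> 0"
    using T_strict_mono[OF dx zero_domain(1)] T_strict_mono[OF zero_domain(1) dx] False T_zero by linarith
  let ?R = "sqrt (q x 0)" and ?R' = "sqrt (q (T x) 0)"
  have R: "ereal ?R < a1" "ereal ?R' < a2" "0 < ?R" "0 < ?R'"
    using x False Tx alpha unfolding near_def q_zero(2) by simp_all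
  obtain d1 where d1: "(G1 has_real_derivative d1) (at ?R)"
    using G_derivative E1.G_diff[of ?R] R by auto
  obtain d2 where d2: "(G2 has_real_derivative d2) (at ?R')"
    using G_derivative E2.G_diff[of ?R'] R by auto
  obtain D where D: "(W has_real_derivative D) (at x)" using W_differentiable[OF dx] .
  note W = W_pos[OF dx]

  \<comment> \<open>The derivative in \<open>x\<close> along \<open>y = 0\<close>, where
    \<open>W 0 = 1\<close> and \<open>T 0 = 0\<close>.\<close>
  have row: "d1 * (\<alpha> * x / ?R) * W x + D * G1 ?R = d2 * (\<alpha> * T x / ?R' * inverse (W x))"
  proof -
    have "((\<lambda>s. G1 (sqrt (q s 0)) * W s) has_real_derivative d1 * (\<alpha> * x / ?R) * W x + D * G1 ?R) (at x)"
      by (rule DERIV_mult[OF DERIV_chain2[OF d1 deriv_sqrt_q(1)[OF False]] D])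
    moreover have "((\<lambda>s. G2 (sqrt (q (T s) 0))) has_real_derivative d2 * (\<alpha> * T x / ?R' * inverse (W x))) (at x)"
      by (rule DERIV_chain2[OF d2 DERIV_chain2[OF deriv_sqrt_q(1)[OF Tx] T_deriv[OF dx]]])
    moreover have "\<forall>\<^sub>F s in nhds x. G1 (sqrt (q s 0)) * W s = G2 (sqrt (q (T s) 0))"
    proof -
      have "\<forall>\<^sub>F s in nhds x. s \<in> near" using open_near x by (rule eventually_nhds_in_open)
      then show ?thesis
      proof eventually_elim
        case (elim s)
        have "ereal (sqrt (q s 0)) \<noteq> a1" "ereal (sqrt (q (T s) (T 0))) \<noteq> a2"
          using elim unfolding near_def T_zero q_zero(2) by auto
        from transport'[OF near_domain[OF elim] zero_domain(1) this] show ?case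
          by (simp add: W_zero T_zero)
      qed
    qed
    ultimately show ?thesis by (rule DERIV_unique_eventually)
  qed
  \<comment> \<open>The derivative in \<open>y\<close> at \<open>y = 0\<close>; the term with the
    derivative of \<open>W\<close> drops out, and every remaining term carries the factor
    \<open>\<gamma>\<close>.\<close>
  have col: "d1 * (\<gamma> * x / ?R) * W x = d2 * (\<gamma> * T x / ?R')"
  proof -
    have "((\<lambda>y. G1 (sqrt (q x y)) * (W x * W y)) has_real_derivative
        d1 * (\<gamma> * x / ?R) * (W x * W 0) + (W x * 0) * G1 ?R) (at 0)"
      by (rule DERIV_mult[OF DERIV_chain2[OF d1 deriv_sqrt_q(2)[OF False]] DERIV_cmult[OF W_deriv_zero]])
    moreover have "((\<lambda>y. G2 (sqrt (q (T x) (T y)))) has_real_derivative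
        d2 * (\<gamma> * T x / ?R' * inverse (W 0))) (at 0)"
    proof (rule DERIV_chain2[where f = G2])
      show "(G2 has_real_derivative d2) (at (sqrt (q (T x) (T 0))))" using d2 T_zero by simp
      have "((\<lambda>y. sqrt (q (T x) y)) has_real_derivative \<gamma> * T x / ?R') (at (T 0))"
        using deriv_sqrt_q(2)[OF Tx] T_zero by simp
      from DERIV_chain2[OF this T_deriv[OF zero_domain(1)]]
      show "((\<lambda>y. sqrt (q (T x) (T y))) has_real_derivative \<gamma> * T x / ?R' * inverse (W 0)) (at 0)" .
    qed
    moreover have "\<forall>\<^sub>F y in nhds 0. G1 (sqrt (q x y)) * (W x * W y) = G2 (sqrt (q (T x) (T y)))"
    proof -
      have "isCont (\<lambda>y. ereal (sqrt (q x y))) 0" "isCont (\<lambda>y. ereal (sqrt (q (T x) (T y)))) 0"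
        unfolding q_def by (intro continuous_intros T_cont zero_domain)+
      from isCont_eventually_less[OF this(1) R(1)] isCont_eventually_less[OF this(2), of a2] R(2) T_zero
      have "\<forall>\<^sub>F y in nhds 0. ereal (sqrt (q x y)) < a1"
        "\<forall>\<^sub>F y in nhds 0. ereal (sqrt (q (T x) (T y))) < a2"
        by simp_all
      moreover have "\<forall>\<^sub>F y in nhds 0. y \<in> {t. ereal \<bar>t\<bar> < a1}"
        using E1.open_domain zero_domain(1) by (intro eventually_nhds_in_open) auto
      ultimately show ?thesis
      proof eventually_elim
        case (elim y)
        then show ?case using transport'[OF dx, of y] by auto
      qed
    qed
    ultimately have "d1 * (\<gamma> * x / ?R) * (W x * W 0) + (W x * 0) * G1 ?R = d2 * (\<gamma> * T x / ?R' * inverse (W 0))"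
      by (rule DERIV_unique_eventually)
    then show ?thesis by (simp add: W_zero)
  qed
  \<comment> \<open>Cancelling \<open>\<gamma>\<close> expresses \<open>d2\<close> through
    \<open>d1\<close>; inserted into \<open>row\<close>, this removes every trace of
    \<open>G2\<close>.\<close>
  have "\<gamma> * (d2 * (T x / ?R')) = \<gamma> * (d1 * (x / ?R) * W x)" using col by (simp add: ac_simps)
  then have "d2 * (T x / ?R') = d1 * (x / ?R) * W x"
    by (rule mult_left_cancel[OF gamma, THEN iffD1])
  then have "d2 * (\<alpha> * T x / ?R' * inverse (W x)) = d1 * (\<alpha> * x / ?R)"
  proof -
    have "d2 * (\<alpha> * T x / ?R' * inverse (W x)) = \<alpha> * inverse (W x) * (d2 * (T x / ?R'))"
      by (simp add: ac_simps)
    also have "\<dots> = \<alpha> * inverse (W x) * (d1 * (x / ?R) * W x)"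
      using \<open>d2 * (T x / ?R') = d1 * (x / ?R) * W x\<close> by (simp only:)
    also have "\<dots> = d1 * (\<alpha> * x / ?R)" using W by simp
    finally show ?thesis .
  qed
  with row have key: "D * G1 ?R + d1 * (\<alpha> * x / ?R) * (W x - 1) = 0"
    unfolding right_diff_distrib by linarith
  have G: "G1 (sqrt (q s 0)) = G1 (sqrt \<alpha> * s)" for s
    using E1.G_even[of "sqrt \<alpha> * s"] by (cases "0 \<le> s") (auto simp: q_zero(2))
  have "((\<lambda>s. (W s - 1) * G1 (sqrt (q s 0))) has_real_derivative
      (D - 0) * G1 ?R + d1 * (\<alpha> * x / ?R) * (W x - 1)) (at x)"
    by (rule DERIV_mult[OF DERIV_diff[OF D DERIV_const] DERIV_chain2[OF d1 deriv_sqrt_q(1)[OF False]]])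
  then show ?thesis using key unfolding G by simp
qed

text \<open>The product with the integrating factor is constant on the segment from 0, where it is
  0, and the factor \<open>G1\<close> is positive.\<close>

lemma W_near: assumes "x \<in> near" shows "W x = 1"
proof -
  let ?E = "\<lambda>x. (W x - 1) * G1 (sqrt \<alpha> * x)"
  have "\<exists>c. \<forall>s\<in>closed_segment 0 x. ?E s = c"
    using near_between[OF assms] integrating_factor
    by (intro has_field_derivative_zero_constant) (auto intro: has_field_derivative_at_within)
  then have "?E x = ?E 0" by (metis ends_in_segment)
  then have "(W x - 1) * G1 (sqrt \<alpha> * x) = 0" by (simp add: W_zero)
  moreover have "0 < G1 (sqrt \<alpha> * x)"
    using assms alpha by (intro E1.G_pos) (simp add: near_def abs_mult)
  ultimately show ?thesis by simp
qed

lemma T_near: assumes "x \<in> near" shows "T x = x"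
proof -
  have "((\<lambda>s. T s - s) has_real_derivative 0) (at s)" if "s \<in> near" for s
    using DERIV_diff[OF T_deriv[OF near_domain[OF that]] DERIV_ident] W_near[OF that] by simp
  then have "\<exists>c. \<forall>s\<in>closed_segment 0 x. T s - s = c"
    using near_between[OF assms]
    by (intro has_field_derivative_zero_constant) (auto intro: has_field_derivative_at_within)
  then have "T x - x = T 0 - 0" by (metis ends_in_segment)
  then show ?thesis by (simp add: T_zero)
qed

text \<open>Removes the condition on \<open>T x\<close> from \<open>near\<close>. If it failed, then
  by continuity some \<open>t * x\<close> would satisfy
  \<open>sqrt \<alpha> * \<bar>T (t * x)\<bar> = v\<close> with \<open>v\<close> above
  \<open>sqrt \<alpha> * \<bar>x\<bar>\<close> and below \<open>a2\<close>. That point is in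
  \<open>near\<close>, so \<open>T\<close> fixes it, although it is too close to 0.\<close>

lemma near_if:
  assumes "ereal (sqrt \<alpha> * \<bar>x\<bar>) < a1" "ereal (sqrt \<alpha> * \<bar>x\<bar>) < a2"
  shows "x \<in> near"
proof (rule ccontr)
  assume "x \<notin> near"
  then have ge: "a2 \<le> ereal (sqrt \<alpha> * \<bar>T x\<bar>)" using assms unfolding near_def by auto
  obtain v where v: "sqrt \<alpha> * \<bar>x\<bar> < v" "ereal v < a2" using ereal_dense2[OF assms(2)] by auto
  have le: "sqrt \<alpha> * \<bar>t * x\<bar> \<le> sqrt \<alpha> * \<bar>x\<bar>" if "0 \<le> t" "t \<le> 1" for t
    using that alpha by (intro mult_left_mono) (auto simp: abs_mult mult_left_le_one_le)
  then have dom: "ereal (sqrt \<alpha> * \<bar>t * x\<bar>) < a1" if "0 \<le> t" "t \<le> 1" for t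
    using that assms(1) by (meson ereal_less_eq(3) le_less_trans)
  have dom': "ereal \<bar>t * x\<bar> < a1" if "0 \<le> t" "t \<le> 1" for t
    using domain_mono[OF abs_le_sqrt_alpha dom[OF that]] .
  have vT: "v < sqrt \<alpha> * \<bar>T x\<bar>" using v(2) ge by (metis ereal_less(1) less_ereal.simps(1) less_le_trans)
  have "\<exists>t\<ge>0. t \<le> 1 \<and> sqrt \<alpha> * \<bar>T (t * x)\<bar> = v"
  proof (rule IVT')
    have "0 \<le> sqrt \<alpha> * \<bar>x\<bar>" using alpha by simp
    then show "sqrt \<alpha> * \<bar>T (0 * x)\<bar> \<le> v" using v(1) by (simp add: T_zero)
    show "continuous_on {0..1} (\<lambda>t. sqrt \<alpha> * \<bar>T (t * x)\<bar>)"
    proof (intro continuous_at_imp_continuous_on ballI)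
      fix t :: real assume "t \<in> {0..1}"
      then have "isCont T (t * x)" by (intro T_cont dom') auto
      moreover have "isCont (\<lambda>t. t * x) t" by (intro continuous_intros)
      ultimately have "isCont (\<lambda>t. T (t * x)) t" by (rule isCont_o2[rotated])
      then show "isCont (\<lambda>t. sqrt \<alpha> * \<bar>T (t * x)\<bar>) t" by (intro continuous_intros)
    qed
  qed (use vT in auto)
  then obtain t where t: "0 \<le> t" "t \<le> 1" "sqrt \<alpha> * \<bar>T (t * x)\<bar> = v" by blast
  then have "t * x \<in> near" using dom[OF t(1,2)] v(2) unfolding near_def by simp
  then have "sqrt \<alpha> * \<bar>t * x\<bar> = v" using T_near t(3) by simp
  with le[OF t(1,2)] v(1) show False by simp
qed

section \<open>Comparing the profiles beyond the smaller support radius\<close>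

definition \<kappa> :: real where "\<kappa> = \<alpha> + \<beta> + 2 * \<bar>\<gamma>\<bar>"

lemma kappa: "0 < \<kappa>" "sqrt \<alpha> < sqrt \<kappa>"
  unfolding \<kappa>_def using alpha beta by auto

lemma G_eq:
  assumes s: "0 \<le> s" "ereal (sqrt \<alpha> * (s / sqrt \<kappa>)) < a1" "ereal (sqrt \<alpha> * (s / sqrt \<kappa>)) < a2"
    and ne: "ereal s \<noteq> a1" "ereal s \<noteq> a2"
  shows "G1 s = G2 s"
proof -
  \<comment> \<open>On the diagonal where \<open>y\<close> is \<open>x\<close> times the sign of
    \<open>\<gamma>\<close> the form is \<open>\<kappa> * x\<^sup>2\<close>. As
    \<open>\<kappa>\<close> exceeds \<open>\<alpha>\<close>, a radius \<open>s\<close> is reached by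
    coordinates at which \<open>sqrt \<alpha> * \<bar>x\<bar>\<close> is less than a positive
    \<open>s\<close>.\<close>
  let ?x = "s / sqrt \<kappa>" and ?y = "sgn \<gamma> * (s / sqrt \<kappa>)"
  have x: "0 \<le> ?x" using s kappa by simp
  have "\<bar>?y\<bar> = ?x" unfolding abs_mult using gamma abs_of_nonneg[OF x] by (simp add: abs_sgn_eq del: abs_divide)
  then have near: "?x \<in> near" "?y \<in> near"
    using s(2,3) near_if[of ?x] near_if[of ?y] unfolding \<open>\<bar>?y\<bar> = ?x\<close> abs_of_nonneg[OF x] by blast+
  have "q z (sgn \<gamma> * z) = \<kappa> * z\<^sup>2" for z
  proof -
    have sgn: "sgn \<gamma> * sgn \<gamma> = 1" "\<gamma> * sgn \<gamma> = \<bar>\<gamma>\<bar>" using gamma by (auto simp: sgn_if)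
    have "q z (sgn \<gamma> * z) = (\<alpha> + \<beta> * (sgn \<gamma> * sgn \<gamma>) + 2 * (\<gamma> * sgn \<gamma>)) * z\<^sup>2"
      unfolding q_def by (simp add: algebra_simps power2_eq_square)
    then show ?thesis unfolding sgn \<kappa>_def by simp
  qed
  then have "q ?x ?y = \<kappa> * ?x\<^sup>2" .
  then have q: "sqrt (q ?x ?y) = s" using s(1) kappa(1) by (simp add: real_sqrt_mult power_divide real_sqrt_divide)
  have "G1 (sqrt (q ?x ?y)) * (W ?x * W ?y) = G2 (sqrt (q (T ?x) (T ?y)))"
    by (intro transport' near_domain near)
      (simp_all only: T_near[OF near(1)] T_near[OF near(2)] q ne not_False_eq_True)
  then show ?thesis
    by (simp only: T_near[OF near(1)] T_near[OF near(2)] W_near[OF near(1)] W_near[OF near(2)] q mult_1_right)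
qed

lemma radius_eq: "a1 = a2"
proof (rule ccontr)
  assume "a1 \<noteq> a2"
  then have lt: "min a1 a2 < max a1 a2" and pos: "0 < min a1 a2"
    using E1.a_pos E2.a_pos by (auto simp: min_def max_def)
  from lt obtain m where m: "min a1 a2 = ereal m" using pos by (cases "min a1 a2") auto
  have "0 < m" using pos m by simp
  \<comment> \<open>\<open>s\<close> is taken above the smaller radius \<open>m\<close> but below
    the larger one, and below the range \<open>m * (sqrt \<kappa> / sqrt \<alpha>)\<close> of the
    diagonal argument. There the profiles agree, yet exactly one of them vanishes.\<close>
  then have "m < m * (sqrt \<kappa> / sqrt \<alpha>)" using kappa alpha by (simp add: field_simps)
  then have "ereal m < min (max a1 a2) (ereal (m * (sqrt \<kappa> / sqrt \<alpha>)))" using lt m by simp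
  from ereal_dense2[OF this] obtain s
    where "ereal m < ereal s" "ereal s < min (max a1 a2) (ereal (m * (sqrt \<kappa> / sqrt \<alpha>)))"
    by blast
  then have s: "m < s" "ereal s < max a1 a2" "s < m * (sqrt \<kappa> / sqrt \<alpha>)"
    by (simp_all only: min_less_iff_conj less_ereal.simps)
  have "sqrt \<alpha> * (s / sqrt \<kappa>) < m" using s(3) kappa alpha by (simp add: field_simps)
  then have "ereal (sqrt \<alpha> * (s / sqrt \<kappa>)) < min a1 a2" using m by simp
  moreover have "ereal s \<noteq> a1" "ereal s \<noteq> a2" using s m by (auto simp: min_def max_def split: if_splits)
  ultimately have eq: "G1 s = G2 s" using s \<open>0 < m\<close> by (intro G_eq) auto
  have abs: "\<bar>s\<bar> = s" using s \<open>0 < m\<close> by simp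
  have "min a1 a2 < ereal s" using s m by simp
  then consider "a1 < ereal s" "ereal s < a2" | "a2 < ereal s" "ereal s < a1"
    using s(2) by (auto simp: min_def max_def split: if_splits)
  then show False
    using eq E1.G_pos[of s] E2.G_pos[of s] E1.G_zero[of s] E2.G_zero[of s] abs by cases auto
qed

lemma G_eq_on_support:
  assumes "ereal \<bar>t\<bar> < a1" shows "G1 t = G2 t"
proof -
  have "sqrt \<alpha> * (\<bar>t\<bar> / sqrt \<kappa>) = \<bar>t\<bar> * (sqrt \<alpha> / sqrt \<kappa>)" by simp
  also have "\<dots> \<le> \<bar>t\<bar> * 1" using kappa alpha by (intro mult_left_mono) (auto simp: field_simps)
  finally have "ereal (sqrt \<alpha> * (\<bar>t\<bar> / sqrt \<kappa>)) < a1"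
    using assms by (metis ereal_less_eq(3) le_less_trans mult.right_neutral)
  then have "G1 \<bar>t\<bar> = G2 \<bar>t\<bar>" using assms radius_eq by (intro G_eq) auto
  then show ?thesis using E1.G_even[of t] E2.G_even[of t] by (cases "0 \<le> t") auto
qed

end

section \<open>Essential uniqueness of the generator\<close>

context elliptical_law
begin

definition has_copula_law :: "(real^'n) measure \<Rightarrow> bool" where
  "has_copula_law P \<longleftrightarrow> uniform_margins P \<and> (\<forall>x. joint_cdf \<mu> x = joint_cdf P (\<chi> k. F (x $ k)))"

lemma F_bounds: "0 \<le> F t" "F t \<le> 1"
proof -
  interpret real_distribution "density lborel (gen_marginal_density CARD('n) g)"
    by (rule real_distribution_marginal)
  show "0 \<le> F t" "F t \<le> 1" unfolding F_def by simp_all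
qed

text \<open>The hypothesis fixes the cdf of \<open>U\<close> on the cube only; a law with uniform
  margins and the same values there takes the place of the law of \<open>U\<close>.\<close>

lemma meta_elliptical_copula_law:
  assumes "meta_elliptical M U S g"
  obtains P where "has_copula_law P"
    "\<forall>u. (\<forall>k. u $ k \<in> {0..1}) \<longrightarrow> joint_cdf (distr M borel U) u = joint_cdf P u"
proof -
  let ?C = "joint_cdf (distr M borel U)"
  have cop: "is_copula ?C" "\<And>x. joint_cdf \<mu> x = ?C (\<chi> k. F (x $ k))"
    using assms unfolding meta_elliptical_def copula_of_def \<mu>_def[symmetric] cdf_component by blast+
  then obtain P where P: "uniform_margins P" "\<And>u. (\<forall>k. u $ k \<in> {0..1}) \<Longrightarrow> ?C u = joint_cdf P u"
    unfolding is_copula_def uniform_margins_def by blast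
  have "has_copula_law P"
    unfolding has_copula_law_def using P cop(2) F_bounds by simp
  with P(2) that show ?thesis by blast
qed

lemma quantile_transform:
  assumes "has_copula_law P"
  obtains Q where "Q \<in> borel_measurable borel" "\<mu> = distr P borel Q"
    "AE w in P. \<forall>k x. Q w $ k \<le> x \<longleftrightarrow> w $ k \<le> F x"
proof -
  have cdf: "cdf (density lborel (gen_marginal_density CARD('n) g)) = F"
    by (rule ext) (simp add: F_def cdf_def)
  show ?thesis
    using assms copula_quantile_transform[OF prob_space_mu sets_mu real_distribution_marginal distr_mu_component, of P]
    unfolding has_copula_law_def cdf using that by blast
qed

text \<open>By the quantile equivalence, \<open>x $ k < Q w $ k\<close> means
  \<open>F (x $ k) < w $ k\<close>, and likewise for the upper sides. Two elliptical laws with the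
  same copula can therefore be compared box by box.\<close>

lemma measure_hbox:
  assumes "has_copula_law P"
  shows "measure \<mu> (hbox x y) = measure P (hbox (\<chi> k. F (x $ k)) (\<chi> k. F (y $ k)))"
proof -
  have sets: "sets P = sets borel" using assms unfolding has_copula_law_def uniform_margins_def by blast
  obtain Q where Q: "Q \<in> borel_measurable borel" "\<mu> = distr P borel Q"
    and gal: "AE w in P. \<forall>k x. Q w $ k \<le> x \<longleftrightarrow> w $ k \<le> F x"
    using quantile_transform[OF assms] .
  have QP: "Q \<in> borel_measurable P" using Q(1) sets by (simp cong: measurable_cong_sets)
  have "emeasure \<mu> (hbox x y) = emeasure P (Q -` hbox x y \<inter> space P)"
    unfolding Q(2) by (rule emeasure_distr[OF QP borel_hbox])
  also have "\<dots> = emeasure P (hbox (\<chi> k. F (x $ k)) (\<chi> k. F (y $ k)))"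
  proof (rule emeasure_eq_AE)
    show "AE w in P. w \<in> Q -` hbox x y \<inter> space P \<longleftrightarrow> w \<in> hbox (\<chi> k. F (x $ k)) (\<chi> k. F (y $ k))"
      using gal
    proof eventually_elim
      case (elim w)
      have "x $ k < Q w $ k \<longleftrightarrow> F (x $ k) < w $ k" for k
        using elim[rule_format, of k "x $ k"] by linarith
      then show ?case using elim sets_eq_imp_space_eq[OF sets] by (simp add: hbox_def)
    qed
    show "Q -` hbox x y \<inter> space P \<in> sets P" by (rule measurable_sets[OF QP borel_hbox])
  qed (simp add: sets)
  finally show ?thesis by (simp add: measure_def)
qed

lemma emeasure_quadrant:
  assumes "has_copula_law P"
  shows "emeasure \<mu> {x. x $ i \<le> 0 \<and> x $ j \<le> 0} = emeasure P {w. w $ i \<le> 1 / 2 \<and> w $ j \<le> 1 / 2}"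
proof -
  have sets: "sets P = sets borel" using assms unfolding has_copula_law_def uniform_margins_def by blast
  obtain Q where Q: "Q \<in> borel_measurable borel" "\<mu> = distr P borel Q"
    and gal: "AE w in P. \<forall>k x. Q w $ k \<le> x \<longleftrightarrow> w $ k \<le> F x"
    using quantile_transform[OF assms] .
  have QP: "Q \<in> borel_measurable P" using Q(1) sets by (simp cong: measurable_cong_sets)
  have quadrant: "{x :: real^'n. x $ i \<le> r \<and> x $ j \<le> r} \<in> sets borel" for r
    by (intro borel_closed closed_Collect_conj closed_Collect_le continuous_intros)
  have "emeasure \<mu> {x. x $ i \<le> 0 \<and> x $ j \<le> 0} = emeasure P (Q -` {x. x $ i \<le> 0 \<and> x $ j \<le> 0} \<inter> space P)"
    unfolding Q(2) by (rule emeasure_distr[OF QP quadrant])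
  also have "\<dots> = emeasure P {w. w $ i \<le> 1 / 2 \<and> w $ j \<le> 1 / 2}"
  proof (rule emeasure_eq_AE)
    show "AE w in P. w \<in> Q -` {x. x $ i \<le> 0 \<and> x $ j \<le> 0} \<inter> space P \<longleftrightarrow> w \<in> {w. w $ i \<le> 1 / 2 \<and> w $ j \<le> 1 / 2}"
      using gal
    proof eventually_elim
      case (elim w)
      then show ?case using sets_eq_imp_space_eq[OF sets] by (simp add: F_zero)
    qed
    show "Q -` {x. x $ i \<le> 0 \<and> x $ j \<le> 0} \<inter> space P \<in> sets P" by (rule measurable_sets[OF QP quadrant])
  qed (simp only: sets quadrant)
  finally show ?thesis .
qed

end

text \<open>The common copula gives both laws the same quadrant probabilities, as both marginal
  medians are 0; equal wedge volumes then force equal correlations, whatever the generators.\<close>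

lemma copula_determines_correlation:
  assumes E1: "elliptical_law S1 g1" and E2: "elliptical_law S2 g2"
    and P: "elliptical_law.has_copula_law S1 g1 P" "elliptical_law.has_copula_law S2 g2 P"
  shows "S1 = S2"
proof (simp only: vec_eq_iff, intro allI)
  fix i j
  show "S1 $ i $ j = S2 $ i $ j"
  proof (cases "i = j")
    case True
    then show ?thesis using elliptical_law.S[OF E1] elliptical_law.S[OF E2]
      unfolding pd_correlation_matrix_def by simp
  next
    case False
    have "emeasure lborel (wedge i j (S1 $ i $ j) \<inter> cball 0 1) = emeasure lborel (wedge i j (S2 $ i $ j) \<inter> cball 0 1)"
      using elliptical_law.prob_quadrant[OF E1 False] elliptical_law.prob_quadrant[OF E2 False]
        elliptical_law.emeasure_quadrant[OF E1 P(1), of i j] elliptical_law.emeasure_quadrant[OF E2 P(2), of i j]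
      by simp
    moreover have "\<bar>S1 $ i $ j\<bar> < 1" "\<bar>S2 $ i $ j\<bar> < 1"
      using elliptical_law.S[OF E1] elliptical_law.S[OF E2] False by (auto intro: pd_correlation_abs_less_one)
    ultimately show ?thesis
      using wedge_volume_strict_mono[OF False, of "S1 $ i $ j" "S2 $ i $ j"]
        wedge_volume_strict_mono[OF False, of "S2 $ i $ j" "S1 $ i $ j"]
      by (metis less_irrefl linorder_neqE_linordered_idom)
  qed
qed

text \<open>The diagonal entry is the squared norm of a whitened unit vector whose
  \<open>i\<close>-th coordinate is still 1.\<close>

lemma (in elliptical_law) inverse_diag_ge_one: "1 \<le> matrix_inv S $ i $ i"
proof -
  obtain j where "i \<noteq> j" using other_index[of i] by metis
  then obtain L where L: "\<And>x. (norm (L *v x))\<^sup>2 = quad x" "\<And>x. (L *v x) $ i = x $ i"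
    using pd_correlation_whitening[OF S] by metis
  have "1 = \<bar>(L *v axis i 1) $ i\<bar>" unfolding L(2) by simp
  also have "\<dots> \<le> norm (L *v axis i 1)" by (rule component_le_norm_cart)
  finally have "1 \<le> (norm (L *v axis i 1))\<^sup>2" by (simp add: one_le_power)
  then show ?thesis unfolding L(1) by (simp add: axis_inner_matrix)
qed

lemma (in elliptical_law) quad_two_axes:
  "quad (x *\<^sub>R axis i 1 + y *\<^sub>R axis j 1) =
    matrix_inv S $ i $ i * x\<^sup>2 + 2 * matrix_inv S $ i $ j * x * y + matrix_inv S $ j $ j * y\<^sup>2"
proof -
  have "matrix_inv S $ j $ i = matrix_inv S $ i $ j"
    using positive_definite_symm[OF positive_definite_matrix_inv[OF positive_definite_S], of "axis i 1" "axis j 1"]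
    by (simp add: axis_inner_matrix)
  then show ?thesis
    by (simp add: matrix_vector_right_distrib matrix_vector_mult_scaleR inner_add_left inner_add_right
        axis_inner_matrix power2_eq_square algebra_simps)
qed

text \<open>\<open>density_transport\<close> at a point of the plane of coordinates \<open>i\<close>
  and \<open>j\<close>. The common determinant cancels, and the boxes match because
  \<open>F2 (T x) = F1 x\<close>.\<close>

lemma regular_transported_pair:
  fixes S :: "real^'n^'n"
  assumes R1: "regular_law S g1" and R2: "regular_law S g2"
    and P: "elliptical_law.has_copula_law S g1 P" "elliptical_law.has_copula_law S g2 P"
    and f0: "gen_marginal_density CARD('n) g1 0 = gen_marginal_density CARD('n) g2 0"
    and ij: "i \<noteq> j" "matrix_inv S $ i $ j \<noteq> 0"
  shows "transported_pair (regular_law.G g1) (regular_law.f TYPE('n) g1) (elliptical_law.F TYPE('n) g1) (regular_law.a g1)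
    (regular_law.G g2) (regular_law.f TYPE('n) g2) (elliptical_law.F TYPE('n) g2) (regular_law.a g2)
    (matrix_inv S $ i $ i) (matrix_inv S $ j $ j) (matrix_inv S $ i $ j)"
proof -
  interpret E1: regular_law S g1 by (rule R1)
  interpret E2: regular_law S g2 by (rule R2)
  interpret PP: profile_pair E1.G E1.f E1.F E1.a E2.G E2.f E2.F E2.a
    by unfold_locales (simp add: E1.f_def E2.f_def f0)
  show ?thesis
  proof (unfold_locales)
    show "1 \<le> matrix_inv S $ i $ i" by (rule E1.inverse_diag_ge_one)
    show "0 < matrix_inv S $ j $ j" using E1.inverse_diag_ge_one[of j] by simp
    show "matrix_inv S $ i $ j \<noteq> 0" by (rule ij)
    fix x y
    assume dom: "ereal \<bar>x\<bar> < E1.a" "ereal \<bar>y\<bar> < E1.a"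
    let ?q = "\<lambda>x y. matrix_inv S $ i $ i * x\<^sup>2 + 2 * matrix_inv S $ i $ j * x * y + matrix_inv S $ j $ j * y\<^sup>2"
    assume ne: "ereal (sqrt (?q x y)) \<noteq> E1.a" "ereal (sqrt (?q (PP.T x) (PP.T y))) \<noteq> E2.a"
    define v :: "real \<Rightarrow> real \<Rightarrow> real^'n" where "v x y = x *\<^sub>R axis i 1 + y *\<^sub>R axis j 1" for x y
    have v: "v x y $ k = (if k = i then x else if k = j then y else 0)" for x y k
      using ij(1) unfolding v_def by (simp add: axis_def)
    have quad: "E1.quad (v x y) = ?q x y" for x y
      unfolding v_def by (rule E1.quad_two_axes)
    have Tv: "(\<chi> k. PP.T (v x y $ k)) = v (PP.T x) (PP.T y)"
      by (simp add: vec_eq_iff v PP.T_zero)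
    have "E1.p (v x y) = E2.p (\<chi> k. PP.T (v x y $ k)) * (\<Prod>k\<in>UNIV. inverse (PP.W (v x y $ k)))"
    proof (rule density_transport[where I = "{t. ereal \<bar>t\<bar> < E1.a}"])
      show "v x y $ k \<in> {t. ereal \<bar>t\<bar> < E1.a}" for k
        using dom PP.zero_domain(1) by (simp add: v)
      show "strict_mono_on {t. ereal \<bar>t\<bar> < E1.a} PP.T"
        using PP.T_strict_mono by (intro strict_mono_onI) auto
      show "(PP.T has_real_derivative inverse (PP.W t)) (at t)" if "t \<in> {t. ereal \<bar>t\<bar> < E1.a}" for t
        using PP.T_deriv that by simp
      show "isCont E1.p (v x y)" using ne(1) by (intro E1.isCont_p) (simp add: quad)
      show "isCont E2.p (\<chi> k. PP.T (v x y $ k))"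
        unfolding Tv using ne(2) by (intro E2.isCont_p) (simp add: quad)
      fix z assume z: "\<And>k. v x y $ k < z $ k \<and> z $ k \<in> {t. ereal \<bar>t\<bar> < E1.a}"
      have "E2.F (PP.T (v x y $ k)) = E1.F (v x y $ k)" "E2.F (PP.T (z $ k)) = E1.F (z $ k)" for k
        using z[of k] dom PP.zero_domain(1) by (auto intro!: PP.F2_T simp: v)
      then show "measure (density lborel (\<lambda>z. ennreal (E1.p z))) (hbox (v x y) z) =
          measure (density lborel (\<lambda>z. ennreal (E2.p z))) (hbox (\<chi> k. PP.T (v x y $ k)) (\<chi> k. PP.T (z $ k)))"
        unfolding E1.mu_density_p[symmetric] E2.mu_density_p[symmetric] E1.measure_hbox[OF P(1)] E2.measure_hbox[OF P(2)]
        by simp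
    qed (fact E1.open_domain E1.measurable_p E2.measurable_p E1.p_nonneg E2.p_nonneg)+
    \<comment> \<open>All other coordinates are 0, where \<open>T\<close> has derivative 1, so only
      two Jacobian factors remain.\<close>
    also have "(\<Prod>k\<in>UNIV. inverse (PP.W (v x y $ k))) = inverse (PP.W x) * inverse (PP.W y)"
    proof -
      have "(\<Prod>k\<in>UNIV. inverse (PP.W (v x y $ k))) = (\<Prod>k\<in>{i, j}. inverse (PP.W (v x y $ k)))"
        by (rule prod.mono_neutral_right) (auto simp: v PP.W_zero)
      then show ?thesis using ij(1) by (simp add: v)
    qed
    finally have "E1.G (sqrt (?q x y)) = E2.G (sqrt (?q (PP.T x) (PP.T y))) * (inverse (PP.W x) * inverse (PP.W y))"
      using E1.det_pos unfolding E1.p_def E2.p_def Tv quad by (simp add: field_simps)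
    then show "E1.G (sqrt (?q x y)) * (PP.W x * PP.W y) = E2.G (sqrt (?q (PP.T x) (PP.T y)))"
      using PP.W_pos[OF dom(1)] PP.W_pos[OF dom(2)] by (simp add: field_simps)
  qed
qed

section \<open>The support of a regular generator\<close>

context regular_law
begin

lemma g_sqrt: "0 \<le> t \<Longrightarrow> g t = ennreal (G (sqrt t))"
  by (simp add: ennreal_G)

lemma support_lower: "0 \<le> t \<Longrightarrow> ereal (sqrt t) < a \<Longrightarrow> t \<in> gen_support g"
  using inside(1)[of "sqrt t"] by (simp add: gen_support_def)

lemma support_upper: "t \<in> gen_support g \<Longrightarrow> 0 \<le> t \<and> ereal (sqrt t) \<le> a"
  using outside[of "sqrt t"] unfolding gen_support_def by (auto simp: not_less[symmetric])

lemma sqrt_less_radius: "s < t \<Longrightarrow> ereal (sqrt t) \<le> a \<Longrightarrow> ereal (sqrt s) < a"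
  by (rule less_le_trans[of _ "ereal (sqrt t)"]) simp_all

lemma is_interval_support: "is_interval (gen_support g)"
  unfolding is_interval_1
proof (intro ballI allI impI)
  fix s r t assume st: "s \<in> gen_support g" "r \<in> gen_support g" and t: "s \<le> t \<and> t \<le> r"
  have "0 \<le> t" using support_upper[OF st(1)] t by simp
  show "t \<in> gen_support g"
  proof (cases "t = r")
    case False
    then have "t < r" using t by simp
    then show ?thesis
      using support_upper[OF st(2)] \<open>0 \<le> t\<close> by (intro support_lower sqrt_less_radius[of t r]) auto
  qed (use st in simp)
qed

lemma interior_support: "interior (gen_support g) = {t. 0 < t \<and> ereal (sqrt t) < a}"
proof (rule interior_unique)
  show "{t. 0 < t \<and> ereal (sqrt t) < a} \<subseteq> gen_support g" using support_lower by auto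
  show "open {t. 0 < t \<and> ereal (sqrt t) < a}"
    by (intro open_Collect_conj open_Collect_less continuous_intros)
  fix T assume T: "T \<subseteq> gen_support g" "open T"
  show "T \<subseteq> {t. 0 < t \<and> ereal (sqrt t) < a}"
  proof
    fix t assume "t \<in> T"
    then obtain e where e: "0 < e" "ball t e \<subseteq> T" using T(2) by (auto simp: open_contains_ball)
    then have "t - e / 2 \<in> gen_support g" "t + e / 2 \<in> gen_support g"
      using T(1) by (auto simp: subset_iff dist_real_def)
    from this[THEN support_upper] have "0 \<le> t - e / 2" "ereal (sqrt (t + e / 2)) \<le> a" by auto
    with e show "t \<in> {t. 0 < t \<and> ereal (sqrt t) < a}"
      using sqrt_less_radius[of t "t + e / 2"] by simp
  qed
qed

lemma closure_support: "closure (gen_support g) = {t. 0 \<le> t \<and> ereal (sqrt t) \<le> a}"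
proof
  have "closed {t. 0 \<le> t \<and> ereal (sqrt t) \<le> a}"
    by (intro closed_Collect_conj closed_Collect_le continuous_intros)
  then show "closure (gen_support g) \<subseteq> {t. 0 \<le> t \<and> ereal (sqrt t) \<le> a}"
    using support_upper by (intro closure_minimal) auto
  show "{t. 0 \<le> t \<and> ereal (sqrt t) \<le> a} \<subseteq> closure (gen_support g)"
  proof
    fix t assume "t \<in> {t. 0 \<le> t \<and> ereal (sqrt t) \<le> a}"
    then have t: "0 \<le> t" "ereal (sqrt t) \<le> a" by auto
    show "t \<in> closure (gen_support g)"
    proof (cases "t = 0")
      case True
      then have "t \<in> gen_support g" using a_pos by (intro support_lower) (auto simp: zero_ereal_def)
      then show ?thesis using closure_subset by blast
    next
      case False
      show ?thesis unfolding closure_approachable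
      proof (intro allI impI)
        fix e :: real assume e: "0 < e"
        define s where "s = t - min t e / 2"
        have s: "0 \<le> s" "s < t" "dist s t < e" using t False e unfolding s_def by (auto simp: dist_real_def)
        have "s \<in> gen_support g" using s(1) sqrt_less_radius[OF s(2) t(2)] by (rule support_lower)
        with s(3) show "\<exists>y\<in>gen_support g. dist y t < e" by blast
      qed
    qed
  qed
qed

end

theorem proposition3:
  fixes M :: "'a measure" and U :: "'a \<Rightarrow> real^'n"
    and \<Sigma> \<Sigma>1 \<Sigma>2 :: "real^'n^'n" and g g1 g2 :: "real \<Rightarrow> ennreal"
    and i j :: 'n and b :: real
    and c :: "real \<Rightarrow> real \<Rightarrow> ennreal"
  defines "c \<equiv> density_slice \<Sigma> g i j"
  assumes "2 \<le> CARD('n)"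
    and "prob_space M" and "U \<in> borel_measurable M"
    and "pd_correlation_matrix \<Sigma>" and "\<Sigma> \<noteq> mat 1" and "density_generator CARD('n) g"
    and "meta_elliptical M U \<Sigma> g"
    and "i \<noteq> j" and "matrix_inv \<Sigma> $ i $ j \<noteq> 0"
    and "\<forall>u\<in>{0<..<1}. \<forall>v\<in>{0<..<1}. c u v < \<infinity>
           \<and> (\<lambda>s. enn2real (c s v)) differentiable (at u)
           \<and> (\<lambda>s. enn2real (c u s)) differentiable (at v)"
    and "\<forall>u\<in>{0<..<1}. (\<lambda>s. ln (enn2real (c s (1/2)))) differentiable (at u)
           \<and> (\<lambda>s. ln (enn2real (c u s))) differentiable (at (1/2))"
    and "locally_lipschitz_on {0<..<1} (\<lambda>u. deriv (\<lambda>s. ln (enn2real (c s (1/2)))) u)"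
    and "locally_lipschitz_on {0<..<1} (\<lambda>u. deriv (\<lambda>s. ln (enn2real (c u s))) (1/2))"
    and "0 < b"
    and "pd_correlation_matrix \<Sigma>1" and "regular_generator CARD('n) g1"
    and "pd_correlation_matrix \<Sigma>2" and "regular_generator CARD('n) g2"
    and "meta_elliptical M U \<Sigma>1 g1" and "meta_elliptical M U \<Sigma>2 g2"
    and "ennreal b = ennreal (pi powr ((real CARD('n) - 1) / 2) / Gamma ((real CARD('n) - 1) / 2)) *
           (\<integral>\<^sup>+s\<in>{0<..}. g1 s * ennreal (s powr ((real CARD('n) - 3) / 2)) \<partial>lborel)"
    and "ennreal b = ennreal (pi powr ((real CARD('n) - 1) / 2) / Gamma ((real CARD('n) - 1) / 2)) *
           (\<integral>\<^sup>+s\<in>{0<..}. g2 s * ennreal (s powr ((real CARD('n) - 3) / 2)) \<partial>lborel)"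
  shows "\<Sigma>1 = \<Sigma>2
    \<and> is_interval (gen_support g1) \<and> is_interval (gen_support g2)
    \<and> interior (gen_support g1) = interior (gen_support g2)
    \<and> closure (gen_support g1) = closure (gen_support g2)
    \<and> (\<forall>t \<in> interior (gen_support g1 \<inter> gen_support g2). g1 t = g2 t)"
proof -
  have regd: "density_generator CARD('n) g1" "density_generator CARD('n) g2"
    using \<open>regular_generator CARD('n) g1\<close> \<open>regular_generator CARD('n) g2\<close>
    unfolding regular_generator_def by blast+
  interpret E: elliptical_law \<Sigma> g
    using \<open>2 \<le> CARD('n)\<close> \<open>pd_correlation_matrix \<Sigma>\<close> \<open>density_generator CARD('n) g\<close> by unfold_locales
  interpret E1: regular_law \<Sigma>1 g1
    using \<open>2 \<le> CARD('n)\<close> \<open>pd_correlation_matrix \<Sigma>1\<close> \<open>regular_generator CARD('n) g1\<close> regd(1) by unfold_locales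
  interpret E2: regular_law \<Sigma>2 g2
    using \<open>2 \<le> CARD('n)\<close> \<open>pd_correlation_matrix \<Sigma>2\<close> \<open>regular_generator CARD('n) g2\<close> regd(2) by unfold_locales
  let ?C = "joint_cdf (distr M borel U)"
  obtain P where P: "E.has_copula_law P" "\<forall>u. (\<forall>k. u $ k \<in> {0..1}) \<longrightarrow> ?C u = joint_cdf P u"
    using E.meta_elliptical_copula_law[OF \<open>meta_elliptical M U \<Sigma> g\<close>] .
  obtain P1 where P1: "E1.has_copula_law P1" "\<forall>u. (\<forall>k. u $ k \<in> {0..1}) \<longrightarrow> ?C u = joint_cdf P1 u"
    using E1.meta_elliptical_copula_law[OF \<open>meta_elliptical M U \<Sigma>1 g1\<close>] .
  obtain P2 where P2: "E2.has_copula_law P2" "\<forall>u. (\<forall>k. u $ k \<in> {0..1}) \<longrightarrow> ?C u = joint_cdf P2 u"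
    using E2.meta_elliptical_copula_law[OF \<open>meta_elliptical M U \<Sigma>2 g2\<close>] .
  \<comment> \<open>All three laws have uniform margins and the cdf of \<open>U\<close> on the cube,
    so a single law carries every copula statement.\<close>
  have "P1 = P" "P2 = P"
    using P P1 P2 unfolding E.has_copula_law_def E1.has_copula_law_def E2.has_copula_law_def
    by (auto intro!: uniform_margins_unique)
  then have law: "E1.has_copula_law P" "E2.has_copula_law P" using P1(1) P2(1) by simp_all
  \<comment> \<open>Comparison with the reference matrix \<open>\<Sigma>\<close> gives equality of
    the two and makes the nonzero entry of its inverse available for both.\<close>
  have S1: "\<Sigma>1 = \<Sigma>"
    by (rule copula_determines_correlation[OF E1.elliptical_law_axioms E.elliptical_law_axioms law(1) P(1)])
  have S2: "\<Sigma>2 = \<Sigma>"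
    by (rule copula_determines_correlation[OF E2.elliptical_law_axioms E.elliptical_law_axioms law(2) P(1)])
  \<comment> \<open>The quantity \<open>b\<close> is the marginal density at 0; fixing it removes
    the freedom of rescaling the generator.\<close>
  have f0: "gen_marginal_density CARD('n) g1 0 = gen_marginal_density CARD('n) g2 0"
    using assms(22,23) by (simp add: gen_marginal_density_def)
  interpret TP: transported_pair E1.G E1.f E1.F E1.a E2.G E2.f E2.F E2.a
    "matrix_inv \<Sigma> $ i $ i" "matrix_inv \<Sigma> $ j $ j" "matrix_inv \<Sigma> $ i $ j"
    using E1.regular_law_axioms E2.regular_law_axioms law \<open>i \<noteq> j\<close> \<open>matrix_inv \<Sigma> $ i $ j \<noteq> 0\<close> f0
    unfolding S1 S2 by (intro regular_transported_pair)
  show ?thesis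
  proof (intro conjI ballI)
    show "\<Sigma>1 = \<Sigma>2" by (simp add: S1 S2)
    show "is_interval (gen_support g1)" by (rule E1.is_interval_support)
    show "is_interval (gen_support g2)" by (rule E2.is_interval_support)
    show "interior (gen_support g1) = interior (gen_support g2)"
      by (simp only: E1.interior_support E2.interior_support TP.radius_eq)
    show "closure (gen_support g1) = closure (gen_support g2)"
      by (simp only: E1.closure_support E2.closure_support TP.radius_eq)
    fix t assume "t \<in> interior (gen_support g1 \<inter> gen_support g2)"
    then have "t \<in> interior (gen_support g1)" by (simp add: interior_Int)
    then have t: "0 < t" "ereal \<bar>sqrt t\<bar> < E1.a" by (auto simp: E1.interior_support)
    show "g1 t = g2 t"
      using t TP.G_eq_on_support[OF t(2)] by (simp add: E1.g_sqrt E2.g_sqrt)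
  qed
qed

end
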